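(* Let $V$ be a model of set theory and $\kappa$ an infinite ordinal. Suppose that $X,\mathscr{L}\in V$, with $X$ an infinite set and $\mathscr{L}$ a relational language, and that $V\models|X|\le\kappa$. Let $\mu\in V$ be a probability $\kappa$-measure on $[\mathrm{Str}^\kappa_{\mathscr{L}}(X)]^V$ and let $G$ be a $\mu$-random generic filter over $V$. Then $\mathcal{M}_G\models[\mathrm{Th}_\kappa(\mu)]^V$, where $\mathcal{M}_G$ is the $\mu$-random generic structure determined by $G$.
   Context: A model of set theory is a transitive model of ZFC. Structures and measures: $\mathrm{Str}_{\mathscr{L}}(X)$ is the set of $\mathscr{L}$-structures with underlying set $X$. An $\mathscr{L}$-literal is an atomic formula or a (possibly iterated) negation of one. $\sigma_\kappa(\mathrm{Str}_{\mathscr{L}}(X))$ is the smallest family of subsets of $\mathrm{Str}_{\mathscr{L}}(X)$ closed under complements and under unions of size $\le\kappa$ and containing all sets $\{\mathcal{M}:\mathcal{M}\models\varphi(\bar a)\}$ for $\varphi$ a literal and $\bar a$ a tuple from $X$. $\mathrm{Str}^\kappa_{\mathscr{L}}(X)$ is $\mathrm{Str}_{\mathscr{L}}(X)$ with this family of measurable sets. A probability $\kappa$-measure on it is a probability measure $\mu$ with $\mu(\bigcup_{i\in\kappa}A_i)=\sum_{i\in\kappa}\mu(A_i)$ for pairwise disjoint measurable $A_i$. Codes: the set $\mathbb{B}^\kappa_{\mathscr{L}:X}$ of $\kappa$-Borel codes is the smallest set containing the basic codes $\langle 0,\varphi,\bar a\rangle$ ($\varphi$ a finite conjunction of $\mathscr{L}$-literals,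 $\bar a$ a tuple from $X$) and closed under formal negation $\neg\gamma$ and formal $\bigvee\Gamma$, $\bigwedge\Gamma$ for $\Gamma=\{\gamma_i\}_{i\in\kappa}$. The interpretation $\mathrm{Int}(\gamma)\subseteq\mathrm{Str}_{\mathscr{L}}(X)$, computed in a given model, interprets basic codes as $\{\mathcal{M}:\mathcal{M}\models\varphi(\bar a)\}$ and $\neg,\bigvee,\bigwedge$ as complement, union, intersection. $\mu(\gamma)=\mu(\mathrm{Int}(\gamma))$. Almost-sure theory: $\mathcal{L}_{\kappa^+,\omega}(\mathscr{L})$ is the set of infinitary formulas built from atomic formulas by negation, quantification over single variables, and conjunctions and disjunctions of fewer than $\kappa^+$ formulas with free variables in a common finite set. When $|X|\le\kappa$, $\{\mathcal{M}\in\mathrm{Str}_{\mathscr{L}}(X):\mathcal{M}\models\varphi\}$ is measurable for each sentence $\varphi$ of this logic, and $\mathrm{Th}_\kappa(\mu)$ is the set of sentences $\varphi\in\mathcal{L}_{\kappa^+,\omega}(\mathscr{L})$ for which this set has $\mu$-measure $1$. Forcing: $\gamma\preceq_\mu\zeta$ means $\mu(\gamma\wedge\neg\zeta)=0$, and $\mathcal{O}^+(\mu)=(\{\gamma\in\mathbb{B}^\kappa_{\mathscr{L}:X}:\mu(\gamma)>0\},\preceq_\mu)$, a pre-order (smaller is stronger), computed in $V$. A $\mu$-random generic filter over $V$ is a filter on $\mathcal{O}^+(\mu)$ generic over $V$. For such $G$, $\mathcal{M}_G$ is the unique $\mathscr{L}$-structure with $V[G]\models\bigcap_{g\in G}\mathrm{Int}(g)=\{\mathcal{M}_G\}$.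 *)

theory Defs
  imports "HOL-Analysis.Infinite_Sum"
begin

section \<open>First-order ZFC and the ambient universe\<close>

datatype fo = FoMem nat nat | FoEq nat nat | FoNeg fo | FoAnd fo fo | FoAll nat fo

text \<open>Satisfaction of a formula of the language of set theory in the structure \<open>(M, E)\<close>.\<close>

primrec fo_sat :: "('a \<Rightarrow> 'a \<Rightarrow> bool) \<Rightarrow> 'a set \<Rightarrow> (nat \<Rightarrow> 'a) \<Rightarrow> fo \<Rightarrow> bool" where
  "fo_sat E M e (FoMem i j) \<longleftrightarrow> E (e i) (e j)"
| "fo_sat E M e (FoEq i j) \<longleftrightarrow> e i = e j"
| "fo_sat E M e (FoNeg p) \<longleftrightarrow> \<not> fo_sat E M e p"
| "fo_sat E M e (FoAnd p q) \<longleftrightarrow> fo_sat E M e p \<and> fo_sat E M e q"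
| "fo_sat E M e (FoAll n p) \<longleftrightarrow> (\<forall>x\<in>M. fo_sat E M (e(n := x)) p)"

text \<open>\<open>(M, E)\<close> is a model of ZFC: extensionality, foundation, pairing, union, power set, infinity,
  choice (pairwise disjoint families of nonempty sets have transversals), and the schemes of
  separation and replacement, with parameters given by the assignment \<open>e\<close>.\<close>

definition zfc_model :: "('a \<Rightarrow> 'a \<Rightarrow> bool) \<Rightarrow> 'a set \<Rightarrow> bool" where
  "zfc_model E M \<longleftrightarrow>
     M \<noteq> {} \<and>
     (\<forall>x\<in>M. \<forall>y\<in>M. (\<forall>z\<in>M. E z x \<longleftrightarrow> E z y) \<longrightarrow> x = y) \<and>
     (\<forall>x\<in>M. (\<exists>y\<in>M. E y x) \<longrightarrow> (\<exists>y\<in>M. E y x \<and> \<not> (\<exists>z\<in>M. E z x \<and> E z y))) \<and>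
     (\<forall>x\<in>M. \<forall>y\<in>M. \<exists>z\<in>M. \<forall>w\<in>M. E w z \<longleftrightarrow> w = x \<or> w = y) \<and>
     (\<forall>x\<in>M. \<exists>u\<in>M. \<forall>z\<in>M. E z u \<longleftrightarrow> (\<exists>y\<in>M. E y x \<and> E z y)) \<and>
     (\<forall>x\<in>M. \<exists>p\<in>M. \<forall>z\<in>M. E z p \<longleftrightarrow> (\<forall>w\<in>M. E w z \<longrightarrow> E w x)) \<and>
     (\<exists>i\<in>M. (\<exists>z\<in>M. E z i \<and> (\<forall>w\<in>M. \<not> E w z)) \<and>
        (\<forall>x\<in>M. E x i \<longrightarrow> (\<exists>s\<in>M. E s i \<and> (\<forall>w\<in>M. E w s \<longleftrightarrow> E w x \<or> w = x)))) \<and>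
     (\<forall>a\<in>M. (\<forall>x\<in>M. E x a \<longrightarrow> (\<exists>z\<in>M. E z x)) \<and>
             (\<forall>x\<in>M. \<forall>y\<in>M. E x a \<and> E y a \<and> x \<noteq> y \<longrightarrow> \<not> (\<exists>z\<in>M. E z x \<and> E z y)) \<longrightarrow>
        (\<exists>c\<in>M. \<forall>x\<in>M. E x a \<longrightarrow> (\<exists>!z. z \<in> M \<and> E z x \<and> E z c))) \<and>
     (\<forall>p e. \<forall>a\<in>M. range e \<subseteq> M \<longrightarrow>
        (\<exists>b\<in>M. \<forall>x\<in>M. E x b \<longleftrightarrow> E x a \<and> fo_sat E M (e(0 := x)) p)) \<and>
     (\<forall>p e. \<forall>a\<in>M. range e \<subseteq> M \<and>
             (\<forall>x\<in>M. E x a \<longrightarrow> (\<exists>!y. y \<in> M \<and> fo_sat E M (e(0 := x, 1 := y)) p)) \<longrightarrow>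
        (\<exists>b\<in>M. \<forall>y\<in>M. E y b \<longleftrightarrow> (\<exists>x\<in>M. E x a \<and> fo_sat E M (e(0 := x, 1 := y)) p)))"

text \<open>The universe in which the mathematics takes place: a (possibly proper-class-sized, possibly
  small) well-founded model of ZFC.  Its sets are the elements of the type; HOL sets over the type
  play the role of classes.  Transitive models of ZFC are transitive HOL sets of such a type.\<close>

class set_universe =
  fixes mem :: "'a \<Rightarrow> 'a \<Rightarrow> bool"
  assumes wfp_mem: "wfp mem"
    and zfc_UNIV: "zfc_model mem UNIV"

definition elts :: "'u::set_universe \<Rightarrow> 'u set" where
  "elts x = {y. mem y x}"

definition model_of_set_theory :: "'u::set_universe set \<Rightarrow> bool" where
  "model_of_set_theory V \<longleftrightarrow> (\<forall>x\<in>V. elts x \<subseteq> V) \<and> zfc_model mem V"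

text \<open>\<open>vset S\<close> is the set with elements \<open>S\<close>; meaningful only if the class \<open>S\<close> is a set of the
  universe, which is the case wherever it is used below.\<close>

definition vset :: "'u::set_universe set \<Rightarrow> 'u" where
  "vset S = (THE x. elts x = S)"

definition pair :: "'u::set_universe \<Rightarrow> 'u \<Rightarrow> 'u" where
  "pair x y = vset {vset {x}, vset {x, y}}"

primrec vnat :: "nat \<Rightarrow> 'u::set_universe" where
  "vnat 0 = vset {}"
| "vnat (Suc n) = vset (insert (vnat n) (elts (vnat n)))"

definition tuple :: "'u::set_universe list \<Rightarrow> 'u" where
  "tuple as = vset {pair (vnat i) (as ! i) |i. i < length as}"

definition tag :: "nat \<Rightarrow> 'u::set_universe \<Rightarrow> 'u" where
  "tag k x = pair (vnat k) x"


lemmas zfc_universe = zfc_UNIV[unfolded zfc_model_def ball_UNIV bex_UNIV, THEN conjunct2]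
lemmas universe_ext = zfc_universe[THEN conjunct1, rule_format]
lemmas universe_pairing = zfc_universe[THEN conjunct2, THEN conjunct2, THEN conjunct1, rule_format]
lemmas universe_union =
  zfc_universe[THEN conjunct2, THEN conjunct2, THEN conjunct2, THEN conjunct1, rule_format]
lemmas universe_infinity = zfc_universe[THEN conjunct2, THEN conjunct2, THEN conjunct2,
  THEN conjunct2, THEN conjunct2, THEN conjunct1]

lemma elts_inject: "elts x = elts y \<Longrightarrow> x = (y :: 'u::set_universe)"
  by (rule universe_ext) (auto simp: elts_def)

lemma elts_vsetI: "elts x = S \<Longrightarrow> elts (vset S) = S"
  unfolding vset_def by (rule theI[of _ x]) (auto intro: elts_inject)

lemma ex_upair: "\<exists>z :: 'u::set_universe. elts z = {x, y}"
  using universe_pairing[of x y] unfolding elts_def by blast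

lemma ex_insert: "\<exists>z :: 'u::set_universe. elts z = insert x (elts y)"
proof -
  obtain s where s: "elts s = {x, x}" using ex_upair by blast
  obtain t where t: "elts t = {s, y}" using ex_upair by blast
  obtain u where "\<forall>z. mem z u \<longleftrightarrow> (\<exists>y. mem y t \<and> mem z y)"
    using universe_union[of t] by blast
  then have "elts u = (\<Union>y\<in>elts t. elts y)" unfolding elts_def by auto
  then show ?thesis using s t by auto
qed

lemma ex_empty: "\<exists>z :: 'u::set_universe. elts z = {}"
  using universe_infinity unfolding elts_def by blast

lemma elts_vset_finite [simp]:
  fixes S :: "'u::set_universe set"
  assumes "finite S"
  shows "elts (vset S) = S"
proof -
  have "\<exists>z. elts z = S" using assms
  proof induction
    case empty
    show ?case by (rule ex_empty)
  next
    case (insert x F)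
    then show ?case by (metis ex_insert)
  qed
  then show ?thesis using elts_vsetI by blast
qed

lemma vset_finite_inject: "finite S \<Longrightarrow> finite T \<Longrightarrow> vset S = vset T \<longleftrightarrow> S = T"
  by (metis elts_vset_finite)

lemma pair_inject [simp]: "pair a b = pair c d \<longleftrightarrow> a = c \<and> b = d"
proof -
  have "pair a b = pair c d \<longleftrightarrow> {{a}, {a, b}} = {{c}, {c, d}}"
    unfolding pair_def by (simp add: vset_finite_inject doubleton_eq_iff)
  then show ?thesis by (auto simp: doubleton_eq_iff)
qed

lemma mem_irrefl: "\<not> mem x (x :: 'u::set_universe)"
  using wfp_mem wfp_imp_irreflp irreflpD by metis

lemma elts_vnat: "elts (vnat n :: 'u::set_universe) = vnat ` {..<n}"
proof (induction n)
  case 0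
  show ?case by simp
next
  case (Suc n)
  then have "finite (elts (vnat n :: 'u))" by simp
  then show ?case using Suc by (simp add: lessThan_Suc)
qed

lemma vnat_neq: "m < n \<Longrightarrow> vnat m \<noteq> (vnat n :: 'u::set_universe)"
proof
  assume less: "m < n" and eq: "vnat m = (vnat n :: 'u)"
  have "(vnat m :: 'u) \<in> elts (vnat n)" using less by (simp add: elts_vnat)
  then show False using eq by (simp add: elts_def mem_irrefl)
qed

lemma vnat_inject [simp]: "vnat m = (vnat n :: 'u::set_universe) \<longleftrightarrow> m = n"
  by (metis vnat_neq linorder_neqE_nat)

lemma tag_inject [simp]: "tag k x = tag l y \<longleftrightarrow> k = l \<and> x = y"
  by (simp add: tag_def)

lemma elts_tuple: "elts (tuple as) = {pair (vnat i) (as ! i) |i. i < length as}"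
  unfolding tuple_def by simp

lemma tuple_inject [simp]: "tuple as = tuple bs \<longleftrightarrow> as = bs"
proof
  assume eq: "tuple as = tuple bs"
  have *: "pair (vnat i) a \<in> elts (tuple cs) \<longleftrightarrow> i < length cs \<and> a = cs ! i" for i a and cs :: "'a list"
    unfolding elts_tuple by auto
  have **: "i < length as \<and> a = as ! i \<longleftrightarrow> i < length bs \<and> a = bs ! i" for i a
    using *[of i a as] *[of i a bs] eq by simp
  have "length as = length bs" using ** by (metis linorder_neqE_nat order_less_irrefl)
  then show "as = bs" using ** by (metis nth_equalityI)
qed simp

text \<open>Well-founded recursion along the transitive closure of membership.\<close>

definition below :: "('u::set_universe \<times> 'u) set" where
  "below = {(x, y). mem x y}\<^sup>+"

lemma wf_below: "wf below"
  using wfp_mem unfolding below_def wfp_def by (rule wf_trancl)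

lemma below_mem: "mem x y \<Longrightarrow> (x, y) \<in> below"
  unfolding below_def by auto

lemma below_trans: "(x, y) \<in> below \<Longrightarrow> (y, z) \<in> below \<Longrightarrow> (x, z) \<in> below"
  unfolding below_def by auto

lemma below_pair: "(x, pair x y) \<in> below" "(y, pair x y) \<in> below"
proof -
  have m: "mem x (vset {x})" "mem y (vset {x, y})"
    "mem (vset {x}) (pair x y)" "mem (vset {x, y}) (pair x y)"
    using elts_vset_finite[of "{x}"] elts_vset_finite[of "{x, y}"]
      elts_vset_finite[of "{vset {x}, vset {x, y}}"]
    unfolding elts_def pair_def by auto
  show "(x, pair x y) \<in> below" "(y, pair x y) \<in> below"
    using m by (meson below_mem below_trans)+
qed

lemma below_tag: "(x, tag k x) \<in> below"
  unfolding tag_def by (rule below_pair)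

lemma below_tag_elts: "y \<in> elts x \<Longrightarrow> (y, tag k x) \<in> below"
  unfolding elts_def by (blast intro: below_mem below_trans below_tag)

lemma below_tag_pair: "(y, tag k (pair x y)) \<in> below"
  by (blast intro: below_pair below_trans below_tag)

declare conj_cong [fundef_cong]


section \<open>Notions relativised to a transitive model\<close>

text \<open>The graph of \<open>h\<close> restricted to the elements of \<open>A\<close> is a set of \<open>V\<close>, so quantifying over
  such \<open>h\<close> is quantifying over the functions with domain \<open>A\<close> in \<open>V\<close>.\<close>

definition fun_in :: "'u::set_universe set \<Rightarrow> 'u \<Rightarrow> ('u \<Rightarrow> 'u) \<Rightarrow> bool" where
  "fun_in V A h \<longleftrightarrow> (\<exists>f\<in>V. elts f = (\<lambda>x. pair x (h x)) ` elts A)"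

definition card_le :: "'u::set_universe set \<Rightarrow> 'u \<Rightarrow> 'u \<Rightarrow> bool" where
  "card_le V A B \<longleftrightarrow> (\<exists>h. fun_in V A h \<and> inj_on h (elts A) \<and> h ` elts A \<subseteq> elts B)"

definition is_ordinal :: "'u::set_universe \<Rightarrow> bool" where
  "is_ordinal a \<longleftrightarrow> (\<forall>x\<in>elts a. elts x \<subseteq> elts a) \<and> (\<forall>x\<in>elts a. \<forall>y\<in>elts x. elts y \<subseteq> elts x)"

text \<open>\<open>indexed_family V \<kappa> \<Gamma>\<close>: in \<open>V\<close>, the set \<open>\<Gamma>\<close> can be written as \<open>{\<gamma>\<^sub>i}\<^sub>i\<^sub>\<in>\<^sub>\<kappa>\<close>.\<close>

definition indexed_family :: "'u::set_universe set \<Rightarrow> 'u \<Rightarrow> 'u \<Rightarrow> bool" where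
  "indexed_family V \<kappa> \<Gamma> \<longleftrightarrow> \<Gamma> \<in> V \<and> (\<exists>h. fun_in V \<kappa> h \<and> elts \<Gamma> = h ` elts \<kappa>)"


section \<open>Languages, infinitary formulas, structures\<close>

text \<open>A relational language is a function assigning an arity to each relation symbol.\<close>

definition relational_language :: "'u::set_universe \<Rightarrow> bool" where
  "relational_language L \<longleftrightarrow> (\<exists>A ar. elts L = (\<lambda>R. pair R (vnat (ar R))) ` A)"

definition fRel :: "'u::set_universe \<Rightarrow> nat list \<Rightarrow> 'u" where
  "fRel R vs = tag 0 (pair R (tuple (map vnat vs)))"

definition fEq :: "nat \<Rightarrow> nat \<Rightarrow> 'u::set_universe" where
  "fEq i j = tag 1 (pair (vnat i) (vnat j))"

definition fNeg :: "'u::set_universe \<Rightarrow> 'u" where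
  "fNeg \<phi> = tag 2 \<phi>"

definition fEx :: "nat \<Rightarrow> 'u::set_universe \<Rightarrow> 'u" where
  "fEx n \<phi> = tag 3 (pair (vnat n) \<phi>)"

definition fAll :: "nat \<Rightarrow> 'u::set_universe \<Rightarrow> 'u" where
  "fAll n \<phi> = tag 4 (pair (vnat n) \<phi>)"

definition fConj :: "'u::set_universe \<Rightarrow> 'u" where
  "fConj \<Phi> = tag 5 \<Phi>"

definition fDisj :: "'u::set_universe \<Rightarrow> 'u" where
  "fDisj \<Phi> = tag 6 \<Phi>"

lemmas formula_defs = fRel_def fEq_def fNeg_def fEx_def fAll_def fConj_def fDisj_def

function free_vars :: "'u::set_universe \<Rightarrow> nat set" where
  "free_vars \<phi> = {v.
     (\<exists>R vs. \<phi> = fRel R vs \<and> v \<in> set vs) \<or>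
     (\<exists>i j. \<phi> = fEq i j \<and> v \<in> {i, j}) \<or>
     (\<exists>\<psi>. \<phi> = fNeg \<psi> \<and> v \<in> free_vars \<psi>) \<or>
     (\<exists>n \<psi>. \<phi> = fEx n \<psi> \<and> v \<noteq> n \<and> v \<in> free_vars \<psi>) \<or>
     (\<exists>n \<psi>. \<phi> = fAll n \<psi> \<and> v \<noteq> n \<and> v \<in> free_vars \<psi>) \<or>
     (\<exists>\<Phi>. \<phi> = fConj \<Phi> \<and> (\<exists>\<psi>\<in>elts \<Phi>. v \<in> free_vars \<psi>)) \<or>
     (\<exists>\<Phi>. \<phi> = fDisj \<Phi> \<and> (\<exists>\<psi>\<in>elts \<Phi>. v \<in> free_vars \<psi>))}"
  by auto
termination
  by (relation below)
     (auto simp: wf_below formula_defs intro: below_tag below_tag_elts below_tag_pair)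
declare free_vars.simps [simp del]

text \<open>A structure with underlying set \<open>X\<close> is encoded by its set of true relational facts
  \<open>(R, a\<^sub>1, \<dots>, a\<^sub>n)\<close>.  \<open>Str W L X\<close> is \<open>Str\<^sub>L(X)\<close> computed in \<open>W\<close>.\<close>

definition Str :: "'u::set_universe set \<Rightarrow> 'u \<Rightarrow> 'u \<Rightarrow> 'u set" where
  "Str W L X = {M \<in> W. elts M \<subseteq>
     {pair R (tuple as) |R as. pair R (vnat (length as)) \<in> elts L \<and> set as \<subseteq> elts X}}"

text \<open>\<open>fsat X M s \<phi>\<close>: the structure \<open>M\<close> on \<open>X\<close> satisfies \<open>\<phi>\<close> under the assignment \<open>s\<close>.\<close>

function fsat :: "'u::set_universe \<Rightarrow> 'u \<Rightarrow> (nat \<Rightarrow> 'u) \<Rightarrow> 'u \<Rightarrow> bool" where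
  "fsat X M s \<phi> \<longleftrightarrow>
     (\<exists>R vs. \<phi> = fRel R vs \<and> pair R (tuple (map s vs)) \<in> elts M) \<or>
     (\<exists>i j. \<phi> = fEq i j \<and> s i = s j) \<or>
     (\<exists>\<psi>. \<phi> = fNeg \<psi> \<and> \<not> fsat X M s \<psi>) \<or>
     (\<exists>n \<psi>. \<phi> = fEx n \<psi> \<and> (\<exists>x\<in>elts X. fsat X M (s(n := x)) \<psi>)) \<or>
     (\<exists>n \<psi>. \<phi> = fAll n \<psi> \<and> (\<forall>x\<in>elts X. fsat X M (s(n := x)) \<psi>)) \<or>
     (\<exists>\<Phi>. \<phi> = fConj \<Phi> \<and> (\<forall>\<psi>\<in>elts \<Phi>. fsat X M s \<psi>)) \<or>
     (\<exists>\<Phi>. \<phi> = fDisj \<Phi> \<and> (\<exists>\<psi>\<in>elts \<Phi>. fsat X M s \<psi>))"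
  by auto
termination
  by (relation "inv_image below (\<lambda>(X, M, s, \<phi>). \<phi>)")
     (auto simp: wf_below formula_defs intro: below_tag below_tag_elts below_tag_pair)
declare fsat.simps [simp del]

definition models :: "'u::set_universe \<Rightarrow> 'u \<Rightarrow> 'u \<Rightarrow> bool" where
  "models X M \<phi> \<longleftrightarrow> (\<forall>s. range s \<subseteq> elts X \<longrightarrow> fsat X M s \<phi>)"

inductive_set atomic :: "'u::set_universe \<Rightarrow> 'u set" for L where
  "pair R (vnat (length vs)) \<in> elts L \<Longrightarrow> fRel R vs \<in> atomic L"
| "fEq i j \<in> atomic L"

inductive_set literals :: "'u::set_universe \<Rightarrow> 'u set" for L where
  "\<phi> \<in> atomic L \<Longrightarrow> \<phi> \<in> literals L"
| "\<phi> \<in> literals L \<Longrightarrow> fNeg \<phi> \<in> literals L"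

text \<open>The formulas of \<open>\<L>\<^bsub>\<kappa>\<^sup>+,\<omega>\<^esub>(L)\<close> in \<open>V\<close>.  Only conjunctions and disjunctions of sets
  belonging to \<open>V\<close>, of size at most \<open>\<kappa>\<close> in \<open>V\<close>, are formed; since \<open>V\<close> is transitive, the least class
  closed under these operations is the one computed in \<open>V\<close>.\<close>

inductive_set infinitary_formulas :: "'u::set_universe set \<Rightarrow> 'u \<Rightarrow> 'u \<Rightarrow> 'u set" for V \<kappa> L where
  "\<phi> \<in> atomic L \<Longrightarrow> \<phi> \<in> infinitary_formulas V \<kappa> L"
| "\<phi> \<in> infinitary_formulas V \<kappa> L \<Longrightarrow> fNeg \<phi> \<in> infinitary_formulas V \<kappa> L"
| "\<phi> \<in> infinitary_formulas V \<kappa> L \<Longrightarrow> fEx n \<phi> \<in> infinitary_formulas V \<kappa> L"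
| "\<phi> \<in> infinitary_formulas V \<kappa> L \<Longrightarrow> fAll n \<phi> \<in> infinitary_formulas V \<kappa> L"
| "\<Phi> \<in> V \<Longrightarrow> card_le V \<Phi> \<kappa> \<Longrightarrow> (\<And>\<phi>. \<phi> \<in> elts \<Phi> \<Longrightarrow> \<phi> \<in> infinitary_formulas V \<kappa> L) \<Longrightarrow>
     finite (\<Union>\<phi>\<in>elts \<Phi>. free_vars \<phi>) \<Longrightarrow> fConj \<Phi> \<in> infinitary_formulas V \<kappa> L"
| "\<Phi> \<in> V \<Longrightarrow> card_le V \<Phi> \<kappa> \<Longrightarrow> (\<And>\<phi>. \<phi> \<in> elts \<Phi> \<Longrightarrow> \<phi> \<in> infinitary_formulas V \<kappa> L) \<Longrightarrow>
     finite (\<Union>\<phi>\<in>elts \<Phi>. free_vars \<phi>) \<Longrightarrow> fDisj \<Phi> \<in> infinitary_formulas V \<kappa> L"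

definition sentences :: "'u::set_universe set \<Rightarrow> 'u \<Rightarrow> 'u \<Rightarrow> 'u set" where
  "sentences V \<kappa> L = {\<phi> \<in> infinitary_formulas V \<kappa> L. free_vars \<phi> = {}}"


section \<open>Borel codes\<close>

definition cBasic :: "'u::set_universe \<Rightarrow> 'u list \<Rightarrow> 'u" where
  "cBasic \<phi> as = tag 0 (pair \<phi> (tuple as))"

definition cNeg :: "'u::set_universe \<Rightarrow> 'u" where
  "cNeg \<gamma> = tag 1 \<gamma>"

definition cOr :: "'u::set_universe \<Rightarrow> 'u" where
  "cOr \<Gamma> = tag 2 \<Gamma>"

definition cAnd :: "'u::set_universe \<Rightarrow> 'u" where
  "cAnd \<Gamma> = tag 3 \<Gamma>"

lemmas code_defs = cBasic_def cNeg_def cOr_def cAnd_def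

text \<open>The \<open>\<kappa>\<close>-Borel codes of \<open>V\<close>; as for formulas, the least class with these closure properties is
  the one computed in \<open>V\<close>.  In a basic code, the tuple \<open>as\<close> gives the values of the variables
  \<open>v\<^sub>0, \<dots>, v\<^sub>n\<^sub>-\<^sub>1\<close>.\<close>

inductive_set borel_codes :: "'u::set_universe set \<Rightarrow> 'u \<Rightarrow> 'u \<Rightarrow> 'u \<Rightarrow> 'u set" for V \<kappa> L X where
  "\<Phi> \<in> V \<Longrightarrow> finite (elts \<Phi>) \<Longrightarrow> elts \<Phi> \<subseteq> literals L \<Longrightarrow> set as \<subseteq> elts X \<Longrightarrow>
     free_vars (fConj \<Phi>) \<subseteq> {..<length as} \<Longrightarrow> cBasic (fConj \<Phi>) as \<in> borel_codes V \<kappa> L X"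
| "\<gamma> \<in> borel_codes V \<kappa> L X \<Longrightarrow> cNeg \<gamma> \<in> borel_codes V \<kappa> L X"
| "indexed_family V \<kappa> \<Gamma> \<Longrightarrow> (\<And>\<gamma>. \<gamma> \<in> elts \<Gamma> \<Longrightarrow> \<gamma> \<in> borel_codes V \<kappa> L X) \<Longrightarrow>
     cOr \<Gamma> \<in> borel_codes V \<kappa> L X"
| "indexed_family V \<kappa> \<Gamma> \<Longrightarrow> (\<And>\<gamma>. \<gamma> \<in> elts \<Gamma> \<Longrightarrow> \<gamma> \<in> borel_codes V \<kappa> L X) \<Longrightarrow>
     cAnd \<Gamma> \<in> borel_codes V \<kappa> L X"

text \<open>\<open>interp X S \<gamma>\<close> is the interpretation of \<open>\<gamma>\<close> as a subset of \<open>S\<close>; with \<open>S = Str W L X\<close> it is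
  \<open>Int(\<gamma>)\<close> computed in \<open>W\<close>.  The clauses appear individually in \<open>interp_simps\<close>.\<close>

function interp :: "'u::set_universe \<Rightarrow> 'u set \<Rightarrow> 'u \<Rightarrow> 'u set" where
  "interp X S \<gamma> = {M \<in> S.
     (\<exists>\<phi> as. \<gamma> = cBasic \<phi> as \<and> fsat X M (\<lambda>i. as ! i) \<phi>) \<or>
     (\<exists>\<zeta>. \<gamma> = cNeg \<zeta> \<and> M \<notin> interp X S \<zeta>) \<or>
     (\<exists>\<Gamma>. \<gamma> = cOr \<Gamma> \<and> (\<exists>\<zeta>\<in>elts \<Gamma>. M \<in> interp X S \<zeta>)) \<or>
     (\<exists>\<Gamma>. \<gamma> = cAnd \<Gamma> \<and> (\<forall>\<zeta>\<in>elts \<Gamma>. M \<in> interp X S \<zeta>))}"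
  by auto
termination
  by (relation "inv_image below (\<lambda>(X, S, \<gamma>). \<gamma>)")
     (auto simp: wf_below code_defs intro: below_tag below_tag_elts)
declare interp.simps [simp del]

lemma interp_simps:
  "interp X S (cBasic \<phi> as) = {M \<in> S. fsat X M (\<lambda>i. as ! i) \<phi>}"
  "interp X S (cNeg \<gamma>) = S - interp X S \<gamma>"
  "interp X S (cOr \<Gamma>) = (\<Union>\<gamma>\<in>elts \<Gamma>. interp X S \<gamma>)"
  "interp X S (cAnd \<Gamma>) = S \<inter> (\<Inter>\<gamma>\<in>elts \<Gamma>. interp X S \<gamma>)"
proof -
  have sub: "interp X S \<gamma> \<subseteq> S" for \<gamma> by (subst interp.simps) auto
  show "interp X S (cBasic \<phi> as) = {M \<in> S. fsat X M (\<lambda>i. as ! i) \<phi>}"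
    "interp X S (cNeg \<gamma>) = S - interp X S \<gamma>"
    "interp X S (cAnd \<Gamma>) = S \<inter> (\<Inter>\<gamma>\<in>elts \<Gamma>. interp X S \<gamma>)"
    by (subst interp.simps; auto simp: code_defs)+
  show "interp X S (cOr \<Gamma>) = (\<Union>\<gamma>\<in>elts \<Gamma>. interp X S \<gamma>)"
    using sub by (subst interp.simps) (auto simp: code_defs)
qed


section \<open>Measures\<close>

text \<open>The sets of \<open>V\<close> that are closed families of subsets of \<open>Str\<^sub>L(X)\<close>, and the least such family,
  \<open>\<sigma>\<^sub>\<kappa>(Str\<^sub>L(X))\<close>, all computed in \<open>V\<close>.\<close>

definition closed_family :: "'u::set_universe set \<Rightarrow> 'u \<Rightarrow> 'u \<Rightarrow> 'u \<Rightarrow> 'u \<Rightarrow> bool" where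
  "closed_family V \<kappa> L X S \<longleftrightarrow>
     S \<in> V \<and> (\<forall>A\<in>elts S. elts A \<subseteq> Str V L X) \<and>
     (\<forall>\<phi>\<in>literals L. \<forall>as. set as \<subseteq> elts X \<and> free_vars \<phi> \<subseteq> {..<length as} \<longrightarrow>
        (\<forall>A\<in>V. elts A = {M \<in> Str V L X. fsat X M (\<lambda>i. as ! i) \<phi>} \<longrightarrow> A \<in> elts S)) \<and>
     (\<forall>A\<in>elts S. \<forall>B\<in>V. elts B = Str V L X - elts A \<longrightarrow> B \<in> elts S) \<and>
     (\<forall>F\<in>V. elts F \<subseteq> elts S \<and> card_le V F \<kappa> \<longrightarrow>
        (\<forall>B\<in>V. elts B = (\<Union>A\<in>elts F. elts A) \<longrightarrow> B \<in> elts S))"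

definition measurable_sets :: "'u::set_universe set \<Rightarrow> 'u \<Rightarrow> 'u \<Rightarrow> 'u \<Rightarrow> 'u set" where
  "measurable_sets V \<kappa> L X = {A \<in> V. \<forall>S. closed_family V \<kappa> L X S \<longrightarrow> A \<in> elts S}"

text \<open>Nonnegative reals are encoded as Dedekind cuts \<open>{(p, q) \<in> \<omega>\<^sup>2. q > 0 \<and> p/q < r}\<close>.  The reals
  of \<open>V\<close> thereby become a subset of the type \<open>real\<close>, and finite sums and suprema in \<open>V\<close>, hence sums of
  families of nonnegative reals belonging to \<open>V\<close>, agree with those in \<open>real\<close>.\<close>

definition real_code :: "real \<Rightarrow> 'u::set_universe \<Rightarrow> bool" where
  "real_code r x \<longleftrightarrow> 0 \<le> r \<and>
     elts x = {pair (vnat p) (vnat q) |p q. 0 < q \<and> real p / real q < r}"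

text \<open>The value at \<open>A\<close> of a real-valued function \<open>\<mu>\<close> of the universe.\<close>

definition mval :: "'u::set_universe \<Rightarrow> 'u \<Rightarrow> real" where
  "mval \<mu> A = (THE r. \<exists>x. real_code r x \<and> pair A x \<in> elts \<mu>)"

text \<open>Additivity of \<open>\<mu>\<close> over pairwise disjoint families in \<open>V\<close> of measurable sets indexed by \<open>I\<close>.\<close>

definition additive_over ::
    "'u::set_universe set \<Rightarrow> 'u \<Rightarrow> 'u \<Rightarrow> 'u \<Rightarrow> 'u \<Rightarrow> 'u \<Rightarrow> bool" where
  "additive_over V \<kappa> L X \<mu> I \<longleftrightarrow>
     (\<forall>h B. fun_in V I h \<and> (\<forall>i\<in>elts I. h i \<in> measurable_sets V \<kappa> L X) \<and>
        (\<forall>i\<in>elts I. \<forall>j\<in>elts I. i \<noteq> j \<longrightarrow> elts (h i) \<inter> elts (h j) = {}) \<and>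
        B \<in> V \<and> elts B = (\<Union>i\<in>elts I. elts (h i)) \<longrightarrow>
        ((\<lambda>i. mval \<mu> (h i)) has_sum mval \<mu> B) (elts I))"

definition probability_kappa_measure ::
    "'u::set_universe set \<Rightarrow> 'u \<Rightarrow> 'u \<Rightarrow> 'u \<Rightarrow> 'u \<Rightarrow> bool" where
  "probability_kappa_measure V \<kappa> L X \<mu> \<longleftrightarrow>
     \<mu> \<in> V \<and>
     (\<exists>h. elts \<mu> = (\<lambda>A. pair A (h A)) ` measurable_sets V \<kappa> L X \<and>
          (\<forall>A\<in>measurable_sets V \<kappa> L X. \<exists>r. real_code r (h A))) \<and>
     mval \<mu> (vset {}) = 0 \<and>
     mval \<mu> (vset (Str V L X)) = 1 \<and>
     additive_over V \<kappa> L X \<mu> (vset (range vnat)) \<and>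
     additive_over V \<kappa> L X \<mu> \<kappa>"

definition almost_sure_theory ::
    "'u::set_universe set \<Rightarrow> 'u \<Rightarrow> 'u \<Rightarrow> 'u \<Rightarrow> 'u \<Rightarrow> 'u set" where
  "almost_sure_theory V \<kappa> L X \<mu> =
     {\<phi> \<in> sentences V \<kappa> L. mval \<mu> (vset {M \<in> Str V L X. models X M \<phi>}) = 1}"


section \<open>Forcing with codes of positive measure\<close>

definition code_measure ::
    "'u::set_universe set \<Rightarrow> 'u \<Rightarrow> 'u \<Rightarrow> 'u \<Rightarrow> 'u \<Rightarrow> real" where
  "code_measure V L X \<mu> \<gamma> = mval \<mu> (vset (interp X (Str V L X) \<gamma>))"

definition code_le ::
    "'u::set_universe set \<Rightarrow> 'u \<Rightarrow> 'u \<Rightarrow> 'u \<Rightarrow> 'u \<Rightarrow> 'u \<Rightarrow> bool" where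
  "code_le V L X \<mu> \<gamma> \<zeta> \<longleftrightarrow> code_measure V L X \<mu> (cAnd (vset {\<gamma>, cNeg \<zeta>})) = 0"

definition positive_codes ::
    "'u::set_universe set \<Rightarrow> 'u \<Rightarrow> 'u \<Rightarrow> 'u \<Rightarrow> 'u \<Rightarrow> 'u set" where
  "positive_codes V \<kappa> L X \<mu> = {\<gamma> \<in> borel_codes V \<kappa> L X. 0 < code_measure V L X \<mu> \<gamma>}"

definition generic_filter ::
    "'u::set_universe set \<Rightarrow> 'u set \<Rightarrow> ('u \<Rightarrow> 'u \<Rightarrow> bool) \<Rightarrow> 'u \<Rightarrow> bool" where
  "generic_filter V P le G \<longleftrightarrow>
     elts G \<subseteq> P \<and> elts G \<noteq> {} \<and>
     (\<forall>p\<in>elts G. \<forall>q\<in>P. le p q \<longrightarrow> q \<in> elts G) \<and>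
     (\<forall>p\<in>elts G. \<forall>q\<in>elts G. \<exists>r\<in>elts G. le r p \<and> le r q) \<and>
     (\<forall>D\<in>V. elts D \<subseteq> P \<and> (\<forall>p\<in>P. \<exists>d\<in>elts D. le d p) \<longrightarrow> elts D \<inter> elts G \<noteq> {})"

definition random_generic_filter ::
    "'u::set_universe set \<Rightarrow> 'u \<Rightarrow> 'u \<Rightarrow> 'u \<Rightarrow> 'u \<Rightarrow> 'u \<Rightarrow> bool" where
  "random_generic_filter V \<kappa> L X \<mu> G \<longleftrightarrow>
     generic_filter V (positive_codes V \<kappa> L X \<mu>) (code_le V L X \<mu>) G"

text \<open>The generic extension \<open>V[G]\<close>: the values of the \<open>P\<close>-names in \<open>V\<close>.\<close>

inductive_set names :: "'u::set_universe set \<Rightarrow> 'u set \<Rightarrow> 'u set" for V P where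
  "\<tau> \<in> V \<Longrightarrow> (\<And>x. x \<in> elts \<tau> \<Longrightarrow> \<exists>\<sigma> p. x = pair \<sigma> p \<and> \<sigma> \<in> names V P \<and> p \<in> P) \<Longrightarrow>
     \<tau> \<in> names V P"

function name_val :: "'u::set_universe \<Rightarrow> 'u \<Rightarrow> 'u" where
  "name_val G \<tau> = vset {x. \<exists>\<sigma> p. pair \<sigma> p \<in> elts \<tau> \<and> p \<in> elts G \<and> x = name_val G \<sigma>}"
  by auto
termination
  by (relation "inv_image below (\<lambda>(G, \<tau>). \<tau>)")
     (auto simp: wf_below elts_def intro: below_mem below_trans below_pair)
declare name_val.simps [simp del]

definition generic_extension :: "'u::set_universe set \<Rightarrow> 'u set \<Rightarrow> 'u \<Rightarrow> 'u set" where
  "generic_extension V P G = name_val G ` names V P"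

text \<open>\<open>M\<close> is the structure \<open>\<M>\<^sub>G\<close>, i.e. \<open>\<Inter>\<^bsub>g\<in>G\<^esub> Int(g) = {M}\<close> holds in \<open>V[G]\<close>.\<close>

definition random_generic_structure ::
    "'u::set_universe set \<Rightarrow> 'u \<Rightarrow> 'u \<Rightarrow> 'u \<Rightarrow> 'u \<Rightarrow> 'u \<Rightarrow> 'u \<Rightarrow> bool" where
  "random_generic_structure V \<kappa> L X \<mu> G M \<longleftrightarrow>
     (\<Inter>g\<in>elts G. interp X
        (Str (generic_extension V (positive_codes V \<kappa> L X \<mu>) G) L X) g) = {M}"

end

theory Submission
  imports Defs "HOL-Library.Nat_Bijection"
begin

text \<open>Every formula \<open>\<phi>\<close> of \<open>V\<close>, with an assignment in \<open>V\<close>, translates to a \<open>\<kappa>\<close>-Borel code in \<open>V\<close> whose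
  interpretation in any model consists of the structures satisfying \<open>\<phi>\<close>: atomic formulas become basic
  codes, and quantifiers become \<open>\<kappa>\<close>-indexed unions and intersections because \<open>|X| \<le> \<kappa>\<close> in \<open>V\<close>.  If
  \<open>\<phi>\<close> is almost surely true, its code \<open>\<zeta>\<close> has measure \<open>1\<close>, so \<open>\<gamma> \<and> \<not>\<zeta>\<close> is null for every code \<open>\<gamma>\<close>; as
  \<open>G\<close> is nonempty and closed upwards it contains \<open>\<zeta>\<close>, whence \<open>\<M>\<^sub>G\<close> lies in the interpretation of \<open>\<zeta>\<close>
  and satisfies \<open>\<phi>\<close>.  The substance is that the translation, and the interpretation of codes in
  \<open>V\<close>, can be carried out by recursion inside \<open>V\<close>.\<close>

section \<open>Definability over a transitive model\<close>

text \<open>Separation and replacement in \<open>V\<close> produce only sets definable over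
  \<open>V\<close> from parameters, whereas \<open>code_of\<close> and \<open>interp\<close> are HOL
  recursions on arbitrary functions and sets. The gap matters twice. A disjunction is a Borel code
  only if its family of codes has an indexing function in \<open>V\<close>, so the translation has
  to be repeated inside \<open>V\<close>. And the measure of a code says something only if its
  interpretation is an element of \<open>V\<close> and measurable there; as measurable sets are
  closed under unions of families belonging to \<open>V\<close>, the map from codes to
  interpretations must again lie in \<open>V\<close>, not merely its single values. Both recursions
  are instances of \<open>fun_in_recursion\<close>, which asks for a definable step relation. This
  is the origin of the many predicates below that restate HOL operations with quantifiers bounded by
  \<open>V\<close>.\<close>

primrec fo_rename :: "(nat \<Rightarrow> nat) \<Rightarrow> fo \<Rightarrow> fo" where
  "fo_rename f (FoMem i j) = FoMem (f i) (f j)"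
| "fo_rename f (FoEq i j) = FoEq (f i) (f j)"
| "fo_rename f (FoNeg p) = FoNeg (fo_rename f p)"
| "fo_rename f (FoAnd p q) = FoAnd (fo_rename f p) (fo_rename f q)"
| "fo_rename f (FoAll n p) = FoAll (f n) (fo_rename f p)"

text \<open>Bound variables are renamed together with free ones; injectivity is what rules out
  capture.\<close>

lemma fo_sat_rename:
  assumes "inj f"
  shows "fo_sat E M e (fo_rename f p) \<longleftrightarrow> fo_sat E M (e \<circ> f) p"
proof (induction p arbitrary: e)
  case (FoAll n p)
  have "e(f n := x) \<circ> f = (e \<circ> f)(n := x)" for x
    using assms by (auto simp: fun_eq_iff inj_eq)
  then show ?case using FoAll by (simp del: fun_upd_apply add: comp_def)
qed simp_all

lemma vset_elts [simp]: "vset (elts x) = x"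
  by (rule elts_inject, rule elts_vsetI[OF refl])

locale transitive_model =
  fixes V :: "'u::set_universe set"
  assumes model: "model_of_set_theory V"
begin

lemmas zfc = model[unfolded model_of_set_theory_def zfc_model_def, THEN conjunct2]
lemmas nonempty = zfc[THEN conjunct1]
lemmas pairing_ax = zfc[THEN conjunct2, THEN conjunct2, THEN conjunct2, THEN conjunct1, rule_format]
lemmas union_ax = zfc[THEN conjunct2, THEN conjunct2, THEN conjunct2, THEN conjunct2, THEN conjunct1,
    rule_format]
lemmas power_ax = zfc[THEN conjunct2, THEN conjunct2, THEN conjunct2, THEN conjunct2, THEN conjunct2,
    THEN conjunct1, rule_format]
lemmas infinity_ax = zfc[THEN conjunct2, THEN conjunct2, THEN conjunct2, THEN conjunct2,
    THEN conjunct2, THEN conjunct2, THEN conjunct1]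
lemmas separation_ax = zfc[THEN conjunct2, THEN conjunct2, THEN conjunct2, THEN conjunct2,
    THEN conjunct2, THEN conjunct2, THEN conjunct2, THEN conjunct2, THEN conjunct1, THEN spec, THEN spec, THEN bspec, THEN mp]
lemmas replacement_ax = zfc[THEN conjunct2, THEN conjunct2, THEN conjunct2, THEN conjunct2,
    THEN conjunct2, THEN conjunct2, THEN conjunct2, THEN conjunct2, THEN conjunct2, THEN spec, THEN spec,
    THEN bspec, THEN mp, OF _ conjI]

lemma transV: "x \<in> V \<Longrightarrow> y \<in> elts x \<Longrightarrow> y \<in> V"
  using model[unfolded model_of_set_theory_def, THEN conjunct1] by blast

text \<open>\<open>definable\<close>: definability over \<open>V\<close> with parameters.  Environments carry de Bruijn indices on the left summand and parameters from \<open>V\<close> on the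
  right one.\<close>

definition definable :: "((nat \<Rightarrow> 'u) \<Rightarrow> bool) \<Rightarrow> bool" where
  "definable P \<longleftrightarrow> (\<exists>p c. range c \<subseteq> V \<and>
     (\<forall>e. range e \<subseteq> V \<longrightarrow> P e = fo_sat mem V (case_sum e c \<circ> sum_decode) p))"

text \<open>There are no function symbols, so a term is definable through its graph: index 0 holds
  the value and the arguments move up by one.\<close>

definition definable_term :: "((nat \<Rightarrow> 'u) \<Rightarrow> 'u) \<Rightarrow> bool" where
  "definable_term t \<longleftrightarrow> (\<forall>e. range e \<subseteq> V \<longrightarrow> t e \<in> V) \<and> definable (\<lambda>e. e 0 = t (\<lambda>i. e (Suc i)))"

lemma definable_cong: "definable Q \<Longrightarrow> (\<And>e. range e \<subseteq> V \<Longrightarrow> P e = Q e) \<Longrightarrow> definable P"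
  unfolding definable_def by simp

lemma definable_rename_vars:
  assumes "definable P" "inj f"
  shows "definable (\<lambda>e. P (\<lambda>i. e (f i)))"
proof -
  obtain p c where c: "range c \<subseteq> V"
    and p: "\<And>e. range e \<subseteq> V \<Longrightarrow> P e = fo_sat mem V (case_sum e c \<circ> sum_decode) p"
    using assms unfolding definable_def by blast
  define g where "g = sum_encode \<circ> map_sum f id \<circ> sum_decode"
  have inj: "inj g" unfolding g_def
    by (intro inj_compose sum.inj_map assms inj_sum_encode inj_sum_decode inj_on_id)
  have "case_sum (\<lambda>i. e (f i)) c \<circ> sum_decode = (case_sum e c \<circ> sum_decode) \<circ> g" for e :: "nat \<Rightarrow> 'u"
    by (auto simp: g_def fun_eq_iff split: sum.split)
  then have "P (\<lambda>i. e (f i)) = fo_sat mem V (case_sum e c \<circ> sum_decode) (fo_rename g p)"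
    if "range e \<subseteq> V" for e
    using p[of "\<lambda>i. e (f i)"] that fo_sat_rename[OF inj] by fastforce
  then show ?thesis unfolding definable_def using c by blast
qed

lemma definable_var_mem: "definable (\<lambda>e. e i \<in> elts (e j))"
  unfolding definable_def
  by (rule exI[of _ "FoMem (sum_encode (Inl i)) (sum_encode (Inl j))"])
     (use nonempty in \<open>auto simp: elts_def intro!: exI[of _ "\<lambda>_. SOME x. x \<in> V"] some_in_eq[THEN iffD2]\<close>)

lemma definable_var_eq: "definable (\<lambda>e. e i = e j)"
  unfolding definable_def
  by (rule exI[of _ "FoEq (sum_encode (Inl i)) (sum_encode (Inl j))"])
     (use nonempty in \<open>auto simp: elts_def intro!: exI[of _ "\<lambda>_. SOME x. x \<in> V"] some_in_eq[THEN iffD2]\<close>)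

lemma definable_var_const: "c \<in> V \<Longrightarrow> definable (\<lambda>e. e i = c)"
  unfolding definable_def
  by (rule exI[of _ "FoEq (sum_encode (Inl i)) (sum_encode (Inr 0))"], rule exI[of _ "\<lambda>_. c"]) auto

lemma definable_neg: "definable P \<Longrightarrow> definable (\<lambda>e. \<not> P e)"
  unfolding definable_def by (elim exE conjE, rule_tac x = "FoNeg p" in exI, rule_tac x = c in exI) simp

lemma definable_conj:
  assumes "definable P" "definable Q"
  shows "definable (\<lambda>e. P e \<and> Q e)"
proof -
  obtain p c where c: "range c \<subseteq> V"
    and p: "\<And>e. range e \<subseteq> V \<Longrightarrow> P e = fo_sat mem V (case_sum e c \<circ> sum_decode) p"
    using assms(1) unfolding definable_def by blast
  obtain q d where d: "range d \<subseteq> V"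
    and q: "\<And>e. range e \<subseteq> V \<Longrightarrow> Q e = fo_sat mem V (case_sum e d \<circ> sum_decode) q"
    using assms(2) unfolding definable_def by blast
  \<comment> \<open>The two parameter sequences are interleaved, and each formula is renamed to read
    its own half.\<close>
  define cd where "cd = case_sum c d \<circ> sum_decode"
  define f where "f = sum_encode \<circ> map_sum id (sum_encode \<circ> Inl) \<circ> sum_decode"
  define g where "g = sum_encode \<circ> map_sum id (sum_encode \<circ> Inr) \<circ> sum_decode"
  have inj: "inj f" "inj g" unfolding f_def g_def
    by (intro inj_compose sum.inj_map inj_sum_encode inj_sum_decode inj_on_id injI; simp)+
  have cd: "range cd \<subseteq> V" using c d by (auto simp: cd_def image_subset_iff split: sum.split)
  have "case_sum e c \<circ> sum_decode = (case_sum e cd \<circ> sum_decode) \<circ> f"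
    "case_sum e d \<circ> sum_decode = (case_sum e cd \<circ> sum_decode) \<circ> g" for e :: "nat \<Rightarrow> 'u"
    by (auto simp: f_def g_def cd_def fun_eq_iff split: sum.split)
  then have "(P e \<and> Q e) = fo_sat mem V (case_sum e cd \<circ> sum_decode) (FoAnd (fo_rename f p) (fo_rename g q))"
    if "range e \<subseteq> V" for e
    using p[OF that] q[OF that] by (simp only: fo_sat.simps fo_sat_rename inj)
  then show ?thesis unfolding definable_def using cd by blast
qed

lemma definable_all:
  assumes "definable (\<lambda>e. Q (e 0) (\<lambda>i. e (Suc i)))"
  shows "definable (\<lambda>e. \<forall>x\<in>V. Q x e)"
proof -
  obtain p c where c: "range c \<subseteq> V"
    and p: "\<And>e. range e \<subseteq> V \<Longrightarrow>
      Q (e 0) (\<lambda>i. e (Suc i)) = fo_sat mem V (case_sum e c \<circ> sum_decode) p"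
    using assms(1) unfolding definable_def by blast
  \<comment> \<open>A formula binds a named variable, but all indices on the left are taken by the
    environment. Shifting the parameters frees slot 0 on the right for the bound variable, and the
    old index 0 is sent there.\<close>
  define f where "f = sum_encode \<circ>
    case_sum (case_nat (Inr 0) Inl) (Inr \<circ> Suc) \<circ> sum_decode"
  have "inj (case_sum (case_nat (Inr 0) Inl) (Inr \<circ> Suc) :: nat + nat \<Rightarrow> nat + nat)"
    by (auto simp: inj_def split: sum.splits nat.splits)
  then have inj: "inj f" unfolding f_def
    by (intro inj_compose inj_sum_encode inj_sum_decode)
  define d where "d = case_nat (c 0) c"
  have d: "range d \<subseteq> V" using c by (auto simp: d_def split: nat.split)
  have env: "case_sum (case_nat x e) c \<circ> sum_decode =
      (case_sum e d \<circ> sum_decode)(sum_encode (Inr 0) := x) \<circ> f" for e x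
    by (auto simp: f_def d_def fun_eq_iff sum_encode_eq split: sum.split nat.split)
  have "(\<forall>x\<in>V. Q x e) =
      fo_sat mem V (case_sum e d \<circ> sum_decode) (FoAll (sum_encode (Inr 0)) (fo_rename f p))"
    if e: "range e \<subseteq> V" for e
  proof -
    have "Q x e = fo_sat mem V (case_sum (case_nat x e) c \<circ> sum_decode) p" if "x \<in> V" for x
      using p[of "case_nat x e"] e that by (simp add: image_subset_iff split: nat.split)
    then show ?thesis unfolding fo_sat.simps fo_sat_rename[OF inj] env[symmetric] by blast
  qed
  then show ?thesis unfolding definable_def using d by blast
qed

lemma definable_disj:
  assumes "definable P" "definable Q"
  shows "definable (\<lambda>e. P e \<or> Q e)"
proof -
  have "definable (\<lambda>e. \<not> (\<not> P e \<and> \<not> Q e))" by (intro definable_neg definable_conj assms)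
  then show ?thesis by simp
qed

lemma definable_imp:
  assumes "definable P" "definable Q"
  shows "definable (\<lambda>e. P e \<longrightarrow> Q e)"
proof -
  have "definable (\<lambda>e. \<not> (P e \<and> \<not> Q e))" by (intro definable_neg definable_conj assms)
  then show ?thesis by simp
qed

lemma definable_iff:
  assumes "definable P" "definable Q"
  shows "definable (\<lambda>e. P e \<longleftrightarrow> Q e)"
proof -
  have "definable (\<lambda>e. (P e \<longrightarrow> Q e) \<and> (Q e \<longrightarrow> P e))" by (intro definable_imp definable_conj assms)
  then show ?thesis by (rule definable_cong) auto
qed

lemma definable_ex:
  assumes "definable (\<lambda>e. Q (e 0) (\<lambda>i. e (Suc i)))"
  shows "definable (\<lambda>e. \<exists>x\<in>V. Q x e)"
proof -
  have "definable (\<lambda>e. \<not> (\<forall>x\<in>V. \<not> Q x e))" by (intro definable_neg definable_all assms)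
  then show ?thesis by simp
qed

lemma definable_term_in: "definable_term t \<Longrightarrow> range e \<subseteq> V \<Longrightarrow> t e \<in> V"
  unfolding definable_term_def by blast

text \<open>As only the graph of \<open>t\<close> is available, \<open>P (t e) e\<close> is
  rephrased as the existence of some \<open>x\<close> in \<open>V\<close> with
  \<open>x = t e\<close> and \<open>P x e\<close>.\<close>

lemma definable_subst:
  assumes t: "definable_term t" and P: "definable (\<lambda>e. P (e 0) (\<lambda>i. e (Suc i)))"
  shows "definable (\<lambda>e. P (t e) e)"
  by (rule definable_cong[OF definable_ex[of "\<lambda>x e. x = t e \<and> P x e"]])
     (use assms definable_term_in in \<open>auto simp: definable_term_def intro!: definable_conj\<close>)

lemma definable_term_weaken:
  assumes t: "definable_term t"
  shows "definable_term (\<lambda>e. t (\<lambda>i. e (Suc i)))"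
  unfolding definable_term_def
proof (intro conjI allI impI)
  fix e :: "nat \<Rightarrow> 'u"
  assume "range e \<subseteq> V"
  then have "range (\<lambda>i. e (Suc i)) \<subseteq> V" by auto
  then show "t (\<lambda>i. e (Suc i)) \<in> V" by (rule definable_term_in[OF t])
next
  \<comment> \<open>Index 0 keeps the value of the term, and the arguments move past the new,
    ignored index 1.\<close>
  have "inj (case_nat 0 (\<lambda>i. Suc (Suc i)))" by (auto simp: inj_def split: nat.splits)
  moreover have "definable (\<lambda>e. e 0 = t (\<lambda>i. e (Suc i)))" using t unfolding definable_term_def by blast
  ultimately show "definable (\<lambda>e. e 0 = t (\<lambda>i. e (Suc (Suc i))))"
    using definable_rename_vars[of "\<lambda>e. e 0 = t (\<lambda>i. e (Suc i))" "case_nat 0 (\<lambda>i. Suc (Suc i))"] by simp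
qed

lemma definable_subst2:
  assumes P: "\<And>i j. definable (\<lambda>e. P (e i) (e j))" and t: "definable_term t" and u: "definable_term u"
  shows "definable (\<lambda>e. P (t e) (u e))"
  by (rule definable_subst[OF t, where P = "\<lambda>x e. P x (u e)",
      OF definable_subst[OF definable_term_weaken[OF u], where P = "\<lambda>y e. P (e 0) y", OF P]])

lemma definable_subst3:
  assumes P: "\<And>i j k. definable (\<lambda>e. P (e i) (e j) (e k))" and t: "definable_term t" and u: "definable_term u" and v: "definable_term v"
  shows "definable (\<lambda>e. P (t e) (u e) (v e))"
proof -
  have "definable (\<lambda>e. P (e 0) (u (\<lambda>i. e (Suc i))) (v (\<lambda>i. e (Suc i))))"
    by (rule definable_subst[OF definable_term_weaken[OF u],
        where P = "\<lambda>y e. P (e 0) y (v (\<lambda>i. e (Suc i)))",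
        OF definable_subst[OF definable_term_weaken[OF definable_term_weaken[OF v]],
          where P = "\<lambda>z e. P (e (Suc 0)) (e 0) z", OF P]])
  then show ?thesis
    by (rule definable_subst[OF t, where P = "\<lambda>x e. P x (u e) (v e)"])
qed

lemma definable_term_var: "definable_term (\<lambda>e. e i)"
  unfolding definable_term_def using definable_var_eq by auto

lemma definable_term_const: "c \<in> V \<Longrightarrow> definable_term (\<lambda>e. c)"
  unfolding definable_term_def using definable_var_const by auto

lemma definable_mem: "definable_term t \<Longrightarrow> definable_term u \<Longrightarrow> definable (\<lambda>e. t e \<in> elts (u e))"
  by (rule definable_subst2[where P = "\<lambda>x y. x \<in> elts y", OF definable_var_mem])

lemma definable_eq: "definable_term t \<Longrightarrow> definable_term u \<Longrightarrow> definable (\<lambda>e. t e = u e)"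
  by (rule definable_subst2[where P = "(=)", OF definable_var_eq])

text \<open>Transitivity of \<open>V\<close> puts all elements of \<open>t e\<close> into
  \<open>V\<close>, so the bounded quantifier can be written with one over \<open>V\<close>.\<close>

lemma definable_ball:
  assumes "definable_term t" "definable (\<lambda>e. Q (e 0) (\<lambda>i. e (Suc i)))"
  shows "definable (\<lambda>e. \<forall>x\<in>elts (t e). Q x e)"
proof -
  have "definable (\<lambda>e. \<forall>x\<in>V. x \<in> elts (t e) \<longrightarrow> Q x e)"
    by (rule definable_all, rule definable_imp, rule definable_mem, rule definable_term_var, rule definable_term_weaken, rule assms,
        rule assms)
  moreover have "(\<forall>x\<in>elts (t e). Q x e) \<longleftrightarrow> (\<forall>x\<in>V. x \<in> elts (t e) \<longrightarrow> Q x e)"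
    if "range e \<subseteq> V" for e
    using transV[OF definable_term_in[OF assms(1) that]] by auto
  ultimately show ?thesis by (rule definable_cong)
qed

lemma definable_bex:
  assumes "definable_term t" "definable (\<lambda>e. Q (e 0) (\<lambda>i. e (Suc i)))"
  shows "definable (\<lambda>e. \<exists>x\<in>elts (t e). Q x e)"
proof -
  have "definable (\<lambda>e. \<not> (\<forall>x\<in>elts (t e). \<not> Q x e))" by (intro definable_neg definable_ball assms)
  then show ?thesis by simp
qed

text \<open>With these rules definability is read off the shape of a predicate, provided its
  quantifiers range over \<open>V\<close> or over elements of a term; predicates meant for
  \<open>V\<close> are written in this form from here on.\<close>

named_theorems definable_intros
lemmas [definable_intros] = definable_neg definable_conj definable_disj definable_imp definable_iff definable_all definable_ex definable_ball definable_bex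
  definable_mem definable_eq definable_term_var definable_term_const

section \<open>Classes of HOL that are sets of the model; separation and replacement\<close>

definition is_set :: "'u set \<Rightarrow> bool" where
  "is_set S \<longleftrightarrow> (\<exists>b\<in>V. elts b = S)"

lemma is_set_vset: "is_set S \<Longrightarrow> vset S \<in> V" "is_set S \<Longrightarrow> elts (vset S) = S"
  unfolding is_set_def by (auto simp: vset_elts)

lemma is_setI: "b \<in> V \<Longrightarrow> elts b = S \<Longrightarrow> is_set S"
  unfolding is_set_def by blast

lemma is_set_elts: "b \<in> V \<Longrightarrow> is_set (elts b)"
  unfolding is_set_def by blast

lemma is_set_subset: "is_set S \<Longrightarrow> S \<subseteq> V"
  unfolding is_set_def using transV by blast

text \<open>The axioms describe only which elements of \<open>V\<close> belong to the new set;
  transitivity excludes any others.\<close>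

lemma is_setI_mem:
  assumes "b \<in> V" "S \<subseteq> V" "\<And>z. z \<in> V \<Longrightarrow> mem z b \<longleftrightarrow> z \<in> S"
  shows "is_set S"
proof (rule is_setI[OF assms(1)])
  show "elts b = S"
  proof (rule set_eqI)
    fix z
    show "z \<in> elts b \<longleftrightarrow> z \<in> S"
      using assms(2) assms(3)[of z] transV[OF assms(1), of z] by (auto simp: elts_def)
  qed
qed

lemma separation:
  assumes "is_set A" "definable (\<lambda>e. P (e 0))"
  shows "is_set {x\<in>A. P x}"
proof -
  obtain a where a: "a \<in> V" "elts a = A" using assms(1) is_set_def by blast
  obtain p c where c: "range c \<subseteq> V"
    and p: "\<And>e. range e \<subseteq> V \<Longrightarrow> P (e 0) = fo_sat mem V (case_sum e c \<circ> sum_decode) p"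
    using assms(2) unfolding definable_def by blast
  \<comment> \<open>The axiom scheme expects the tested element in variable 0. The renaming puts de
    Bruijn index 0 there and moves every other variable up, out of its way.\<close>
  define f where "f = (\<lambda>n. if n = sum_encode (Inl 0) then 0 else Suc n)"
  have inj: "inj f" by (auto simp: f_def inj_def)
  define d where "d = case_nat (c 0) (case_sum (\<lambda>_. c 0) c \<circ> sum_decode)"
  have d: "range d \<subseteq> V" using c by (simp add: d_def image_subset_iff split: nat.split sum.split)
  have env: "case_sum (\<lambda>i. if i = 0 then x else c 0) c \<circ> sum_decode = d(0 := x) \<circ> f" for x
  proof
    fix n
    obtain z where n: "n = sum_encode z" by (metis sum_decode_inverse)
    show "(case_sum (\<lambda>i. if i = 0 then x else c 0) c \<circ> sum_decode) n = (d(0 := x) \<circ> f) n"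
      by (cases z) (auto simp: n f_def d_def sum_encode_eq)
  qed
  have "P x = fo_sat mem V (d(0 := x)) (fo_rename f p)" if "x \<in> V" for x
  proof -
    have "range (\<lambda>i :: nat. if i = 0 then x else c 0) \<subseteq> V" using that c by auto
    from p[OF this] show ?thesis unfolding fo_sat_rename[OF inj] env[symmetric] by simp
  qed
  moreover have "\<exists>b\<in>V. \<forall>x\<in>V. mem x b \<longleftrightarrow> mem x a \<and> fo_sat mem V (d(0 := x)) (fo_rename f p)"
    by (rule separation_ax[OF a(1) d])
  ultimately obtain b where b: "b \<in> V" "\<forall>x\<in>V. mem x b \<longleftrightarrow> mem x a \<and> P x" by auto
  have "A \<subseteq> V" by (rule is_set_subset[OF assms(1)])
  with b a show ?thesis by (intro is_setI_mem[OF b(1)]) (auto simp: elts_def)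
qed

text \<open>\<open>F\<close> may be any function of HOL: it suffices that its graph over
  \<open>A\<close> agrees with a definable relation. The renaming is as in
  \<open>separation\<close>, with variables 0 and 1 both reserved.\<close>

lemma replacement:
  assumes "is_set A" "definable (\<lambda>e. P (e 0) (e 1))"
    and F: "\<And>x. x \<in> A \<Longrightarrow> F x \<in> V" "\<And>x y. x \<in> A \<Longrightarrow> y \<in> V \<Longrightarrow> P x y \<longleftrightarrow> y = F x"
  shows "is_set (F ` A)"
proof -
  obtain a where a: "a \<in> V" "elts a = A" using assms(1) is_set_def by blast
  obtain p c where c: "range c \<subseteq> V"
    and p: "\<And>e. range e \<subseteq> V \<Longrightarrow> P (e 0) (e 1) = fo_sat mem V (case_sum e c \<circ> sum_decode) p"
    using assms(2) unfolding definable_def by blast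
  define f where "f = (\<lambda>n. if n = sum_encode (Inl 0) then 0
    else if n = sum_encode (Inl 1) then 1 else Suc (Suc n))"
  have inj: "inj f" by (auto simp: f_def inj_def)
  define d where "d = (\<lambda>n. (case_sum (\<lambda>_. c 0) c \<circ> sum_decode) (n - 2))"
  have d: "range d \<subseteq> V" using c by (simp add: d_def image_subset_iff split: nat.split sum.split)
  have env: "case_sum (\<lambda>i. if i = 0 then x else if i = 1 then y else c 0) c \<circ> sum_decode =
      d(0 := x, 1 := y) \<circ> f" for x y
  proof
    fix n
    obtain z where n: "n = sum_encode z" by (metis sum_decode_inverse)
    show "(case_sum (\<lambda>i. if i = 0 then x else if i = 1 then y else c 0) c \<circ> sum_decode) n =
      (d(0 := x, 1 := y) \<circ> f) n"
      by (cases z) (auto simp: n f_def d_def sum_encode_eq)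
  qed
  have *: "P x y = fo_sat mem V (d(0 := x, 1 := y)) (fo_rename f p)" if "x \<in> V" "y \<in> V" for x y
  proof -
    have "range (\<lambda>i :: nat. if i = 0 then x else if i = 1 then y else c 0) \<subseteq> V" using that c by auto
    from p[OF this] show ?thesis unfolding fo_sat_rename[OF inj] env[symmetric] by simp
  qed
  have "\<forall>x\<in>V. mem x a \<longrightarrow> (\<exists>!y. y \<in> V \<and> fo_sat mem V (d(0 := x, 1 := y)) (fo_rename f p))"
  proof (intro ballI impI)
    fix x assume x: "x \<in> V" "mem x a"
    then have "x \<in> A" using a by (auto simp: elts_def)
    then show "\<exists>!y. y \<in> V \<and> fo_sat mem V (d(0 := x, 1 := y)) (fo_rename f p)"
      using F *[OF x(1)] by (intro ex1I[of _ "F x"]) auto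
  qed
  from replacement_ax[OF a(1) d this] obtain b where b: "b \<in> V"
    "\<forall>y\<in>V. mem y b \<longleftrightarrow> (\<exists>x\<in>V. mem x a \<and> fo_sat mem V (d(0 := x, 1 := y)) (fo_rename f p))"
    by blast
  have "A \<subseteq> V" by (rule is_set_subset[OF assms(1)])
  have "mem y b \<longleftrightarrow> y \<in> F ` A" if "y \<in> V" for y
  proof -
    have "mem y b \<longleftrightarrow> (\<exists>x\<in>V. x \<in> A \<and> P x y)"
      using bspec[OF b(2) that] *[OF _ that] a by (auto simp: elts_def)
    also have "\<dots> \<longleftrightarrow> (\<exists>x\<in>A. y = F x)" using F(2)[OF _ that] \<open>A \<subseteq> V\<close> by auto
    finally show ?thesis by auto
  qed
  then show ?thesis using F(1) by (intro is_setI_mem[OF b(1)]) auto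
qed

section \<open>Sets and functions in a transitive model\<close>

lemma is_set_empty: "is_set {}"
proof -
  obtain z where "z \<in> V" "\<forall>w\<in>V. \<not> mem w z" using infinity_ax by blast
  then show ?thesis by (intro is_setI_mem[of z]) auto
qed

lemma is_set_upair:
  assumes "x \<in> V" "y \<in> V"
  shows "is_set {x, y}"
proof -
  obtain z where "z \<in> V" "\<forall>w\<in>V. mem w z \<longleftrightarrow> w = x \<or> w = y"
    using pairing_ax[OF assms] by blast
  then show ?thesis using assms by (intro is_setI_mem[of z]) auto
qed

lemma is_set_Union:
  assumes "is_set A"
  shows "is_set (\<Union>y\<in>A. elts y)"
proof -
  obtain a where a: "a \<in> V" "elts a = A" using assms is_set_def by blast
  obtain u where u: "u \<in> V" "\<forall>z\<in>V. mem z u \<longleftrightarrow> (\<exists>y\<in>V. mem y a \<and> mem z y)"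
    using union_ax[OF a(1)] by blast
  have A: "A \<subseteq> V" by (rule is_set_subset[OF assms])
  show ?thesis
  proof (rule is_setI_mem[OF u(1)])
    show "(\<Union>y\<in>A. elts y) \<subseteq> V" using A transV by auto
    show "mem z u \<longleftrightarrow> z \<in> (\<Union>y\<in>A. elts y)" if "z \<in> V" for z
      using bspec[OF u(2) that] A a(2) by (auto simp: elts_def)
  qed
qed

lemma is_set_Un:
  assumes "is_set A" "is_set B"
  shows "is_set (A \<union> B)"
proof -
  have "is_set (\<Union>y\<in>{vset A, vset B}. elts y)"
    by (intro is_set_Union is_set_upair is_set_vset assms)
  then show ?thesis by (simp add: is_set_vset(2) assms)
qed

lemma is_set_insert:
  assumes "x \<in> V" "is_set A"
  shows "is_set (insert x A)"
  using is_set_Un[OF is_set_upair[OF assms(1) assms(1)] assms(2)] by simp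

lemma is_set_finite: "finite S \<Longrightarrow> S \<subseteq> V \<Longrightarrow> is_set S"
  by (induction rule: finite_induct) (simp_all add: is_set_empty is_set_insert)

lemma vset_finite_in:
  assumes "finite S"
  shows "vset S \<in> V \<longleftrightarrow> S \<subseteq> V"
proof
  show "S \<subseteq> V" if "vset S \<in> V"
    using is_set_subset[OF is_set_elts[OF that]] assms by simp
  show "vset S \<in> V" if "S \<subseteq> V"
    by (intro is_set_vset is_set_finite that assms)
qed

lemma pair_in [simp]: "pair x y \<in> V \<longleftrightarrow> x \<in> V \<and> y \<in> V"
  by (auto simp: pair_def vset_finite_in)

lemma vnat_in [simp]: "vnat n \<in> V"
proof (induction n)
  case (Suc n)
  then have "is_set (insert (vnat n) (elts (vnat n)))" by (intro is_set_insert is_set_elts)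
  then show ?case by (simp add: is_set_vset(1))
qed (simp add: vset_finite_in)

lemma tag_in [simp]: "tag k x \<in> V \<longleftrightarrow> x \<in> V"
  by (simp add: tag_def)

lemma tuple_in [simp]: "tuple as \<in> V \<longleftrightarrow> set as \<subseteq> V"
proof -
  have "tuple as \<in> V \<longleftrightarrow> {pair (vnat i) (as ! i) |i. i < length as} \<subseteq> V"
    unfolding tuple_def by (intro vset_finite_in) simp
  also have "\<dots> \<longleftrightarrow> (\<forall>i<length as. as ! i \<in> V)" by auto
  also have "\<dots> \<longleftrightarrow> set as \<subseteq> V" by (auto simp: set_conv_nth)
  finally show ?thesis .
qed

lemma is_set_Pow:
  assumes "is_set A"
  shows "is_set {z\<in>V. elts z \<subseteq> A}"
proof -
  obtain a where a: "a \<in> V" "elts a = A" using assms is_set_def by blast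
  obtain p where p: "p \<in> V" "\<forall>z\<in>V. mem z p \<longleftrightarrow> (\<forall>w\<in>V. mem w z \<longrightarrow> mem w a)"
    using power_ax[OF a(1)] by blast
  show ?thesis
  proof (rule is_setI_mem[OF p(1)])
    show "mem z p \<longleftrightarrow> z \<in> {z\<in>V. elts z \<subseteq> A}" if "z \<in> V" for z
      using bspec[OF p(2) that] that transV[OF that] a(2) by (auto simp: elts_def)
  qed auto
qed

lemma definable_var_upair: "definable (\<lambda>e. e i = vset {e j, e k})"
proof -
  have "definable (\<lambda>e. \<forall>z\<in>V. z \<in> elts (e i) \<longleftrightarrow> z = e j \<or> z = e k)" by (intro definable_intros)
  then show ?thesis
  proof (rule definable_cong)
    fix e :: "nat \<Rightarrow> 'u"
    assume "range e \<subseteq> V"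
    then have *: "e i \<in> V" "e j \<in> V" "e k \<in> V" by auto
    have "e i = vset {e j, e k} \<longleftrightarrow> elts (e i) = {e j, e k}"
      by (metis elts_inject elts_vset_finite finite.emptyI finite_insert)
    also have "\<dots> \<longleftrightarrow> (\<forall>z\<in>V. z \<in> elts (e i) \<longleftrightarrow> z = e j \<or> z = e k)"
      using * transV by blast
    finally show "e i = vset {e j, e k} \<longleftrightarrow> (\<forall>z\<in>V. z \<in> elts (e i) \<longleftrightarrow> z = e j \<or> z = e k)" .
  qed
qed

lemma definable_term_upair [definable_intros]:
  assumes "definable_term t" "definable_term u"
  shows "definable_term (\<lambda>e. vset {t e, u e})"
proof -
  have "definable (\<lambda>e. e 0 = vset {t (\<lambda>i. e (Suc i)), u (\<lambda>i. e (Suc i))})"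
    by (rule definable_subst3[where P = "\<lambda>x y z. x = vset {y, z}", OF definable_var_upair definable_term_var
        definable_term_weaken[OF assms(1)] definable_term_weaken[OF assms(2)]])
  then show ?thesis unfolding definable_term_def by (simp add: vset_finite_in definable_term_in[OF assms(1)] definable_term_in[OF assms(2)])
qed

lemma definable_term_singleton [definable_intros]: "definable_term t \<Longrightarrow> definable_term (\<lambda>e. vset {t e})"
  using definable_term_upair[of t t] by simp

lemma definable_term_pair [definable_intros]: "definable_term t \<Longrightarrow> definable_term u \<Longrightarrow> definable_term (\<lambda>e. pair (t e) (u e))"
  unfolding pair_def by (intro definable_intros)

lemma definable_term_tag [definable_intros]: "definable_term t \<Longrightarrow> definable_term (\<lambda>e. tag k (t e))"
  unfolding tag_def by (intro definable_intros vnat_in)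

text \<open>The axiom gives some inductive set; \<open>W\<close> is the least one in
  \<open>V\<close>. If \<open>W\<close> had an element that is not a numeral, then by
  well-foundedness there would be a minimal one, and removing it would leave a smaller inductive set
  in \<open>V\<close>.\<close>

lemma is_set_omega: "is_set (range vnat)"
proof -
  define ind where "ind j \<longleftrightarrow> (\<exists>z\<in>elts j. \<forall>w\<in>V. w \<notin> elts z) \<and>
    (\<forall>x\<in>elts j. \<exists>s\<in>elts j. \<forall>w\<in>V. w \<in> elts s \<longleftrightarrow> w \<in> elts x \<or> w = x)" for j
  have ind: "ind j \<longleftrightarrow> vset {} \<in> elts j \<and> (\<forall>x\<in>elts j. \<exists>s\<in>elts j. elts s = insert x (elts x))"
    if "j \<in> V" for j
  proof -
    have 1: "(\<forall>w\<in>V. w \<notin> elts z) \<longleftrightarrow> z = vset {}" if "z \<in> elts j" for z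
      using transV[of z] transV[OF \<open>j \<in> V\<close> that] elts_inject[of z "vset {}"] by auto
    have 2: "(\<forall>w\<in>V. w \<in> elts s \<longleftrightarrow> w \<in> elts x \<or> w = x) \<longleftrightarrow> elts s = insert x (elts x)"
      if "s \<in> elts j" "x \<in> elts j" for s x
    proof -
      have "s \<in> V" "x \<in> V" using that transV[OF \<open>j \<in> V\<close>] by auto
      then have "elts s \<subseteq> V" "insert x (elts x) \<subseteq> V" using transV by auto
      then show ?thesis by auto
    qed
    have "(\<exists>z\<in>elts j. \<forall>w\<in>V. w \<notin> elts z) \<longleftrightarrow> (\<exists>z\<in>elts j. z = vset {})"
      by (intro bex_cong refl 1)
    moreover have "(\<forall>x\<in>elts j. \<exists>s\<in>elts j. \<forall>w\<in>V. w \<in> elts s \<longleftrightarrow> w \<in> elts x \<or> w = x) \<longleftrightarrow>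
        (\<forall>x\<in>elts j. \<exists>s\<in>elts j. elts s = insert x (elts x))"
      by (intro ball_cong bex_cong refl 2)
    ultimately show ?thesis unfolding ind_def by simp
  qed
  obtain i where iV: "i \<in> V" and i0: "\<exists>z\<in>V. mem z i \<and> (\<forall>w\<in>V. \<not> mem w z)"
    and iS: "\<forall>x\<in>V. mem x i \<longrightarrow> (\<exists>s\<in>V. mem s i \<and> (\<forall>w\<in>V. mem w s \<longleftrightarrow> mem w x \<or> w = x))"
    using infinity_ax by (rule bexE) (elim conjE)
  have "ind i" unfolding ind_def
  proof (intro conjI ballI)
    show "\<exists>z\<in>elts i. \<forall>w\<in>V. w \<notin> elts z" using i0 unfolding elts_def by blast
    show "\<exists>s\<in>elts i. \<forall>w\<in>V. w \<in> elts s \<longleftrightarrow> w \<in> elts x \<or> w = x" if "x \<in> elts i" for x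
      using bspec[OF iS transV[OF iV that]] that unfolding elts_def by blast
  qed
  note i = iV this
  define W where "W = {x \<in> elts i. \<forall>j\<in>V. ind j \<longrightarrow> x \<in> elts j}"
  have W: "is_set W"
    unfolding W_def ind_def by (intro separation is_set_elts i definable_intros)
  have W_in: "x \<in> elts j" if "x \<in> W" "j \<in> V" "ind j" for x j using that by (simp add: W_def)
  have in_W: "x \<in> W" if "\<And>j. j \<in> V \<Longrightarrow> ind j \<Longrightarrow> x \<in> elts j" for x
    using that i by (simp add: W_def)
  have succ_in: "vset (insert x (elts x)) \<in> elts j" if jx: "j \<in> V" "ind j" "x \<in> elts j" for x j
  proof -
    obtain s where s: "s \<in> elts j" "elts s = insert x (elts x)"
      using bspec[OF conjunct2[OF iffD1[OF ind[OF jx(1)] jx(2)]] jx(3)] by blast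
    show ?thesis unfolding s(2)[symmetric] vset_elts by (rule s(1))
  qed
  have elts_succ: "elts (vset (insert x (elts x))) = insert x (elts x)" for x :: 'u
    using ex_insert[of x x] by (elim exE) (rule elts_vsetI)
  have vnat_ind: "vnat n \<in> elts j" if "j \<in> V" "ind j" for n j
    by (induction n)
      (use conjunct1[OF iffD1[OF ind[OF that(1)] that(2)]] succ_in[OF that] in simp_all)
  have "W \<subseteq> range vnat"
  proof (rule ccontr)
    assume "\<not> W \<subseteq> range vnat"
    then obtain x0 where x0: "x0 \<in> W - range vnat" by blast
    obtain x where x: "x \<in> W - range vnat" "\<And>y. mem y x \<Longrightarrow> y \<notin> W - range vnat"
    proof (rule wfE_min[OF wfp_mem[unfolded wfp_def] x0])
      fix z assume "z \<in> W - range vnat" and "\<And>y. (y, z) \<in> {(x, y). mem x y} \<Longrightarrow> y \<notin> W - range vnat"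
      then show thesis by (intro that[of z]) simp_all
    qed
    have xV: "x \<in> V" using x(1) is_set_subset[OF W] by blast
    have "is_set {y\<in>W. y \<noteq> x}" by (intro separation W definable_intros xV)
    then obtain j where j: "j \<in> V" "elts j = {y\<in>W. y \<noteq> x}" unfolding is_set_def by blast
    have "ind j" unfolding ind[OF j(1)]
    proof (intro conjI ballI)
      have "(vnat 0 :: 'u) \<in> W" by (intro in_W vnat_ind)
      moreover have "vnat 0 \<noteq> x" using x(1) by blast
      ultimately show "vset {} \<in> elts j" using j by simp
    next
      fix y assume "y \<in> elts j"
      then have y: "y \<in> W" using j by blast
      define s where "s = vset (insert y (elts y))"
      have es: "elts s = insert y (elts y)" unfolding s_def by (rule elts_succ)
      have "s \<in> W" unfolding s_def by (rule in_W, rule succ_in, assumption+, rule W_in[OF y])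
      \<comment> \<open>If the successor of \<open>y\<close> were \<open>x\<close>, then
        \<open>y\<close>, lying below the minimal counterexample, would be a numeral, and so would
        \<open>x\<close>.\<close>
      moreover have "s \<noteq> x"
      proof
        assume "s = x"
        then have "mem y x" using es unfolding elts_def by blast
        then obtain n where "y = vnat n" using x(2)[of y] y by blast
        then have "s = vnat (Suc n)" by (simp add: s_def)
        then show False using x(1) \<open>s = x\<close> by blast
      qed
      ultimately show "\<exists>s\<in>elts j. elts s = insert y (elts y)"
        using j(2) es by (intro bexI[of _ s]) auto
    qed
    then have "x \<in> elts j" using x(1) by (intro W_in j(1)) auto
    then show False using j(2) by blast
  qed
  moreover have "range vnat \<subseteq> W" by (rule image_subsetI, rule in_W, rule vnat_ind)
  ultimately show ?thesis using W by simp
qed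

text \<open>A Kuratowski pair over \<open>A\<close> and \<open>B\<close> belongs to the double power
  set of their union, from which the pairs are separated.\<close>

lemma is_set_prod:
  assumes A: "is_set A" and B: "is_set B"
  shows "is_set {pair a b |a b. a \<in> A \<and> b \<in> B}"
proof -
  define K where "K = {z\<in>V. elts z \<subseteq> {z\<in>V. elts z \<subseteq> A \<union> B}}"
  have "is_set {p\<in>K. \<exists>a\<in>elts (vset A). \<exists>b\<in>elts (vset B). p = pair a b}"
    unfolding K_def
    by (intro separation is_set_Pow is_set_Un A B definable_intros is_set_vset)
  moreover have "{p\<in>K. \<exists>a\<in>elts (vset A). \<exists>b\<in>elts (vset B). p = pair a b} =
      {pair a b |a b. a \<in> A \<and> b \<in> B}"
    using is_set_subset[OF A] is_set_subset[OF B]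
    by (auto simp: K_def is_set_vset A B) (auto simp: pair_def vset_finite_in)
  ultimately show ?thesis by simp
qed

lemma fun_in_graph: "fun_in V A h \<longleftrightarrow> is_set ((\<lambda>x. pair x (h x)) ` elts A)"
  unfolding fun_in_def is_set_def ..

lemma fun_in_values: "fun_in V A h \<Longrightarrow> x \<in> elts A \<Longrightarrow> h x \<in> V"
  unfolding fun_in_graph using is_set_subset by fastforce

lemma fun_in_cong:
  assumes "\<And>x. x \<in> elts A \<Longrightarrow> h x = k x"
  shows "fun_in V A h \<longleftrightarrow> fun_in V A k"
proof -
  have "(\<lambda>x. pair x (h x)) ` elts A = (\<lambda>x. pair x (k x)) ` elts A"
    using assms by (intro image_cong) simp_all
  then show ?thesis unfolding fun_in_graph by simp
qed

text \<open>A function whose graph is in \<open>V\<close> is definable with that graph as a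
  parameter, however it was introduced in HOL.\<close>

lemma fun_in_image:
  assumes "A \<in> V" "fun_in V A h"
  shows "is_set (h ` elts A)"
proof -
  obtain g where g: "g \<in> V" "elts g = (\<lambda>x. pair x (h x)) ` elts A"
    using assms(2) unfolding fun_in_def by blast
  show ?thesis
  proof (rule replacement[where P = "\<lambda>x y. pair x y \<in> elts g"])
    show "definable (\<lambda>e. pair (e 0) (e 1) \<in> elts g)" by (intro definable_intros g)
  qed (use g(2) fun_in_values[OF assms(2)] in \<open>auto intro: is_set_elts assms\<close>)
qed

lemma fun_inI:
  assumes A: "A \<in> V" and P: "definable (\<lambda>e. P (e 0) (e 1))"
    and F: "\<And>x. x \<in> elts A \<Longrightarrow> F x \<in> V" "\<And>x y. x \<in> elts A \<Longrightarrow> y \<in> V \<Longrightarrow> P x y \<longleftrightarrow> y = F x"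
  shows "fun_in V A F"
  unfolding fun_in_graph
proof (rule replacement[where P = "\<lambda>x z. \<exists>y\<in>V. P x y \<and> z = pair x y"])
  \<comment> \<open>Below the quantifier over \<open>y\<close>, index 0 is \<open>y\<close> and the
    argument has become index 1, so the two places of \<open>P\<close> are exchanged.\<close>
  from definable_rename_vars[OF P, of "\<lambda>i. if i = 0 then Suc 0 else if i = Suc 0 then 0 else i"]
  have "definable (\<lambda>e. P (e (Suc 0)) (e 0))" by (simp add: inj_def)
  then show "definable (\<lambda>e. \<exists>y\<in>V. P (e 0) y \<and> e 1 = pair (e 0) y)"
    by (intro definable_intros) simp_all
qed (use assms transV in \<open>auto intro: is_set_elts\<close>)

section \<open>Recursion in a transitive model\<close>

text \<open>Recursion inside \<open>V\<close>: \<open>St x y T\<close> says that the partial function \<open>T\<close> determines the value \<open>y\<close>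
  at \<open>x\<close> from its values on \<open>sub x\<close>.  To collect witnesses without a collection principle, replacement
  is applied to the least partial function that is closed under \<open>St\<close> and defined at a given point,
  which is unique.\<close>

lemma fun_in_recursion:
  fixes D :: "'u set" and sub :: "'u \<Rightarrow> 'u set" and f :: "'u \<Rightarrow> 'u" and St :: "'u \<Rightarrow> 'u \<Rightarrow> 'u \<Rightarrow> bool"
  assumes D: "D \<subseteq> V" and wf: "wf r"
    and sub: "\<And>x z. x \<in> D \<Longrightarrow> z \<in> sub x \<Longrightarrow> z \<in> D \<and> (z, x) \<in> r"
    and sub_set: "\<And>x. x \<in> D \<Longrightarrow> is_set (sub x)"
    and St: "\<And>i j k. definable (\<lambda>e. St (e i) (e j) (e k))"
    and step: "\<And>x T. x \<in> D \<Longrightarrow> T \<in> V \<Longrightarrow> (\<And>z w. z \<in> sub x \<Longrightarrow> pair z w \<in> elts T \<longleftrightarrow> w = f z) \<Longrightarrow>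
      f x \<in> V \<and> St x (f x) T"
    and uniq: "\<And>x y T. x \<in> D \<Longrightarrow> T \<in> V \<Longrightarrow> y \<in> V \<Longrightarrow> St x y T \<Longrightarrow>
      (\<And>z w. z \<in> sub x \<Longrightarrow> pair z w \<in> elts T \<Longrightarrow> w = f z) \<Longrightarrow>
      y = f x \<and> (\<forall>z\<in>sub x. pair z (f z) \<in> elts T)"
    and A: "A \<in> V" "elts A \<subseteq> D"
  shows "fun_in V A f"
proof -
  define good where "good T \<longleftrightarrow> (\<forall>p\<in>elts T. \<exists>x\<in>V. \<exists>y\<in>V. p = pair x y \<and> St x y T)" for T
  have definable_good: "definable (\<lambda>e. good (e i))" for i
    unfolding good_def by (intro definable_intros St)
  have goodD: "St x y T" if "good T" "pair x y \<in> elts T" for x y T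
    using that unfolding good_def by fastforce
  \<comment> \<open>Being good does not include being a function. Induction supplies this: once the
    values that \<open>T\<close> has on \<open>sub x\<close> are right, \<open>uniq\<close> yields
    the value at \<open>x\<close> and also that none of those on \<open>sub x\<close> is
    missing.\<close>
  have good_val: "y = f x \<and> (\<forall>z\<in>sub x. pair z (f z) \<in> elts T)"
    if T: "T \<in> V" "good T" and x: "x \<in> D" and xy: "pair x y \<in> elts T" for T x y
    using x xy
  proof (induction x arbitrary: y rule: wf_induct_rule[OF wf])
    case (1 x)
    show ?case
    proof (rule uniq[OF 1(2) T(1)])
      show "y \<in> V" using transV[OF T(1) 1(3)] by simp
      show "St x y T" by (rule goodD[OF T(2) 1(3)])
      show "w = f z" if "z \<in> sub x" "pair z w \<in> elts T" for z w
        using 1(1)[of z w] sub[OF 1(2) that(1)] that(2) by simp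
    qed
  qed
  define S where "S = {(z, x). x \<in> D \<and> z \<in> sub x}"
  define cl where "cl x = {z. (z, x) \<in> S\<^sup>*}" for x
  \<comment> \<open>The graph of \<open>f\<close> on the closure of \<open>x\<close> under
    \<open>sub\<close>; it will be the least good relation defined at \<open>x\<close>.\<close>
  define Tx where "Tx x = (\<lambda>z. pair z (f z)) ` cl x" for x
  have cl_step: "cl x = insert x (\<Union>z\<in>sub x. cl z)" if "x \<in> D" for x
    using that unfolding cl_def S_def by (auto elim: rtranclE intro: rtrancl_into_rtrancl)
  have cl_D: "z \<in> D" if "z \<in> cl x" "x \<in> D" for z x
    using that(1) unfolding cl_def mem_Collect_eq
    by (induction rule: converse_rtrancl_induct) (auto simp: S_def that(2) sub)
  have cl_sub: "z' \<in> cl x" if "z \<in> cl x" "z' \<in> sub z" "x \<in> D" for z z' x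
    using that cl_D[OF that(1,3)] unfolding cl_def S_def by (auto intro: converse_rtrancl_into_rtrancl)
  have Tx_le: "Tx x \<subseteq> elts T" if T: "T \<in> V" "good T" and x: "x \<in> D" "pair x y \<in> elts T" for T x y
  proof -
    have "pair z (f z) \<in> elts T" if "(z, x) \<in> S\<^sup>*" for z
      using that
    proof (induction rule: converse_rtrancl_induct)
      case base
      then show ?case using good_val[OF T x] x(2) by simp
    next
      case (step z' z)
      then show ?case using good_val[OF T _ step.IH] by (simp add: S_def)
    qed
    then show ?thesis unfolding Tx_def cl_def by auto
  qed
  have Tx_iff: "pair z w \<in> Tx x \<longleftrightarrow> z \<in> cl x \<and> w = f z" for z w x
    unfolding Tx_def by auto
  \<comment> \<open>Minimality is expressed by quantifiers over \<open>V\<close> alone, without the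
    closure \<open>cl\<close>, so that replacement can use it.\<close>
  define least where "least z y \<longleftrightarrow> good y \<and> (\<exists>w\<in>V. pair z w \<in> elts y) \<and>
    (\<forall>T\<in>V. good T \<and> (\<exists>w\<in>V. pair z w \<in> elts T) \<longrightarrow> (\<forall>p\<in>elts y. p \<in> elts T))" for z y
  have definable_least: "definable (\<lambda>e. least (e 0) (e 1))"
    unfolding least_def by (intro definable_intros definable_good)
  have self: "x \<in> cl x" for x by (simp add: cl_def)
  have least: "least z y \<longleftrightarrow> y = vset (Tx z)"
    if z: "z \<in> D" "is_set (Tx z)" "good (vset (Tx z))" and y: "y \<in> V" for z y
  proof -
    have "pair z (f z) \<in> Tx z" using self by (simp add: Tx_iff)
    then have fz: "f z \<in> V" using is_set_subset[OF z(2)] by auto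
    have ex: "\<exists>w\<in>V. pair z w \<in> elts (vset (Tx z))"
      using fz \<open>pair z (f z) \<in> Tx z\<close> by (auto simp: is_set_vset(2)[OF z(2)])
    show ?thesis
    proof
      assume l: "least z y"
      then obtain w where w: "pair z w \<in> elts y" "good y" unfolding least_def by blast
      have "Tx z \<subseteq> elts y" by (rule Tx_le[OF y w(2) z(1) w(1)])
      moreover have "elts y \<subseteq> elts (vset (Tx z))"
        using l is_set_vset(1)[OF z(2)] z(3) ex unfolding least_def by auto
      ultimately have "elts y = elts (vset (Tx z))" by (auto simp: is_set_vset(2)[OF z(2)])
      then show "y = vset (Tx z)" by (rule elts_inject)
    next
      assume "y = vset (Tx z)"
      then show "least z y"
        unfolding least_def using z(3) ex Tx_le[OF _ _ z(1)]
        by (auto simp: is_set_vset(2)[OF z(2)])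
    qed
  qed
  have main: "is_set (Tx x) \<and> good (vset (Tx x)) \<and> f x \<in> V" if "x \<in> D" for x
    using that
  proof (induction x rule: wf_induct_rule[OF wf])
    case (1 x)
    have x: "x \<in> D" by fact
    have IH: "z \<in> D" "is_set (Tx z)" "good (vset (Tx z))" if "z \<in> sub x" for z
      using 1(1)[of z] sub[OF x that] by simp_all
    have "is_set ((\<lambda>z. vset (Tx z)) ` sub x)"
      by (rule replacement[OF sub_set[OF x] definable_least])
        (use least[OF IH] is_set_vset(1)[OF IH(2)] in simp_all)
    then have "is_set (\<Union>y\<in>(\<lambda>z. vset (Tx z)) ` sub x. elts y)" by (rule is_set_Union)
    also have "(\<Union>y\<in>(\<lambda>z. vset (Tx z)) ` sub x. elts y) = (\<Union>z\<in>sub x. Tx z)"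
      using is_set_vset(2)[OF IH(2)] by simp
    finally have U: "is_set (\<Union>z\<in>sub x. Tx z)" .
    \<comment> \<open>The union of the graphs below \<open>x\<close> agrees with \<open>f\<close> on
      \<open>sub x\<close>, which is all that \<open>step\<close> asks of it.\<close>
    have fx: "f x \<in> V"
    proof -
      have "pair z w \<in> elts (vset (\<Union>z\<in>sub x. Tx z)) \<longleftrightarrow> w = f z" if "z \<in> sub x" for z w
        unfolding is_set_vset(2)[OF U] using that self by (auto simp: Tx_iff)
      from step[OF x is_set_vset(1)[OF U] this] show ?thesis by simp
    qed
    have "Tx x = insert (pair x (f x)) (\<Union>z\<in>sub x. Tx z)"
      unfolding Tx_def cl_step[OF x] by auto
    then have Tx: "is_set (Tx x)" using is_set_insert[OF _ U] fx x D by auto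
    have "good (vset (Tx x))"
      unfolding good_def is_set_vset(2)[OF Tx]
    proof
      fix p assume p: "p \<in> Tx x"
      then obtain u where u: "p = pair u (f u)" "u \<in> cl x" unfolding Tx_def by blast
      have "u \<in> V" "f u \<in> V" using p u is_set_subset[OF Tx] by auto
      moreover have "St u (f u) (vset (Tx x))"
        using step[OF cl_D[OF u(2) x] is_set_vset(1)[OF Tx]] cl_sub[OF u(2) _ x]
        unfolding is_set_vset(2)[OF Tx] Tx_iff by simp
      ultimately show "\<exists>x'\<in>V. \<exists>y\<in>V. p = pair x' y \<and> St x' y (vset (Tx x))"
        using u(1) by blast
    qed
    then show ?case using Tx fx by simp
  qed
  show ?thesis
  proof (rule fun_inI[OF A(1), where P = "\<lambda>x y. \<exists>T\<in>V. good T \<and> pair x y \<in> elts T"])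
    show "definable (\<lambda>e. \<exists>T\<in>V. good T \<and> pair (e 0) (e 1) \<in> elts T)"
      by (intro definable_intros definable_good)
    fix x assume "x \<in> elts A"
    then have x: "x \<in> D" using A by blast
    note m = main[OF x]
    show "f x \<in> V" using m by simp
    fix y
    show "(\<exists>T\<in>V. good T \<and> pair x y \<in> elts T) \<longleftrightarrow> y = f x"
    proof
      show "y = f x" if "\<exists>T\<in>V. good T \<and> pair x y \<in> elts T"
        using that good_val[OF _ _ x] by blast
      show "\<exists>T\<in>V. good T \<and> pair x y \<in> elts T" if "y = f x"
        using that m self by (intro bexI[of _ "vset (Tx x)"]) (simp_all add: is_set_vset Tx_iff)
    qed
  qed
qed

end

section \<open>Translating formulas into Borel codes\<close>

lemma map_vnat_inject [simp]: "map vnat vs = map (vnat :: nat \<Rightarrow> 'u::set_universe) ws \<longleftrightarrow> vs = ws"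
  by (simp add: inj_map_eq_map inj_def)

lemma free_vars_simps:
  "free_vars (fRel R vs) = set vs"
  "free_vars (fEq i j) = {i, j}"
  "free_vars (fNeg \<phi>) = free_vars \<phi>"
  "free_vars (fEx n \<phi>) = free_vars \<phi> - {n}"
  "free_vars (fAll n \<phi>) = free_vars \<phi> - {n}"
  "free_vars (fConj \<Phi>) = (\<Union>\<phi>\<in>elts \<Phi>. free_vars \<phi>)"
  "free_vars (fDisj \<Phi>) = (\<Union>\<phi>\<in>elts \<Phi>. free_vars \<phi>)"
  by (subst free_vars.simps; auto simp: formula_defs)+

lemma fsat_simps:
  "fsat X M s (fRel R vs) \<longleftrightarrow> pair R (tuple (map s vs)) \<in> elts M"
  "fsat X M s (fEq i j) \<longleftrightarrow> s i = s j"
  "fsat X M s (fNeg \<phi>) \<longleftrightarrow> \<not> fsat X M s \<phi>"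
  "fsat X M s (fEx n \<phi>) \<longleftrightarrow> (\<exists>x\<in>elts X. fsat X M (s(n := x)) \<phi>)"
  "fsat X M s (fAll n \<phi>) \<longleftrightarrow> (\<forall>x\<in>elts X. fsat X M (s(n := x)) \<phi>)"
  "fsat X M s (fConj \<Phi>) \<longleftrightarrow> (\<forall>\<phi>\<in>elts \<Phi>. fsat X M s \<phi>)"
  "fsat X M s (fDisj \<Phi>) \<longleftrightarrow> (\<exists>\<phi>\<in>elts \<Phi>. fsat X M s \<phi>)"
  by (subst fsat.simps; auto simp: formula_defs)+

lemma fsat_cong:
  assumes "\<phi> \<in> infinitary_formulas V \<kappa> L" "\<And>i. i \<in> free_vars \<phi> \<Longrightarrow> s i = t i"
  shows "fsat X M s \<phi> \<longleftrightarrow> fsat X M t \<phi>"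
  using assms
proof (induction arbitrary: s t)
  case (1 \<phi>)
  from 1(1) show ?case
  proof cases
    case (1 R vs)
    then have "map s vs = map t vs" using \<open>\<And>i. i \<in> free_vars \<phi> \<Longrightarrow> s i = t i\<close> by (simp add: free_vars_simps)
    then show ?thesis by (simp only: 1 fsat_simps)
  next
    case (2 i j)
    then show ?thesis using \<open>\<And>i. i \<in> free_vars \<phi> \<Longrightarrow> s i = t i\<close> by (simp add: fsat_simps free_vars_simps)
  qed
next
  case (3 \<phi> n)
  have "fsat X M (s(n := x)) \<phi> \<longleftrightarrow> fsat X M (t(n := x)) \<phi>" for x
    by (rule "3.IH") (use "3.prems" in \<open>auto simp: free_vars_simps\<close>)
  then show ?case by (simp add: fsat_simps)
next
  case (4 \<phi> n)
  have "fsat X M (s(n := x)) \<phi> \<longleftrightarrow> fsat X M (t(n := x)) \<phi>" for x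
    by (rule "4.IH") (use "4.prems" in \<open>auto simp: free_vars_simps\<close>)
  then show ?case by (simp add: fsat_simps)
next
  case (5 \<Phi>)
  have "fsat X M s \<phi> \<longleftrightarrow> fsat X M t \<phi>" if "\<phi> \<in> elts \<Phi>" for \<phi>
    by (rule "5.IH"[OF that]) (use "5.prems" that in \<open>auto simp: free_vars_simps\<close>)
  then show ?case by (simp add: fsat_simps)
next
  case (6 \<Phi>)
  have "fsat X M s \<phi> \<longleftrightarrow> fsat X M t \<phi>" if "\<phi> \<in> elts \<Phi>" for \<phi>
    by (rule "6.IH"[OF that]) (use "6.prems" that in \<open>auto simp: free_vars_simps\<close>)
  then show ?case by (simp add: fsat_simps)
next
  case (2 \<phi>)
  have "fsat X M s \<phi> \<longleftrightarrow> fsat X M t \<phi>"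
    by (rule "2.IH") (use "2.prems" in \<open>simp add: free_vars_simps\<close>)
  then show ?case by (simp add: fsat_simps)
qed

text \<open>\<open>cTrue\<close> and \<open>cFalse\<close> are neutral for \<open>cAnd\<close> and
  \<open>cOr\<close>, so padding with them gives empty conjunctions and disjunctions the right
  interpretation.\<close>

definition cTrue :: "'u::set_universe" where
  "cTrue = cBasic (fConj (vset {})) []"

definition cFalse :: "'u::set_universe" where
  "cFalse = cNeg cTrue"

text \<open>A \<open>\<kappa>\<close>-indexed family of codes is never empty, so empty conjunctions and disjunctions are
  padded with \<open>d\<close>.\<close>

definition pad :: "'a \<Rightarrow> 'a set \<Rightarrow> 'a set" where
  "pad d S = (if S = {} then {d} else S)"

lemma pad_nonempty: "pad d S \<noteq> {}"
  by (simp add: pad_def)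

text \<open>Atomic formulas are renamed to use the variables \<open>0, 1, \<dots>\<close>, so that the tuple of a basic code
  only depends on the values of the variables that occur.\<close>

function code_of :: "'u::set_universe \<Rightarrow> (nat \<Rightarrow> 'u) \<Rightarrow> 'u \<Rightarrow> 'u" where
  "code_of X s \<phi> = (THE c.
     (\<exists>R vs. \<phi> = fRel R vs \<and> c = cBasic (fConj (vset {fRel R [0..<length vs]})) (map s vs)) \<or>
     (\<exists>i j. \<phi> = fEq i j \<and> c = cBasic (fConj (vset {fEq 0 1})) [s i, s j]) \<or>
     (\<exists>\<psi>. \<phi> = fNeg \<psi> \<and> c = cNeg (code_of X s \<psi>)) \<or>
     (\<exists>n \<psi>. \<phi> = fEx n \<psi> \<and> c = cOr (vset (pad cFalse ((\<lambda>x. code_of X (s(n := x)) \<psi>) ` elts X)))) \<or>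
     (\<exists>n \<psi>. \<phi> = fAll n \<psi> \<and> c = cAnd (vset (pad cTrue ((\<lambda>x. code_of X (s(n := x)) \<psi>) ` elts X)))) \<or>
     (\<exists>\<Phi>. \<phi> = fConj \<Phi> \<and> c = cAnd (vset (pad cTrue ((\<lambda>\<psi>. code_of X s \<psi>) ` elts \<Phi>)))) \<or>
     (\<exists>\<Phi>. \<phi> = fDisj \<Phi> \<and> c = cOr (vset (pad cFalse ((\<lambda>\<psi>. code_of X s \<psi>) ` elts \<Phi>)))))"
  by auto
termination
  by (relation "inv_image below (\<lambda>(X, s, \<phi>). \<phi>)")
     (auto simp: wf_below formula_defs intro: below_tag below_tag_elts below_tag_pair)
declare code_of.simps [simp del]

lemma code_of_simps:
  "code_of X s (fRel R vs) = cBasic (fConj (vset {fRel R [0..<length vs]})) (map s vs)"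
  "code_of X s (fEq i j) = cBasic (fConj (vset {fEq 0 1})) [s i, s j]"
  "code_of X s (fNeg \<phi>) = cNeg (code_of X s \<phi>)"
  "code_of X s (fEx n \<phi>) = cOr (vset (pad cFalse ((\<lambda>x. code_of X (s(n := x)) \<phi>) ` elts X)))"
  "code_of X s (fAll n \<phi>) = cAnd (vset (pad cTrue ((\<lambda>x. code_of X (s(n := x)) \<phi>) ` elts X)))"
  "code_of X s (fConj \<Phi>) = cAnd (vset (pad cTrue (code_of X s ` elts \<Phi>)))"
  "code_of X s (fDisj \<Phi>) = cOr (vset (pad cFalse (code_of X s ` elts \<Phi>)))"
  by (subst code_of.simps; auto simp: formula_defs)+

section \<open>Families of codes indexed by \<kappa> inside the model\<close>

context transitive_model begin

lemma fun_in_comp: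
  assumes "A \<in> V" "B \<in> V" "fun_in V A k" "fun_in V B h" "k ` elts A \<subseteq> elts B"
  shows "fun_in V A (\<lambda>x. h (k x))"
proof -
  obtain g where g: "g \<in> V" "elts g = (\<lambda>x. pair x (k x)) ` elts A"
    using assms(3) unfolding fun_in_def by blast
  obtain g' where g': "g' \<in> V" "elts g' = (\<lambda>x. pair x (h x)) ` elts B"
    using assms(4) unfolding fun_in_def by blast
  show ?thesis
  proof (rule fun_inI[OF assms(1), where P = "\<lambda>x c. \<exists>z\<in>V. pair x z \<in> elts g \<and> pair z c \<in> elts g'"])
    show "definable (\<lambda>e. \<exists>z\<in>V. pair (e 0) z \<in> elts g \<and> pair z (e 1) \<in> elts g')"
      by (intro definable_intros g g')
    fix x assume x: "x \<in> elts A"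
    then have kx: "k x \<in> elts B" using assms(5) by blast
    show "h (k x) \<in> V" by (rule fun_in_values[OF assms(4) kx])
    show "(\<exists>z\<in>V. pair x z \<in> elts g \<and> pair z c \<in> elts g') \<longleftrightarrow> c = h (k x)" for c
      using x kx fun_in_values[OF assms(3) x] by (auto simp: g g')
  qed
qed

lemma fun_in_finite:
  assumes "finite (elts A)" "A \<in> V" "h ` elts A \<subseteq> V"
  shows "fun_in V A h"
  unfolding fun_in_graph using assms transV by (intro is_set_finite) auto

text \<open>The graph of a function from a finite set into \<open>V\<close> is a finite subset of
  \<open>V\<close> and hence in \<open>V\<close>, so an injection found outside is good
  enough.\<close>

lemma card_le_finite:
  assumes "finite (elts A)" "A \<in> V" "B \<in> V" "infinite (elts B)"
  shows "card_le V A B"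
proof -
  obtain C where C: "finite C" "card C = card (elts A)" "C \<subseteq> elts B"
    using infinite_arbitrarily_large[OF assms(4)] by blast
  obtain h where h: "h ` elts A \<subseteq> elts B" "inj_on h (elts A)"
    using card_le_inj[OF assms(1) C(1)] C(2,3) by auto
  moreover have "fun_in V A h"
    using h transV[OF assms(3)] assms by (intro fun_in_finite) auto
  ultimately show ?thesis unfolding card_le_def by blast
qed

lemma pad_in:
  assumes "A \<in> V" "fun_in V A h" "d \<in> V"
  shows "is_set (pad d (h ` elts A))"
  using fun_in_image[OF assms(1,2)] assms(3) by (simp add: pad_def is_set_upair[of d d, simplified])

text \<open>\<open>card_le\<close> provides an injection into \<kappa>, but an indexed family needs
  a map from \<kappa> onto it: the inverse of the injection, extended by a constant.\<close>

lemma indexed_family_pad: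
  assumes A: "A \<in> V" and h: "fun_in V A h" and d: "d \<in> V"
    and \<kappa>: "\<kappa> \<in> V" "elts \<kappa> \<noteq> {}" "card_le V A \<kappa>"
  shows "indexed_family V \<kappa> (vset (pad d (h ` elts A)))"
proof -
  obtain j where j: "fun_in V A j" "inj_on j (elts A)" "j ` elts A \<subseteq> elts \<kappa>"
    using \<kappa>(3) unfolding card_le_def by blast
  obtain g where g: "g \<in> V" "elts g = (\<lambda>x. pair x (j x)) ` elts A"
    using j(1) unfolding fun_in_def by blast
  obtain g' where g': "g' \<in> V" "elts g' = (\<lambda>x. pair x (h x)) ` elts A"
    using h unfolding fun_in_def by blast
  obtain d' where d': "d' \<in> pad d (h ` elts A)" using pad_nonempty[of d "h ` elts A"] by blast
  note set = pad_in[OF A h d]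
  have d'V: "d' \<in> V" using is_set_subset[OF set] d' by blast
  define k where "k i = (if i \<in> j ` elts A then h (inv_into (elts A) j i) else d')" for i
  have "fun_in V \<kappa> k"
  proof (rule fun_inI[OF \<kappa>(1), where P = "\<lambda>i y. (\<exists>x\<in>elts A. pair x i \<in> elts g \<and> pair x y \<in> elts g') \<or>
      \<not> (\<exists>x\<in>elts A. pair x i \<in> elts g) \<and> y = d'"])
    show "definable (\<lambda>e. (\<exists>x\<in>elts A. pair x (e 0) \<in> elts g \<and> pair x (e 1) \<in> elts g') \<or>
      \<not> (\<exists>x\<in>elts A. pair x (e 0) \<in> elts g) \<and> e 1 = d')"
      by (intro definable_intros A g g' d'V)
    show "k i \<in> V" for i
      using d'V fun_in_values[OF h] by (auto simp: k_def j(2))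
    show "(\<exists>x\<in>elts A. pair x i \<in> elts g \<and> pair x y \<in> elts g') \<or>
      \<not> (\<exists>x\<in>elts A. pair x i \<in> elts g) \<and> y = d' \<longleftrightarrow> y = k i" for i y
      using j(2) by (auto simp: k_def g g' inj_on_eq_iff)
  qed
  moreover have "pad d (h ` elts A) = k ` elts \<kappa>"
  proof (cases "elts A = {}")
    case True
    then show ?thesis using \<kappa>(2) d' by (auto simp: pad_def k_def)
  next
    case False
    then have p: "pad d (h ` elts A) = h ` elts A" by (simp add: pad_def)
    show ?thesis
    proof
      show "k ` elts \<kappa> \<subseteq> pad d (h ` elts A)"
        using d' by (auto simp: p k_def j(2))
      have "h x = k (j x)" if "x \<in> elts A" for x
        using that j(2) by (simp add: k_def)
      then show "pad d (h ` elts A) \<subseteq> k ` elts \<kappa>" unfolding p using j(3) by blast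
    qed
  qed
  ultimately show ?thesis
    unfolding indexed_family_def using is_set_vset[OF set] by auto
qed

end

section \<open>First-order descriptions of assignments, tuples and families\<close>

lemma elts_eq_elts_iff: "elts x = elts y \<longleftrightarrow> x = y"
  by (rule iffI, rule elts_inject) simp_all

lemma elts_tuple_map: "elts (tuple (map s vs)) = (\<lambda>i. pair (vnat i) (s (vs ! i))) ` {..<length vs}"
  unfolding elts_tuple by auto

lemma pair_in_tuple: "pair (vnat i) x \<in> elts (tuple as) \<longleftrightarrow> i < length as \<and> x = as ! i"
  unfolding elts_tuple by auto

lemma pair_in_tuple_map:
  "pair j x \<in> elts (tuple (map s vs)) \<longleftrightarrow> (\<exists>i<length vs. j = vnat i \<and> x = s (vs ! i))"
  unfolding elts_tuple_map by auto

context transitive_model begin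

lemma elts_eq_iff:
  assumes "b \<in> V" "S \<subseteq> V"
  shows "(\<forall>p\<in>V. p \<in> elts b \<longleftrightarrow> p \<in> S) \<longleftrightarrow> elts b = S"
  using transV[OF assms(1)] assms(2) by auto

text \<open>The operations of the recursion come in pairs: a relation bounded by \<open>V\<close>,
  which is definable, and the HOL object that it determines. Here \<open>a\<close> is the graph of
  an assignment, changed at the variable \<open>v\<close>.\<close>

definition isupd :: "'u \<Rightarrow> 'u \<Rightarrow> 'u \<Rightarrow> 'u \<Rightarrow> bool" where
  "isupd a v x a' \<longleftrightarrow>
     (\<forall>p\<in>V. p \<in> elts a' \<longleftrightarrow> p = pair v x \<or> p \<in> elts a \<and> \<not> (\<exists>w\<in>V. p = pair v w))"

definition upd :: "'u \<Rightarrow> 'u \<Rightarrow> 'u \<Rightarrow> 'u" where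
  "upd a v x = vset (insert (pair v x) {p\<in>elts a. \<not> (\<exists>w\<in>V. p = pair v w)})"

lemma definable_isupd: "definable (\<lambda>e. isupd (e i) (e j) (e k) (e l))"
  unfolding isupd_def by (intro definable_intros)

lemma is_set_upd:
  assumes "a \<in> V" "v \<in> V" "x \<in> V"
  shows "is_set (insert (pair v x) {p\<in>elts a. \<not> (\<exists>w\<in>V. p = pair v w)})"
  using assms by (intro is_set_insert separation is_set_elts definable_intros) simp_all

lemma upd_in:
  assumes "a \<in> V" "v \<in> V" "x \<in> V"
  shows "upd a v x \<in> V"
    and "elts (upd a v x) = insert (pair v x) {p\<in>elts a. \<not> (\<exists>w\<in>V. p = pair v w)}"
  unfolding upd_def using is_set_vset[OF is_set_upd[OF assms]] by simp_all

lemma isupd_iff: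
  assumes "a \<in> V" "v \<in> V" "x \<in> V" "a' \<in> V"
  shows "isupd a v x a' \<longleftrightarrow> a' = upd a v x"
proof -
  have "isupd a v x a' \<longleftrightarrow> (\<forall>p\<in>V. p \<in> elts a' \<longleftrightarrow> p \<in> elts (upd a v x))"
    unfolding isupd_def upd_in(2)[OF assms(1-3)] by simp
  also have "\<dots> \<longleftrightarrow> elts a' = elts (upd a v x)"
    by (intro elts_eq_iff assms is_set_subset is_set_elts upd_in(1))
  also have "\<dots> \<longleftrightarrow> a' = upd a v x" by (rule elts_eq_elts_iff)
  finally show ?thesis .
qed

text \<open>Applied to a tuple of variables, the diagonal of its domain is the tuple of the
  variables \<open>0, 1, ...\<close> of the same length, as needed for the renamed atomic formulas
  of \<open>code_of\<close>.\<close>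

definition isdiag :: "'u \<Rightarrow> 'u \<Rightarrow> bool" where
  "isdiag v d \<longleftrightarrow> (\<forall>p\<in>V. p \<in> elts d \<longleftrightarrow> (\<exists>j\<in>V. \<exists>i\<in>V. pair j i \<in> elts v \<and> p = pair j j))"

definition iscomp :: "'u \<Rightarrow> 'u \<Rightarrow> 'u \<Rightarrow> bool" where
  "iscomp v a w \<longleftrightarrow> (\<forall>p\<in>V. p \<in> elts w \<longleftrightarrow>
     (\<exists>j\<in>V. \<exists>i\<in>V. \<exists>u\<in>V. pair j i \<in> elts v \<and> pair i u \<in> elts a \<and> p = pair j u))"

lemma definable_isdiag: "definable (\<lambda>e. isdiag (e i) (e j))"
  unfolding isdiag_def by (intro definable_intros)

lemma definable_iscomp: "definable (\<lambda>e. iscomp (e i) (e j) (e k))"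
  unfolding iscomp_def by (intro definable_intros)

lemma isdiag_iff:
  assumes "d \<in> V"
  shows "isdiag (tuple (map vnat vs)) d \<longleftrightarrow> d = tuple (map vnat [0..<length vs])"
proof -
  have "(\<exists>j\<in>V. \<exists>i\<in>V. pair j i \<in> elts (tuple (map vnat vs)) \<and> p = pair j j) \<longleftrightarrow>
      p \<in> elts (tuple (map vnat [0..<length vs]))" for p
    unfolding pair_in_tuple_map by (auto simp: elts_tuple_map)
  then have "isdiag (tuple (map vnat vs)) d \<longleftrightarrow>
      (\<forall>p\<in>V. p \<in> elts d \<longleftrightarrow> p \<in> elts (tuple (map vnat [0..<length vs])))"
    unfolding isdiag_def by simp
  also have "\<dots> \<longleftrightarrow> elts d = elts (tuple (map vnat [0..<length vs]))"
    by (intro elts_eq_iff assms is_set_subset is_set_elts) auto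
  also have "\<dots> \<longleftrightarrow> d = tuple (map vnat [0..<length vs])" by (rule elts_eq_elts_iff)
  finally show ?thesis .
qed

text \<open>Only the values of \<open>a\<close> at variables from \<open>vs\<close> matter, so the
  lemma serves both for assignments defined on all numerals and for the finite tuples of basic
  codes.\<close>

lemma iscomp_iff:
  assumes "w \<in> V" and s: "\<And>i. i \<in> set vs \<Longrightarrow> s i \<in> V"
    and a: "\<And>i u. i \<in> set vs \<Longrightarrow> pair (vnat i) u \<in> elts a \<longleftrightarrow> u = s i"
  shows "iscomp (tuple (map vnat vs)) a w \<longleftrightarrow> w = tuple (map s vs)"
proof -
  have "(\<exists>j\<in>V. \<exists>i\<in>V. \<exists>u\<in>V. pair j i \<in> elts (tuple (map vnat vs)) \<and> pair i u \<in> elts a \<and> p = pair j u) \<longleftrightarrow>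
      p \<in> elts (tuple (map s vs))" (is "?l \<longleftrightarrow> ?r") for p
  proof
    assume ?l
    then obtain n u where n: "n < length vs" "pair (vnat (vs ! n)) u \<in> elts a" "p = pair (vnat n) u"
      unfolding pair_in_tuple_map by blast
    then have "u = s (vs ! n)" using a[OF nth_mem[OF n(1)]] by simp
    then show ?r unfolding elts_tuple_map using n by blast
  next
    assume ?r
    then obtain i where i: "i < length vs" "p = pair (vnat i) (s (vs ! i))"
      unfolding elts_tuple_map by blast
    have "pair (vnat i) (vnat (vs ! i)) \<in> elts (tuple (map vnat vs))"
      using i(1) unfolding pair_in_tuple_map by blast
    moreover have "pair (vnat (vs ! i)) (s (vs ! i)) \<in> elts a"
      using a[OF nth_mem[OF i(1)]] by simp
    ultimately show ?l using i(2) s[OF nth_mem[OF i(1)]] vnat_in by blast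
  qed
  then have "iscomp (tuple (map vnat vs)) a w \<longleftrightarrow>
      (\<forall>p\<in>V. p \<in> elts w \<longleftrightarrow> p \<in> elts (tuple (map s vs)))"
    unfolding iscomp_def by simp
  also have "\<dots> \<longleftrightarrow> elts w = elts (tuple (map s vs))"
    using s by (intro elts_eq_iff assms is_set_subset is_set_elts) auto
  also have "\<dots> \<longleftrightarrow> w = tuple (map s vs)" by (rule elts_eq_elts_iff)
  finally show ?thesis .
qed

text \<open>\<open>T\<close> is the table of values found so far. The first conjunct makes the
  relation fail when a value is missing, as the hypothesis \<open>uniq\<close> of
  \<open>fun_in_recursion\<close> requires.\<close>

definition famset :: "'u \<Rightarrow> 'u \<Rightarrow> 'u \<Rightarrow> 'u \<Rightarrow> bool" where
  "famset d B T \<Gamma> \<longleftrightarrow> (\<forall>z\<in>elts B. \<exists>c\<in>V. pair z c \<in> elts T) \<and>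
     (\<forall>c\<in>V. c \<in> elts \<Gamma> \<longleftrightarrow> (\<exists>z\<in>elts B. pair z c \<in> elts T) \<or> c = d \<and> \<not> (\<exists>z\<in>V. z \<in> elts B))"

lemma definable_famset: "d \<in> V \<Longrightarrow> definable (\<lambda>e. famset d (e i) (e j) (e k))"
  unfolding famset_def by (intro definable_intros)

lemma famset_iff:
  assumes B: "B \<in> V" and T: "T \<in> V" and d: "d \<in> V"
    and f: "\<And>z w. z \<in> elts B \<Longrightarrow> pair z w \<in> elts T \<Longrightarrow> w = f z"
  defines "tot \<equiv> \<forall>z\<in>elts B. pair z (f z) \<in> elts T"
  shows "tot \<Longrightarrow> is_set (pad d (f ` elts B))"
    and "y \<in> V \<Longrightarrow> (\<exists>\<Gamma>\<in>V. y = tag k \<Gamma> \<and> famset d B T \<Gamma>) \<longleftrightarrow>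
      tot \<and> y = tag k (vset (pad d (f ` elts B)))"
proof -
  show set: "is_set (pad d (f ` elts B))" if t: tot
  proof (rule pad_in[OF B _ d], rule fun_inI[OF B, where P = "\<lambda>x y. pair x y \<in> elts T"])
    show "definable (\<lambda>e. pair (e 0) (e 1) \<in> elts T)" by (intro definable_intros T)
    fix x assume x: "x \<in> elts B"
    have "pair x (f x) \<in> elts T" using t x unfolding tot_def by blast
    then show "f x \<in> V" and "pair x y \<in> elts T \<longleftrightarrow> y = f x" for y
      using transV[OF T, of "pair x (f x)"] f[OF x, of y] by auto
  qed
  have fam: "famset d B T \<Gamma> \<longleftrightarrow> tot \<and> elts \<Gamma> = pad d (f ` elts B)" if "\<Gamma> \<in> V" for \<Gamma>
  proof -
    have tot: "(\<forall>z\<in>elts B. \<exists>c\<in>V. pair z c \<in> elts T) \<longleftrightarrow> tot"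
    proof
      assume *: "\<forall>z\<in>elts B. \<exists>c\<in>V. pair z c \<in> elts T"
      show tot unfolding tot_def
      proof
        fix z assume z: "z \<in> elts B"
        then obtain c where "pair z c \<in> elts T" using * by blast
        then show "pair z (f z) \<in> elts T" using f[OF z] by blast
      qed
    next
      assume tot
      show "\<forall>z\<in>elts B. \<exists>c\<in>V. pair z c \<in> elts T"
      proof
        fix z assume "z \<in> elts B"
        then have "pair z (f z) \<in> elts T" using \<open>tot\<close> unfolding tot_def by blast
        then show "\<exists>c\<in>V. pair z c \<in> elts T" using transV[OF T, of "pair z (f z)"] by auto
      qed
    qed
    have "(\<exists>z\<in>elts B. pair z c \<in> elts T) \<or> c = d \<and> \<not> (\<exists>z\<in>V. z \<in> elts B) \<longleftrightarrow> c \<in> pad d (f ` elts B)"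
      if tot for c
    proof -
      have "(\<exists>z\<in>elts B. pair z c \<in> elts T) \<longleftrightarrow> c \<in> f ` elts B"
      proof -
        have "pair z c \<in> elts T \<longleftrightarrow> c = f z" if "z \<in> elts B" for z
          using \<open>tot\<close> f[OF that, of c] that by (auto simp: tot_def)
        then show ?thesis by auto
      qed
      moreover have "(\<exists>z\<in>V. z \<in> elts B) \<longleftrightarrow> elts B \<noteq> {}" using transV[OF B] by blast
      ultimately show ?thesis by (auto simp: pad_def)
    qed
    then have "famset d B T \<Gamma> \<longleftrightarrow> tot \<and> (\<forall>c\<in>V. c \<in> elts \<Gamma> \<longleftrightarrow> c \<in> pad d (f ` elts B))"
      unfolding famset_def tot by auto
    then show ?thesis using elts_eq_iff[OF that is_set_subset[OF set]] by auto
  qed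
  show "(\<exists>\<Gamma>\<in>V. y = tag k \<Gamma> \<and> famset d B T \<Gamma>) \<longleftrightarrow> tot \<and> y = tag k (vset (pad d (f ` elts B)))"
    if "y \<in> V"
  proof
    assume "\<exists>\<Gamma>\<in>V. y = tag k \<Gamma> \<and> famset d B T \<Gamma>"
    then obtain \<Gamma> where \<Gamma>: "\<Gamma> \<in> V" "y = tag k \<Gamma>" "famset d B T \<Gamma>" by blast
    then have "tot" "elts \<Gamma> = pad d (f ` elts B)" using fam[OF \<Gamma>(1)] by simp_all
    then show "tot \<and> y = tag k (vset (pad d (f ` elts B)))" using \<Gamma>(2) by (metis vset_elts)
  next
    assume r: "tot \<and> y = tag k (vset (pad d (f ` elts B)))"
    then show "\<exists>\<Gamma>\<in>V. y = tag k \<Gamma> \<and> famset d B T \<Gamma>"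
      using is_set_vset[OF set] fam[OF is_set_vset(1)[OF set]]
      by (intro bexI[of _ "vset (pad d (f ` elts B))"]) simp_all
  qed
qed

end

section \<open>The recursion that translates formulas, inside the model\<close>

locale random_setting = transitive_model V for V :: "'u::set_universe set" +
  fixes \<kappa> X L :: 'u
  assumes \<kappa>_in: "\<kappa> \<in> V" and ordinal: "is_ordinal \<kappa>" and \<kappa>_infinite: "infinite (elts \<kappa>)"
    and X_in: "X \<in> V" and X_infinite: "infinite (elts X)"
    and L_in: "L \<in> V" and language: "relational_language L"
    and X_card: "card_le V X \<kappa>"
begin

abbreviation "formulas \<equiv> infinitary_formulas V \<kappa> L"
abbreviation "codes \<equiv> borel_codes V \<kappa> L X"

lemma X_sub: "x \<in> elts X \<Longrightarrow> x \<in> V"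
  by (rule transV[OF X_in])

lemma X_nonempty: "elts X \<noteq> {}"
  using X_infinite by auto

lemma \<kappa>_nonempty: "elts \<kappa> \<noteq> {}"
  using \<kappa>_infinite by auto

lemma symbol_in: "pair R v \<in> elts L \<Longrightarrow> R \<in> V"
  using transV[OF L_in, of "pair R v"] by simp

lemma atomic_in: "\<phi> \<in> atomic L \<Longrightarrow> \<phi> \<in> V"
  by (induction rule: atomic.induct) (auto simp: fRel_def fEq_def image_subset_iff dest: symbol_in)

lemma formulas_in: "\<phi> \<in> formulas \<Longrightarrow> \<phi> \<in> V"
  by (induction rule: infinitary_formulas.induct) (simp_all add: atomic_in formula_defs)

lemma cTrue_in [simp]: "cTrue \<in> V"
  by (simp add: cTrue_def cBasic_def fConj_def vset_finite_in)

lemma cFalse_in [simp]: "cFalse \<in> V"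
  by (simp add: cFalse_def cNeg_def)

text \<open>A recursion in \<open>V\<close> needs sets as arguments, so an assignment is represented
  by its graph. Constant assignments have graphs in \<open>V\<close> because the set of numerals is
  there, and updates, which are what quantifiers call for, preserve this.\<close>

definition asg :: "(nat \<Rightarrow> 'u) \<Rightarrow> 'u \<Rightarrow> bool" where
  "asg s a \<longleftrightarrow> a \<in> V \<and> range s \<subseteq> elts X \<and> elts a = range (\<lambda>i. pair (vnat i) (s i))"

definition val :: "'u \<Rightarrow> nat \<Rightarrow> 'u" where
  "val a i = (THE y. pair (vnat i) y \<in> elts a)"

lemma asg_pair: "asg s a \<Longrightarrow> pair (vnat i) u \<in> elts a \<longleftrightarrow> u = s i"
  unfolding asg_def by auto

lemma asg_val: "asg s a \<Longrightarrow> val a = s"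
  unfolding val_def by (rule ext) (simp add: asg_pair)

lemma asgD: "asg s a \<Longrightarrow> a \<in> V" "asg s a \<Longrightarrow> s i \<in> elts X" "asg s a \<Longrightarrow> s i \<in> V"
  unfolding asg_def using X_sub by auto

lemma asg_upd:
  assumes a: "asg s a" and x: "x \<in> elts X"
  shows "asg (s(n := x)) (upd a (vnat n) x)"
proof -
  have a': "a \<in> V" "range s \<subseteq> elts X" "elts a = range (\<lambda>i. pair (vnat i) (s i))"
    using a unfolding asg_def by simp_all
  note u = upd_in[OF a'(1) vnat_in X_sub[OF x], of n]
  have "elts (upd a (vnat n) x) = range (\<lambda>i. pair (vnat i) ((s(n := x)) i))"
  proof (rule set_eqI)
    fix p
    have "p \<in> elts (upd a (vnat n) x) \<longleftrightarrow>
        p = pair (vnat n) x \<or> (\<exists>i. i \<noteq> n \<and> p = pair (vnat i) (s i))"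
      unfolding u(2) a'(3) using asgD(3)[OF a] by auto
    also have "\<dots> \<longleftrightarrow> (\<exists>i. p = pair (vnat i) ((s(n := x)) i))" by (metis fun_upd_apply)
    finally show "p \<in> elts (upd a (vnat n) x) \<longleftrightarrow> p \<in> range (\<lambda>i. pair (vnat i) ((s(n := x)) i))"
      by auto
  qed
  then show ?thesis unfolding asg_def using u(1) a'(2) x by auto
qed

lemma ex_asg:
  assumes "x \<in> elts X"
  shows "\<exists>a. asg (\<lambda>_. x) a"
proof -
  have "is_set {pair n y |n y. n \<in> range vnat \<and> y \<in> {x}}"
    using is_set_upair[of x x] X_sub[OF assms] by (intro is_set_prod is_set_omega) simp
  moreover have "{pair n y |n y. n \<in> range vnat \<and> y \<in> {x}} = range (\<lambda>i. pair (vnat i) x)"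
    by auto
  ultimately show ?thesis using assms unfolding asg_def is_set_def by auto
qed

text \<open>A key is a pair of a formula and the graph of an assignment, the argument of the
  recursion. \<open>B\<close> collects the keys of the recursive calls made at a quantifier.\<close>

definition is_quantifier_keys :: "'u \<Rightarrow> 'u \<Rightarrow> 'u \<Rightarrow> 'u \<Rightarrow> bool" where
  "is_quantifier_keys v \<psi> a B \<longleftrightarrow>
     (\<forall>z\<in>V. z \<in> elts B \<longleftrightarrow> (\<exists>x\<in>elts X. \<exists>a'\<in>V. isupd a v x a' \<and> z = pair \<psi> a'))"

definition is_connective_keys :: "'u \<Rightarrow> 'u \<Rightarrow> 'u \<Rightarrow> bool" where
  "is_connective_keys \<Phi> a B \<longleftrightarrow> (\<forall>z\<in>V. z \<in> elts B \<longleftrightarrow> (\<exists>\<psi>\<in>elts \<Phi>. z = pair \<psi> a))"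

lemma definable_is_quantifier_keys: "definable (\<lambda>e. is_quantifier_keys (e i) (e j) (e k) (e l))"
  unfolding is_quantifier_keys_def by (intro definable_intros definable_isupd X_in)

lemma definable_is_connective_keys: "definable (\<lambda>e. is_connective_keys (e i) (e j) (e k))"
  unfolding is_connective_keys_def by (intro definable_intros)

definition quantifier_keys :: "nat \<Rightarrow> 'u \<Rightarrow> 'u \<Rightarrow> 'u set" where
  "quantifier_keys n \<psi> a = (\<lambda>x. pair \<psi> (upd a (vnat n) x)) ` elts X"

definition connective_keys :: "'u \<Rightarrow> 'u \<Rightarrow> 'u set" where
  "connective_keys \<Phi> a = (\<lambda>\<psi>. pair \<psi> a) ` elts \<Phi>"

lemma fun_in_quantifier_keys:
  assumes "\<psi> \<in> V" "a \<in> V"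
  shows "fun_in V X (\<lambda>x. pair \<psi> (upd a (vnat n) x))"
\<comment> \<open>\<open>definable_isupd\<close> is about variables, so the constants
  \<open>vnat n\<close> and \<open>a\<close> enter as quantified variables.\<close>
proof (rule fun_inI[OF X_in, where P = "\<lambda>x z. \<exists>v\<in>V. v = vnat n \<and> (\<exists>b\<in>V. b = a \<and> (\<exists>a'\<in>V. isupd b v x a' \<and> z = pair \<psi> a'))"])
  show "definable (\<lambda>e. \<exists>v\<in>V. v = vnat n \<and> (\<exists>b\<in>V. b = a \<and> (\<exists>a'\<in>V. isupd b v (e 0) a' \<and> e 1 = pair \<psi> a')))"
    by (intro definable_intros definable_isupd assms vnat_in)
  fix x assume x: "x \<in> elts X"
  note u = upd_in(1)[OF assms(2) vnat_in X_sub[OF x]]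
  show "pair \<psi> (upd a (vnat n) x) \<in> V" using u assms by simp
  show "(\<exists>v\<in>V. v = vnat n \<and> (\<exists>b\<in>V. b = a \<and> (\<exists>a'\<in>V. isupd b v x a' \<and> z = pair \<psi> a'))) \<longleftrightarrow>
    z = pair \<psi> (upd a (vnat n) x)" for z
    using isupd_iff[OF assms(2) vnat_in X_sub[OF x]] u assms(2) by auto
qed

lemma fun_in_connective_keys:
  assumes "\<Phi> \<in> V" "a \<in> V"
  shows "fun_in V \<Phi> (\<lambda>\<psi>. pair \<psi> a)"
proof (rule fun_inI[OF assms(1), where P = "\<lambda>\<psi> z. z = pair \<psi> a"])
  show "definable (\<lambda>e. e 1 = pair (e 0) a)" by (intro definable_intros assms)
qed (use assms transV in auto)

lemma is_set_quantifier_keys: "\<psi> \<in> V \<Longrightarrow> a \<in> V \<Longrightarrow> is_set (quantifier_keys n \<psi> a)"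
  unfolding quantifier_keys_def by (intro fun_in_image fun_in_quantifier_keys X_in)

lemma is_set_connective_keys: "\<Phi> \<in> V \<Longrightarrow> a \<in> V \<Longrightarrow> is_set (connective_keys \<Phi> a)"
  unfolding connective_keys_def by (intro fun_in_image fun_in_connective_keys)

lemma is_quantifier_keys_iff:
  assumes "\<psi> \<in> V" "a \<in> V" "B \<in> V"
  shows "is_quantifier_keys (vnat n) \<psi> a B \<longleftrightarrow> B = vset (quantifier_keys n \<psi> a)"
proof -
  have "(\<exists>x\<in>elts X. \<exists>a'\<in>V. isupd a (vnat n) x a' \<and> z = pair \<psi> a') \<longleftrightarrow> z \<in> quantifier_keys n \<psi> a" for z
  proof -
    have "(\<exists>a'\<in>V. isupd a (vnat n) x a' \<and> z = pair \<psi> a') \<longleftrightarrow> z = pair \<psi> (upd a (vnat n) x)"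
      if "x \<in> elts X" for x
      using isupd_iff[OF assms(2) vnat_in X_sub[OF that]] upd_in(1)[OF assms(2) vnat_in X_sub[OF that]]
      by auto
    then show ?thesis unfolding quantifier_keys_def by auto
  qed
  then have "is_quantifier_keys (vnat n) \<psi> a B \<longleftrightarrow> (\<forall>z\<in>V. z \<in> elts B \<longleftrightarrow> z \<in> quantifier_keys n \<psi> a)"
    unfolding is_quantifier_keys_def by simp
  also have "\<dots> \<longleftrightarrow> elts B = quantifier_keys n \<psi> a"
    by (intro elts_eq_iff assms is_set_subset is_set_quantifier_keys)
  also have "\<dots> \<longleftrightarrow> B = vset (quantifier_keys n \<psi> a)"
    using is_set_vset(2)[OF is_set_quantifier_keys[OF assms(1,2)]] by (metis vset_elts)
  finally show ?thesis .
qed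

lemma is_connective_keys_iff:
  assumes "\<Phi> \<in> V" "a \<in> V" "B \<in> V"
  shows "is_connective_keys \<Phi> a B \<longleftrightarrow> B = vset (connective_keys \<Phi> a)"
proof -
  have "is_connective_keys \<Phi> a B \<longleftrightarrow> (\<forall>z\<in>V. z \<in> elts B \<longleftrightarrow> z \<in> connective_keys \<Phi> a)"
    unfolding is_connective_keys_def connective_keys_def by auto
  also have "\<dots> \<longleftrightarrow> elts B = connective_keys \<Phi> a"
    by (intro elts_eq_iff assms is_set_subset is_set_connective_keys)
  also have "\<dots> \<longleftrightarrow> B = vset (connective_keys \<Phi> a)"
    using is_set_vset(2)[OF is_set_connective_keys[OF assms(1,2)]] by (metis vset_elts)
  finally show ?thesis .
qed

text \<open>The clauses of \<open>code_of\<close>, with tags for the syntax so that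
  \<open>definable_intros\<close> applies to every term, and with lookups in the table
  \<open>T\<close> for the recursive calls.\<close>

definition code_step :: "'u \<Rightarrow> 'u \<Rightarrow> 'u \<Rightarrow> 'u \<Rightarrow> bool" where
  "code_step \<phi> a y T \<longleftrightarrow>
     (\<exists>R\<in>V. \<exists>v\<in>V. \<phi> = tag 0 (pair R v) \<and> (\<exists>d\<in>V. \<exists>w\<in>V. isdiag v d \<and> iscomp v a w \<and>
        y = tag 0 (pair (tag 5 (vset {tag 0 (pair R d)})) w))) \<or>
     (\<exists>i\<in>V. \<exists>j\<in>V. \<phi> = tag 1 (pair i j) \<and> (\<exists>u\<in>V. \<exists>w\<in>V. pair i u \<in> elts a \<and> pair j w \<in> elts a \<and>
        y = tag 0 (pair (tag 5 (vset {tag 1 (pair (vnat 0) (vnat 1))}))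
          (vset {pair (vnat 0) u, pair (vnat 1) w})))) \<or>
     (\<exists>\<psi>\<in>V. \<phi> = tag 2 \<psi> \<and> (\<exists>c\<in>V. pair (pair \<psi> a) c \<in> elts T \<and> y = tag 1 c)) \<or>
     (\<exists>v\<in>V. \<exists>\<psi>\<in>V. \<phi> = tag 3 (pair v \<psi>) \<and>
        (\<exists>B\<in>V. is_quantifier_keys v \<psi> a B \<and> (\<exists>\<Gamma>\<in>V. y = tag 2 \<Gamma> \<and> famset cFalse B T \<Gamma>))) \<or>
     (\<exists>v\<in>V. \<exists>\<psi>\<in>V. \<phi> = tag 4 (pair v \<psi>) \<and>
        (\<exists>B\<in>V. is_quantifier_keys v \<psi> a B \<and> (\<exists>\<Gamma>\<in>V. y = tag 3 \<Gamma> \<and> famset cTrue B T \<Gamma>))) \<or>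
     (\<exists>\<Phi>\<in>V. \<phi> = tag 5 \<Phi> \<and>
        (\<exists>B\<in>V. is_connective_keys \<Phi> a B \<and> (\<exists>\<Gamma>\<in>V. y = tag 3 \<Gamma> \<and> famset cTrue B T \<Gamma>))) \<or>
     (\<exists>\<Phi>\<in>V. \<phi> = tag 6 \<Phi> \<and>
        (\<exists>B\<in>V. is_connective_keys \<Phi> a B \<and> (\<exists>\<Gamma>\<in>V. y = tag 2 \<Gamma> \<and> famset cFalse B T \<Gamma>)))"

definition code_St :: "'u \<Rightarrow> 'u \<Rightarrow> 'u \<Rightarrow> bool" where
  "code_St x y T \<longleftrightarrow> (\<exists>\<phi>\<in>V. \<exists>a\<in>V. x = pair \<phi> a \<and> code_step \<phi> a y T)"

lemma definable_code_St: "definable (\<lambda>e. code_St (e i) (e j) (e k))"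
  unfolding code_St_def code_step_def
  by (intro definable_intros definable_is_quantifier_keys definable_is_connective_keys definable_famset definable_isdiag definable_iscomp vnat_in cTrue_in cFalse_in)

lemma code_St_pair: "pair \<phi> a \<in> V \<Longrightarrow> code_St (pair \<phi> a) y T \<longleftrightarrow> code_step \<phi> a y T"
  unfolding code_St_def by auto

definition code_dom :: "'u set" where
  "code_dom = {pair \<phi> a |\<phi> a s. \<phi> \<in> formulas \<and> asg s a}"

definition code_sub :: "'u \<Rightarrow> 'u set" where
  "code_sub x = {z. \<exists>\<phi> a. x = pair \<phi> a \<and>
     ((\<exists>\<psi>. \<phi> = fNeg \<psi> \<and> z = pair \<psi> a) \<or>
      (\<exists>n \<psi>. (\<phi> = fEx n \<psi> \<or> \<phi> = fAll n \<psi>) \<and> z \<in> quantifier_keys n \<psi> a) \<or>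
      (\<exists>\<Phi>. (\<phi> = fConj \<Phi> \<or> \<phi> = fDisj \<Phi>) \<and> z \<in> connective_keys \<Phi> a))}"

lemma code_sub_simps:
  "code_sub (pair (fRel R vs) a) = {}"
  "code_sub (pair (fEq i j) a) = {}"
  "code_sub (pair (fNeg \<psi>) a) = {pair \<psi> a}"
  "code_sub (pair (fEx n \<psi>) a) = quantifier_keys n \<psi> a"
  "code_sub (pair (fAll n \<psi>) a) = quantifier_keys n \<psi> a"
  "code_sub (pair (fConj \<Phi>) a) = connective_keys \<Phi> a"
  "code_sub (pair (fDisj \<Phi>) a) = connective_keys \<Phi> a"
  by (auto simp: code_sub_def formula_defs)

definition code_fun :: "'u \<Rightarrow> 'u" where
  "code_fun x = (THE c. \<exists>\<phi> a. x = pair \<phi> a \<and> c = code_of X (val a) \<phi>)"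

lemma code_fun_pair: "code_fun (pair \<phi> a) = code_of X (val a) \<phi>"
  unfolding code_fun_def by auto

lemma code_fun_quantifier_keys:
  assumes "asg s a"
  shows "code_fun ` quantifier_keys n \<psi> a = (\<lambda>x. code_of X (s(n := x)) \<psi>) ` elts X"
  unfolding quantifier_keys_def image_image code_fun_pair
  by (intro image_cong refl) (simp add: asg_val[OF asg_upd[OF assms]])

lemma code_fun_connective_keys:
  assumes "asg s a"
  shows "code_fun ` connective_keys \<Phi> a = code_of X s ` elts \<Phi>"
  unfolding connective_keys_def image_image code_fun_pair asg_val[OF assms] ..

text \<open>Shared by both quantifiers and both infinitary connectives, which differ only in the set
  \<open>B\<close> of keys, the tag and the padding.\<close>

lemma code_step_family:
  assumes B: "is_set B" and T: "T \<in> V" and d: "d \<in> V"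
    and keys: "\<And>C. C \<in> V \<Longrightarrow> K C \<longleftrightarrow> C = vset B"
    and part: "\<And>z w. z \<in> B \<Longrightarrow> pair z w \<in> elts T \<Longrightarrow> w = f z"
  shows "(\<forall>y\<in>V. (\<exists>C\<in>V. K C \<and> (\<exists>\<Gamma>\<in>V. y = tag k \<Gamma> \<and> famset d C T \<Gamma>)) \<longleftrightarrow>
      (\<forall>z\<in>B. pair z (f z) \<in> elts T) \<and> y = tag k (vset (pad d (f ` B)))) \<and>
    ((\<forall>z\<in>B. pair z (f z) \<in> elts T) \<longrightarrow> tag k (vset (pad d (f ` B))) \<in> V)"
proof -
  note b = is_set_vset[OF B]
  have part': "w = f z" if "z \<in> elts (vset B)" "pair z w \<in> elts T" for z w
    using part that b by simp
  note fam = famset_iff[OF b(1) T d part', unfolded b(2)]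
  have "(\<exists>C\<in>V. K C \<and> P C) \<longleftrightarrow> P (vset B)" for P
    using keys b(1) by auto
  then show ?thesis using fam is_set_vset(1) by simp
qed

text \<open>Assuming merely that \<open>T\<close> contains no wrong values, this equivalence
  delivers both \<open>step\<close> and \<open>uniq\<close> of
  \<open>fun_in_recursion\<close>.\<close>

lemma code_St_char:
  assumes "x \<in> code_dom" and T: "T \<in> V"
    and part: "\<And>z w. z \<in> code_sub x \<Longrightarrow> pair z w \<in> elts T \<Longrightarrow> w = code_fun z"
  shows "(\<forall>y\<in>V. code_St x y T \<longleftrightarrow>
      (\<forall>z\<in>code_sub x. pair z (code_fun z) \<in> elts T) \<and> y = code_fun x) \<and>
    ((\<forall>z\<in>code_sub x. pair z (code_fun z) \<in> elts T) \<longrightarrow> code_fun x \<in> V)"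
proof -
  obtain \<phi> a s where x: "x = pair \<phi> a" and \<phi>: "\<phi> \<in> formulas" and a: "asg s a"
    using assms(1) unfolding code_dom_def by blast
  have aV: "a \<in> V" by (rule asgD(1)[OF a])
  have St: "code_St x y T \<longleftrightarrow> code_step \<phi> a y T" for y
    unfolding x by (rule code_St_pair) (simp add: aV formulas_in[OF \<phi>])
  have fx: "code_fun x = code_of X s \<phi>" unfolding x code_fun_pair asg_val[OF a] ..
  note part = part[unfolded x]
  show ?thesis using \<phi>
  proof cases
    case 1
    then show ?thesis
    proof cases
      case (1 R vs)
      have R: "R \<in> V" by (rule symbol_in[OF 1(2)])
      have c: "code_of X s \<phi> = tag 0 (pair (tag 5 (vset {tag 0 (pair R (tuple (map vnat [0..<length vs])))}))
          (tuple (map s vs)))"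
        unfolding 1(1) code_of_simps unfolding cBasic_def fConj_def fRel_def by simp
      have st: "code_step \<phi> a y T \<longleftrightarrow> y = code_of X s \<phi>" for y
      proof -
        have "code_step \<phi> a y T \<longleftrightarrow> (\<exists>d\<in>V. \<exists>w\<in>V. isdiag (tuple (map vnat vs)) d \<and>
            iscomp (tuple (map vnat vs)) a w \<and> y = tag 0 (pair (tag 5 (vset {tag 0 (pair R d)})) w))"
          unfolding code_step_def 1(1) fRel_def using R by (auto simp: image_subset_iff)
        also have "\<dots> \<longleftrightarrow> y = code_of X s \<phi>"
        proof -
          have comp: "iscomp (tuple (map vnat vs)) a w \<longleftrightarrow> w = tuple (map s vs)" if "w \<in> V" for w
            by (rule iscomp_iff[OF that asgD(3)[OF a] asg_pair[OF a]])
          have "tuple (map vnat [0..<length vs]) \<in> V" "tuple (map s vs) \<in> V"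
            using asgD(3)[OF a] by (simp_all add: image_subset_iff)
          then show ?thesis unfolding c by (auto simp: isdiag_iff comp)
        qed
        finally show ?thesis .
      qed
      have "code_of X s \<phi> \<in> V"
        unfolding c using R asgD(3)[OF a] by (auto simp: vset_finite_in image_subset_iff)
      then show ?thesis unfolding St fx st unfolding x 1(1) code_sub_simps by simp
    next
      case (2 i j)
      have c: "code_of X s \<phi> = tag 0 (pair (tag 5 (vset {tag 1 (pair (vnat 0) (vnat 1))}))
          (vset {pair (vnat 0) (s i), pair (vnat 1) (s j)}))"
      proof -
        have "{pair (vnat k) ([s i, s j] ! k) |k. k < length [s i, s j]} =
            {pair (vnat 0) (s i), pair (vnat 1) (s j)}"
          unfolding setcompr_eq_image lessThan_def[symmetric]
          by (simp add: lessThan_Suc insert_commute del: vnat.simps)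
        then show ?thesis unfolding 2 code_of_simps unfolding cBasic_def fConj_def fEq_def tuple_def by simp
      qed
      have st: "code_step \<phi> a y T \<longleftrightarrow> y = code_of X s \<phi>" for y
      proof -
        have "code_step \<phi> a y T \<longleftrightarrow> (\<exists>u\<in>V. \<exists>w\<in>V. pair (vnat i) u \<in> elts a \<and> pair (vnat j) w \<in> elts a \<and>
          y = tag 0 (pair (tag 5 (vset {tag 1 (pair (vnat 0) (vnat 1))}))
          (vset {pair (vnat 0) u, pair (vnat 1) w})))"
          unfolding code_step_def 2 fEq_def by auto
        also have "\<dots> \<longleftrightarrow> y = code_of X s \<phi>"
          unfolding c asg_pair[OF a] using asgD(3)[OF a] by auto
        finally show ?thesis .
      qed
      have "code_of X s \<phi> \<in> V"
        unfolding c using asgD(3)[OF a] by (auto simp: vset_finite_in)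
      then show ?thesis unfolding St fx st unfolding x 2 code_sub_simps by simp
    qed
  next
    case (2 \<psi>)
    have \<psi>: "\<psi> \<in> V" by (rule formulas_in[OF 2(2)])
    have c: "code_of X s \<phi> = tag 1 (code_fun (pair \<psi> a))"
      unfolding 2 code_of_simps cNeg_def code_fun_pair asg_val[OF a] ..
    have "code_step \<phi> a y T \<longleftrightarrow> (\<exists>c\<in>V. pair (pair \<psi> a) c \<in> elts T \<and> y = tag 1 c)" for y
      unfolding code_step_def 2 fNeg_def using \<psi> by auto
    moreover have "(\<exists>c\<in>V. pair (pair \<psi> a) c \<in> elts T \<and> y = tag 1 c) \<longleftrightarrow>
        pair (pair \<psi> a) (code_fun (pair \<psi> a)) \<in> elts T \<and> y = code_of X s \<phi>" (is "?l \<longleftrightarrow> ?r") for y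
    proof
      assume ?l
      then obtain c' where c': "pair (pair \<psi> a) c' \<in> elts T" "y = tag 1 c'" by blast
      have "c' = code_fun (pair \<psi> a)" by (rule part[OF _ c'(1)]) (simp add: 2 code_sub_simps)
      then show ?r unfolding c using c' by simp
    next
      assume r: ?r
      then have "code_fun (pair \<psi> a) \<in> V" using transV[OF T, of "pair (pair \<psi> a) (code_fun (pair \<psi> a))"] by simp
      then show ?l using r unfolding c by blast
    qed
    ultimately have st: "code_step \<phi> a y T \<longleftrightarrow>
      pair (pair \<psi> a) (code_fun (pair \<psi> a)) \<in> elts T \<and> y = code_of X s \<phi>" for y by simp
    have "code_of X s \<phi> \<in> V" if "pair (pair \<psi> a) (code_fun (pair \<psi> a)) \<in> elts T"
      unfolding c using transV[OF T that] by simp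
    then show ?thesis unfolding St fx st unfolding x 2 code_sub_simps by simp
  next
    case (3 \<psi> n)
    have \<psi>: "\<psi> \<in> V" by (rule formulas_in[OF 3(2)])
    have c: "code_of X s \<phi> = tag 2 (vset (pad cFalse (code_fun ` quantifier_keys n \<psi> a)))"
      unfolding 3 code_of_simps cOr_def code_fun_quantifier_keys[OF a] ..
    have st: "code_step \<phi> a y T \<longleftrightarrow>
        (\<exists>B\<in>V. is_quantifier_keys (vnat n) \<psi> a B \<and> (\<exists>\<Gamma>\<in>V. y = tag 2 \<Gamma> \<and> famset cFalse B T \<Gamma>))" for y
      unfolding code_step_def 3 fEx_def using \<psi> by auto
    show ?thesis
      unfolding St st fx c unfolding x 3 code_sub_simps
      by (intro code_step_family is_set_quantifier_keys T cFalse_in is_quantifier_keys_iff \<psi> aV) 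
        (use part[unfolded 3 code_sub_simps] in simp_all)
  next
    case (4 \<psi> n)
    have \<psi>: "\<psi> \<in> V" by (rule formulas_in[OF 4(2)])
    have c: "code_of X s \<phi> = tag 3 (vset (pad cTrue (code_fun ` quantifier_keys n \<psi> a)))"
      unfolding 4 code_of_simps cAnd_def code_fun_quantifier_keys[OF a] ..
    have st: "code_step \<phi> a y T \<longleftrightarrow>
        (\<exists>B\<in>V. is_quantifier_keys (vnat n) \<psi> a B \<and> (\<exists>\<Gamma>\<in>V. y = tag 3 \<Gamma> \<and> famset cTrue B T \<Gamma>))" for y
      unfolding code_step_def 4 fAll_def using \<psi> by auto
    show ?thesis
      unfolding St st fx c unfolding x 4 code_sub_simps
      by (intro code_step_family is_set_quantifier_keys T cTrue_in is_quantifier_keys_iff \<psi> aV) 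
        (use part[unfolded 4 code_sub_simps] in simp_all)
  next
    case (5 \<Phi>)
    have c: "code_of X s \<phi> = tag 3 (vset (pad cTrue (code_fun ` connective_keys \<Phi> a)))"
      unfolding 5(1) code_of_simps cAnd_def code_fun_connective_keys[OF a] ..
    have st: "code_step \<phi> a y T \<longleftrightarrow>
        (\<exists>B\<in>V. is_connective_keys \<Phi> a B \<and> (\<exists>\<Gamma>\<in>V. y = tag 3 \<Gamma> \<and> famset cTrue B T \<Gamma>))" for y
      unfolding code_step_def 5(1) fConj_def using 5(2) by auto
    show ?thesis
      unfolding St st fx c unfolding x 5(1) code_sub_simps
      by (intro code_step_family is_set_connective_keys T cTrue_in is_connective_keys_iff 5(2) aV) 
        (use part[unfolded 5(1) code_sub_simps] in simp_all)
  next
    case (6 \<Phi>)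
    have c: "code_of X s \<phi> = tag 2 (vset (pad cFalse (code_fun ` connective_keys \<Phi> a)))"
      unfolding 6(1) code_of_simps cOr_def code_fun_connective_keys[OF a] ..
    have st: "code_step \<phi> a y T \<longleftrightarrow>
        (\<exists>B\<in>V. is_connective_keys \<Phi> a B \<and> (\<exists>\<Gamma>\<in>V. y = tag 2 \<Gamma> \<and> famset cFalse B T \<Gamma>))" for y
      unfolding code_step_def 6(1) fDisj_def using 6(2) by auto
    show ?thesis
      unfolding St st fx c unfolding x 6(1) code_sub_simps
      by (intro code_step_family is_set_connective_keys T cFalse_in is_connective_keys_iff 6(2) aV) 
        (use part[unfolded 6(1) code_sub_simps] in simp_all)
  qed
qed

end

section \<open>Correctness of the translation\<close>

lemma interp_subset: "interp X S \<gamma> \<subseteq> S"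
  by (subst interp.simps) auto

lemma interp_cTrue: "interp X S cTrue = S"
  by (simp add: cTrue_def interp_simps fsat_simps)

lemma interp_cFalse: "interp X S cFalse = {}"
  by (simp add: cFalse_def interp_simps interp_cTrue)

lemma interp_cAnd_pad:
  assumes "elts \<Gamma> = pad cTrue (h ` A)" "\<And>x. x \<in> A \<Longrightarrow> interp X S (h x) = {M\<in>S. P x M}"
  shows "interp X S (cAnd \<Gamma>) = {M\<in>S. \<forall>x\<in>A. P x M}"
proof -
  have "S \<inter> (\<Inter>x\<in>A. interp X S (h x)) = {M\<in>S. \<forall>x\<in>A. P x M}"
    using assms(2) by auto
  then show ?thesis
    by (cases "A = {}") (simp_all add: interp_simps assms(1) pad_def interp_cTrue)
qed

lemma interp_cOr_pad:
  assumes "elts \<Gamma> = pad cFalse (h ` A)" "\<And>x. x \<in> A \<Longrightarrow> interp X S (h x) = {M\<in>S. P x M}"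
  shows "interp X S (cOr \<Gamma>) = {M\<in>S. \<exists>x\<in>A. P x M}"
proof -
  have "(\<Union>x\<in>A. interp X S (h x)) = {M\<in>S. \<exists>x\<in>A. P x M}"
    using assms(2) by auto
  then show ?thesis
    by (cases "A = {}") (simp_all add: interp_simps assms(1) pad_def interp_cFalse)
qed

context random_setting begin

lemma code_dom_in: "code_dom \<subseteq> V"
  unfolding code_dom_def using formulas_in asgD(1) by auto

lemma code_domI: "\<phi> \<in> formulas \<Longrightarrow> asg s a \<Longrightarrow> pair \<phi> a \<in> code_dom"
  unfolding code_dom_def by blast

text \<open>Quantifiers replace the assignment by an unrelated set, so descent is measured on the
  formula alone.\<close>

definition code_rel :: "('u \<times> 'u) set" where
  "code_rel = inv_image below (\<lambda>x. THE \<phi>. \<exists>a. x = pair \<phi> a)"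

lemma code_rel_pair: "(pair \<phi> a, pair \<psi> b) \<in> code_rel \<longleftrightarrow> (\<phi>, \<psi>) \<in> below"
  unfolding code_rel_def by auto

lemma code_sub_cases:
  assumes "x \<in> code_dom"
  shows "is_set (code_sub x) \<and> (\<forall>z\<in>code_sub x. z \<in> code_dom \<and> (z, x) \<in> code_rel)"
proof -
  obtain \<phi> a s where x: "x = pair \<phi> a" and \<phi>: "\<phi> \<in> formulas" and a: "asg s a"
    using assms(1) unfolding code_dom_def by blast
  have aV: "a \<in> V" by (rule asgD(1)[OF a])
  have q: "z \<in> code_dom \<and> (z, pair (tag k (pair v \<psi>)) a) \<in> code_rel"
    if "z \<in> quantifier_keys n \<psi> a" "\<psi> \<in> formulas" for z n \<psi> v k
    using that code_domI[OF that(2) asg_upd[OF a]]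
    by (auto simp: quantifier_keys_def code_rel_pair intro: below_tag_pair)
  have c: "z \<in> code_dom \<and> (z, pair (tag k \<Phi>) a) \<in> code_rel"
    if "z \<in> connective_keys \<Phi> a" "\<And>\<psi>. \<psi> \<in> elts \<Phi> \<Longrightarrow> \<psi> \<in> formulas" for z \<Phi> k
    using that code_domI[OF that(2) a]
    by (auto simp: connective_keys_def code_rel_pair intro: below_tag_elts)
  show ?thesis using \<phi>
  proof cases
    case 1
    then show ?thesis
      by cases (simp_all add: x code_sub_simps is_set_empty)
  next
    case (2 \<psi>)
    have "is_set {pair \<psi> a}" using is_set_upair[of "pair \<psi> a" "pair \<psi> a"] aV formulas_in[OF 2(2)] by simp
    then show ?thesis unfolding x 2 code_sub_simps
      using code_domI[OF 2(2) a] by (simp add: code_rel_pair fNeg_def below_tag)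
  next
    case (3 \<psi> n)
    show ?thesis unfolding x 3 code_sub_simps
      using is_set_quantifier_keys[OF formulas_in[OF 3(2)] aV] q[OF _ 3(2)] unfolding fEx_def by blast
  next
    case (4 \<psi> n)
    show ?thesis unfolding x 4 code_sub_simps
      using is_set_quantifier_keys[OF formulas_in[OF 4(2)] aV] q[OF _ 4(2)] unfolding fAll_def by blast
  next
    case (5 \<Phi>)
    show ?thesis unfolding x 5(1) code_sub_simps
      using is_set_connective_keys[OF 5(2) aV] c[OF _ 5(4)] unfolding fConj_def by blast
  next
    case (6 \<Phi>)
    show ?thesis unfolding x 6(1) code_sub_simps
      using is_set_connective_keys[OF 6(2) aV] c[OF _ 6(4)] unfolding fDisj_def by blast
  qed
qed

lemma fun_in_code_fun:
  assumes "A \<in> V" "elts A \<subseteq> code_dom"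
  shows "fun_in V A code_fun"
proof (rule fun_in_recursion[where D = code_dom and sub = code_sub and r = code_rel and St = code_St])
  show "code_dom \<subseteq> V" by (rule code_dom_in)
  show "definable (\<lambda>e. code_St (e i) (e j) (e k))" for i j k by (rule definable_code_St)
  show "A \<in> V" "elts A \<subseteq> code_dom" by (rule assms)+
  show "wf code_rel" unfolding code_rel_def by (intro wf_inv_image wf_below)
  show "z \<in> code_dom \<and> (z, x) \<in> code_rel" if "x \<in> code_dom" "z \<in> code_sub x" for x z
    using code_sub_cases[OF that(1)] that(2) by blast
  show "is_set (code_sub x)" if "x \<in> code_dom" for x
    using code_sub_cases[OF that] by blast
next
  fix x T
  assume x: "x \<in> code_dom" and T: "T \<in> V"
    and tot: "\<And>z w. z \<in> code_sub x \<Longrightarrow> pair z w \<in> elts T \<longleftrightarrow> w = code_fun z"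
  show "code_fun x \<in> V \<and> code_St x (code_fun x) T"
    using code_St_char[OF x T iffD1[OF tot]] tot by simp
next
  fix x y T
  assume x: "x \<in> code_dom" and T: "T \<in> V" and y: "y \<in> V" "code_St x y T"
    and part: "\<And>z w. z \<in> code_sub x \<Longrightarrow> pair z w \<in> elts T \<Longrightarrow> w = code_fun z"
  show "y = code_fun x \<and> (\<forall>z\<in>code_sub x. pair z (code_fun z) \<in> elts T)"
    using code_St_char[OF x T part] y by blast
qed

lemma cTrue_code: "cTrue \<in> codes"
  unfolding cTrue_def by (rule borel_codes.intros) (simp_all add: vset_finite_in free_vars_simps)

lemma cFalse_code: "cFalse \<in> codes"
  unfolding cFalse_def by (intro borel_codes.intros cTrue_code)

lemma indexed_family_codes:
  assumes "A \<in> V" "card_le V A \<kappa>" "d \<in> V" "d \<in> codes" "fun_in V A h"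
    and "\<And>x. x \<in> elts A \<Longrightarrow> h x \<in> codes"
  shows "indexed_family V \<kappa> (vset (pad d (h ` elts A)))"
    and "elts (vset (pad d (h ` elts A))) = pad d (h ` elts A)"
    and "\<gamma> \<in> elts (vset (pad d (h ` elts A))) \<Longrightarrow> \<gamma> \<in> codes"
proof -
  show "indexed_family V \<kappa> (vset (pad d (h ` elts A)))"
    by (intro indexed_family_pad assms \<kappa>_in \<kappa>_nonempty)
  show *: "elts (vset (pad d (h ` elts A))) = pad d (h ` elts A)"
    by (intro is_set_vset pad_in assms)
  show "\<gamma> \<in> codes" if "\<gamma> \<in> elts (vset (pad d (h ` elts A)))"
  proof -
    have "\<gamma> \<in> pad d (h ` elts A)" using that * by simp
    then show ?thesis using assms(4,6) by (auto simp: pad_def split: if_splits)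
  qed
qed

text \<open>The gain from the recursion in \<open>V\<close>: the codes of all instances of a
  quantified formula form a family belonging to \<open>V\<close>, as \<open>indexed_family\<close>
  demands.\<close>

lemma fun_in_code_quantifier:
  assumes \<phi>: "\<phi> \<in> formulas" and a: "asg s a"
  shows "fun_in V X (\<lambda>x. code_of X (s(n := x)) \<phi>)"
proof -
  note B = is_set_vset[OF is_set_quantifier_keys[OF formulas_in[OF \<phi>] asgD(1)[OF a]]]
  have dom: "elts (vset (quantifier_keys n \<phi> a)) \<subseteq> code_dom"
    unfolding B(2) unfolding quantifier_keys_def using code_domI[OF \<phi> asg_upd[OF a]] by blast
  have "fun_in V X (\<lambda>x. code_fun (pair \<phi> (upd a (vnat n) x)))"
    by (rule fun_in_comp[OF X_in B(1) fun_in_quantifier_keys[OF formulas_in[OF \<phi>] asgD(1)[OF a]]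
          fun_in_code_fun[OF B(1) dom]])
      (simp only: B(2), simp add: quantifier_keys_def)
  then show ?thesis
    by (rule iffD1[OF fun_in_cong, rotated]) (simp add: code_fun_pair asg_val[OF asg_upd[OF a]])
qed

lemma fun_in_code_connective:
  assumes \<Phi>: "\<Phi> \<in> V" and sub: "\<And>\<phi>. \<phi> \<in> elts \<Phi> \<Longrightarrow> \<phi> \<in> formulas" and a: "asg s a"
  shows "fun_in V \<Phi> (code_of X s)"
proof -
  note B = is_set_vset[OF is_set_connective_keys[OF \<Phi> asgD(1)[OF a]]]
  have dom: "elts (vset (connective_keys \<Phi> a)) \<subseteq> code_dom"
    unfolding B(2) unfolding connective_keys_def using code_domI[OF sub a] by blast
  have "fun_in V \<Phi> (\<lambda>\<phi>. code_fun (pair \<phi> a))"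
    by (rule fun_in_comp[OF \<Phi> B(1) fun_in_connective_keys[OF \<Phi> asgD(1)[OF a]] fun_in_code_fun[OF B(1) dom]])
      (simp only: B(2), simp add: connective_keys_def)
  then show ?thesis by (simp add: code_fun_pair asg_val[OF a])
qed

text \<open>Every clause of \<open>interp\<close> treats one structure at a time, hence
  \<open>S\<close> can be arbitrary and the same code can be evaluated over different collections of
  structures.\<close>

lemma code_of_correct:
  assumes "\<phi> \<in> formulas" "asg s a"
  shows "code_of X s \<phi> \<in> codes \<and> (\<forall>S. interp X S (code_of X s \<phi>) = {M\<in>S. fsat X M s \<phi>})"
  using assms
proof (induction arbitrary: s a)
  case (1 \<phi>)
  note a = \<open>asg s a\<close>
  have basic: "cBasic (fConj (vset {\<psi>})) as \<in> codes"
    if "\<psi> \<in> atomic L" "set as \<subseteq> elts X" "free_vars \<psi> \<subseteq> {..<length as}" for \<psi> as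
    using that atomic_in[OF that(1)]
    by (intro borel_codes.intros) (auto simp: vset_finite_in free_vars_simps intro: literals.intros)
  from 1(1) show ?case
  proof cases
    case (1 R vs)
    have "fRel R [0..<length vs] \<in> atomic L" using 1(2) by (intro atomic.intros) simp
    then have "code_of X s \<phi> \<in> codes" unfolding 1(1) code_of_simps
      by (intro basic) (auto simp: free_vars_simps asgD(2)[OF a])
    moreover have "interp X S (code_of X s \<phi>) = {M\<in>S. fsat X M s \<phi>}" for S
    proof -
      \<comment> \<open>Variable \<open>i\<close> of the renamed atom reads entry \<open>i\<close>
        of the tuple, so the relation is tested at the original arguments.\<close>
      have "map (\<lambda>i. map s vs ! i) [0..<length vs] = map s vs"
        using map_nth[of "map s vs"] by simp
      then show ?thesis unfolding 1(1) code_of_simps interp_simps fsat_simps by (simp add: fsat_simps)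
    qed
    ultimately show ?thesis by blast
  next
    case (2 i j)
    have "fEq 0 1 \<in> atomic L" by (rule atomic.intros)
    then have "code_of X s \<phi> \<in> codes" unfolding 2 code_of_simps
      by (intro basic) (auto simp: free_vars_simps asgD(2)[OF a])
    moreover have "interp X S (code_of X s \<phi>) = {M\<in>S. fsat X M s \<phi>}" for S
      unfolding 2 code_of_simps interp_simps fsat_simps by (simp add: fsat_simps)
    ultimately show ?thesis by blast
  qed
next
  case (2 \<phi>)
  show ?case unfolding code_of_simps using "2.IH"[OF "2.prems"]
    by (auto simp: interp_simps fsat_simps intro: borel_codes.intros)
next
  case (3 \<phi> n)
  note a = \<open>asg s a\<close>
  note IH = "3.IH"[OF asg_upd[OF a]]
  note fam = indexed_family_codes[OF X_in X_card cFalse_in cFalse_code fun_in_code_quantifier[OF "3.hyps"(1) a]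
      conjunct1[OF IH]]
  have "code_of X s (fEx n \<phi>) \<in> codes"
    unfolding code_of_simps by (intro borel_codes.intros fam)
  moreover have "interp X S (code_of X s (fEx n \<phi>)) = {M\<in>S. fsat X M s (fEx n \<phi>)}" for S
    unfolding code_of_simps fsat_simps
    by (rule interp_cOr_pad[OF fam(2)]) (assumption | rule spec[OF conjunct2[OF IH]])+
  ultimately show ?case by blast
next
  case (4 \<phi> n)
  note a = \<open>asg s a\<close>
  note IH = "4.IH"[OF asg_upd[OF a]]
  note fam = indexed_family_codes[OF X_in X_card cTrue_in cTrue_code fun_in_code_quantifier[OF "4.hyps"(1) a]
      conjunct1[OF IH]]
  have "code_of X s (fAll n \<phi>) \<in> codes"
    unfolding code_of_simps by (intro borel_codes.intros fam)
  moreover have "interp X S (code_of X s (fAll n \<phi>)) = {M\<in>S. fsat X M s (fAll n \<phi>)}" for S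
    unfolding code_of_simps fsat_simps
    by (rule interp_cAnd_pad[OF fam(2)]) (assumption | rule spec[OF conjunct2[OF IH]])+
  ultimately show ?case by blast
next
  case (5 \<Phi>)
  note a = \<open>asg s a\<close>
  note IH = "5.IH"[OF _ a]
  note fam = indexed_family_codes[OF "5.hyps"(1,2) cTrue_in cTrue_code fun_in_code_connective[OF "5.hyps"(1,3) a]
      conjunct1[OF IH]]
  have "code_of X s (fConj \<Phi>) \<in> codes"
    unfolding code_of_simps by (intro borel_codes.intros fam)
  moreover have "interp X S (code_of X s (fConj \<Phi>)) = {M\<in>S. fsat X M s (fConj \<Phi>)}" for S
    unfolding code_of_simps fsat_simps
    by (rule interp_cAnd_pad[OF fam(2)]) (assumption | rule spec[OF conjunct2[OF IH]])+
  ultimately show ?case by blast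
next
  case (6 \<Phi>)
  note a = \<open>asg s a\<close>
  note IH = "6.IH"[OF _ a]
  note fam = indexed_family_codes[OF "6.hyps"(1,2) cFalse_in cFalse_code fun_in_code_connective[OF "6.hyps"(1,3) a]
      conjunct1[OF IH]]
  have "code_of X s (fDisj \<Phi>) \<in> codes"
    unfolding code_of_simps by (intro borel_codes.intros fam)
  moreover have "interp X S (code_of X s (fDisj \<Phi>)) = {M\<in>S. fsat X M s (fDisj \<Phi>)}" for S
    unfolding code_of_simps fsat_simps
    by (rule interp_cOr_pad[OF fam(2)]) (assumption | rule spec[OF conjunct2[OF IH]])+
  ultimately show ?case by blast
qed

section \<open>Interpretations of codes are sets of the model\<close>

abbreviation "Strs \<equiv> Str V L X"

definition is_tuple_over_X :: "'u \<Rightarrow> 'u \<Rightarrow> bool" where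
  "is_tuple_over_X n t \<longleftrightarrow> (\<forall>q\<in>elts t. \<exists>i\<in>elts n. \<exists>x\<in>elts X. q = pair i x) \<and>
     (\<forall>i\<in>elts n. \<exists>x\<in>elts X. pair i x \<in> elts t \<and> (\<forall>y\<in>V. pair i y \<in> elts t \<longrightarrow> y = x))"

lemma is_tuple_over_X_iff:
  assumes "t \<in> V"
  shows "is_tuple_over_X (vnat n) t \<longleftrightarrow> (\<exists>as. length as = n \<and> set as \<subseteq> elts X \<and> t = tuple as)"
proof
  assume t: "is_tuple_over_X (vnat n) t"
  have "\<exists>x\<in>elts X. pair (vnat i) x \<in> elts t \<and> (\<forall>y\<in>V. pair (vnat i) y \<in> elts t \<longrightarrow> y = x)" if "i < n" for i
    using t that unfolding is_tuple_over_X_def elts_vnat by auto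
  then obtain f where f: "\<And>i. i < n \<Longrightarrow> f i \<in> elts X" "\<And>i. i < n \<Longrightarrow> pair (vnat i) (f i) \<in> elts t"
    "\<And>i y. i < n \<Longrightarrow> y \<in> V \<Longrightarrow> pair (vnat i) y \<in> elts t \<Longrightarrow> y = f i"
    by metis
  have "elts t = elts (tuple (map f [0..<n]))"
  proof (rule set_eqI)
    fix q
    show "q \<in> elts t \<longleftrightarrow> q \<in> elts (tuple (map f [0..<n]))"
    proof
      assume q: "q \<in> elts t"
      then obtain i x where i: "i < n" "x \<in> elts X" "q = pair (vnat i) x"
        using t unfolding is_tuple_over_X_def elts_vnat by blast
      then have "x = f i" using f(3)[OF i(1) X_sub] q by simp
      then show "q \<in> elts (tuple (map f [0..<n]))" using i by (simp add: pair_in_tuple)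
    next
      assume "q \<in> elts (tuple (map f [0..<n]))"
      then show "q \<in> elts t" unfolding elts_tuple using f(2) by auto
    qed
  qed
  then have "t = tuple (map f [0..<n])" by (rule elts_inject)
  then show "\<exists>as. length as = n \<and> set as \<subseteq> elts X \<and> t = tuple as"
    using f(1) by (intro exI[of _ "map f [0..<n]"]) auto
next
  assume "\<exists>as. length as = n \<and> set as \<subseteq> elts X \<and> t = tuple as"
  then obtain as where as: "length as = n" "set as \<subseteq> elts X" "t = tuple as" by blast
  have "as ! i \<in> elts X" if "i < n" for i using as that nth_mem by blast
  then show "is_tuple_over_X (vnat n) t"
    unfolding is_tuple_over_X_def elts_vnat as(3) using as(1)
    by (auto simp: pair_in_tuple) (auto simp: elts_tuple)
qed

text \<open>The possible relational facts are separated from a product \<open>K\<close> that is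
  clearly in \<open>V\<close>; a structure is then any subset of them in \<open>V\<close>.\<close>

lemma is_set_Str: "is_set Strs"
proof -
  \<comment> \<open>A pair with first component \<open>R\<close> contains the singleton of
    \<open>R\<close>, so two unions over \<open>L\<close> reach all relation symbols.
    \<open>N\<close> contains the entries of all finite tuples.\<close>
  define U where "U = (\<Union>y\<in>(\<Union>y\<in>elts L. elts y). elts y)"
  define N where "N = {pair n x |n x. n \<in> range vnat \<and> x \<in> elts X}"
  define K where "K = {pair R t |R t. R \<in> U \<and> t \<in> {t\<in>V. elts t \<subseteq> N}}"
  have K: "is_set K"
    unfolding K_def U_def N_def
    by (intro is_set_prod is_set_Union is_set_Pow is_set_omega is_set_elts L_in X_in)
  define P where "P p \<longleftrightarrow> (\<exists>R\<in>V. \<exists>n\<in>V. \<exists>t\<in>V. p = pair R t \<and> pair R n \<in> elts L \<and> is_tuple_over_X n t)" for p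
  have "is_set {p\<in>K. P p}"
    unfolding P_def is_tuple_over_X_def by (intro separation K definable_intros X_in L_in)
  also have "{p\<in>K. P p} = {pair R (tuple as) |R as.
      pair R (vnat (length as)) \<in> elts L \<and> set as \<subseteq> elts X}"
  proof (intro set_eqI iffI)
    fix p assume "p \<in> {p\<in>K. P p}"
    then obtain R n t where p: "t \<in> V" "p = pair R t" "pair R n \<in> elts L" "is_tuple_over_X n t"
      unfolding P_def by blast
    \<comment> \<open>The predicate \<open>P\<close> does not say that the arity is a numeral; the
      language guarantees it, and the tuple is therefore a finite list.\<close>
    obtain k where n: "n = vnat k" using language p(3) unfolding relational_language_def by auto
    obtain as where "length as = k" "set as \<subseteq> elts X" "t = tuple as"
      using p(4) is_tuple_over_X_iff[OF p(1)] unfolding n by blast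
    then show "p \<in> {pair R (tuple as) |R as. pair R (vnat (length as)) \<in> elts L \<and> set as \<subseteq> elts X}"
      using p n by blast
  next
    fix p assume "p \<in> {pair R (tuple as) |R as. pair R (vnat (length as)) \<in> elts L \<and> set as \<subseteq> elts X}"
    then obtain R as where p: "p = pair R (tuple as)" "pair R (vnat (length as)) \<in> elts L" "set as \<subseteq> elts X"
      by blast
    have as: "tuple as \<in> V" using p(3) X_sub by auto
    have "elts (pair R (vnat (length as))) = {vset {R}, vset {R, vnat (length as)}}"
      unfolding pair_def by simp
    then have "vset {R} \<in> (\<Union>y\<in>elts L. elts y)" using p(2) by blast
    moreover have "R \<in> elts (vset {R})" by simp
    ultimately have "R \<in> U" unfolding U_def by blast
    moreover have "elts (tuple as) \<subseteq> N"
      unfolding elts_tuple N_def using p(3) nth_mem by blast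
    ultimately have "p \<in> K" unfolding K_def p(1) using as by blast
    moreover have "is_tuple_over_X (vnat (length as)) (tuple as)" using is_tuple_over_X_iff[OF as] p(3) by blast
    then have "P p" unfolding P_def using p as symbol_in[OF p(2)] vnat_in by blast
    ultimately show "p \<in> {p\<in>K. P p}" by blast
  qed
  finally show ?thesis unfolding Str_def by (rule is_set_Pow)
qed

lemma Strs_in: "M \<in> Strs \<Longrightarrow> M \<in> V"
  unfolding Str_def by simp

section \<open>Truth of a code in a structure as a recursion\<close>

definition basic_literals :: "'u set" where
  "basic_literals = {cBasic \<phi> as |\<phi> as. \<phi> \<in> literals L \<and> set as \<subseteq> elts X \<and> free_vars \<phi> \<subseteq> {..<length as}}"

lemma literals_in: "\<phi> \<in> literals L \<Longrightarrow> \<phi> \<in> V"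
  by (induction rule: literals.induct) (simp_all add: atomic_in fNeg_def)

lemma basic_in: "\<phi> \<in> V \<Longrightarrow> set as \<subseteq> elts X \<Longrightarrow> cBasic \<phi> as \<in> V"
  using X_sub by (auto simp: cBasic_def)

lemma codes_in: "\<gamma> \<in> codes \<Longrightarrow> \<gamma> \<in> V"
proof (induction rule: borel_codes.induct)
  case (1 \<Phi> as)
  then show ?case by (intro basic_in) (simp_all add: fConj_def)
qed (simp_all add: code_defs indexed_family_def)

lemma basic_literals_in: "\<gamma> \<in> basic_literals \<Longrightarrow> \<gamma> \<in> V"
  unfolding basic_literals_def using basic_in literals_in by blast

definition is_child :: "'u \<Rightarrow> 'u \<Rightarrow> bool" where
  "is_child \<gamma> z \<longleftrightarrow> \<gamma> = tag 1 z \<or>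
     (\<exists>\<Gamma>\<in>V. (\<gamma> = tag 2 \<Gamma> \<or> \<gamma> = tag 3 \<Gamma>) \<and> z \<in> elts \<Gamma>) \<or>
     (\<exists>t\<in>V. \<exists>\<Phi>\<in>V. \<gamma> = tag 0 (pair (tag 5 \<Phi>) t) \<and> (\<exists>l\<in>elts \<Phi>. z = tag 0 (pair l t))) \<or>
     (\<exists>t\<in>V. \<exists>l\<in>V. \<gamma> = tag 0 (pair (tag 2 l) t) \<and> z = tag 0 (pair l t))"

lemma definable_is_child: "definable (\<lambda>e. is_child (e i) (e j))"
  unfolding is_child_def by (intro definable_intros)

text \<open>\<open>T\<close> records truth values as the numerals 0 and 1. Negated literals are
  evaluated like \<open>cNeg\<close> and conjunctions inside basic codes like \<open>cAnd\<close>,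
  which leaves only atomic formulas as base cases.\<close>

definition truth :: "'u \<Rightarrow> 'u \<Rightarrow> 'u \<Rightarrow> bool" where
  "truth \<gamma> M T \<longleftrightarrow>
     (\<exists>R\<in>V. \<exists>v\<in>V. \<exists>t\<in>V. \<exists>w\<in>V. \<gamma> = tag 0 (pair (tag 0 (pair R v)) t) \<and> iscomp v t w \<and> pair R w \<in> elts M) \<or>
     (\<exists>i\<in>V. \<exists>j\<in>V. \<exists>t\<in>V. \<gamma> = tag 0 (pair (tag 1 (pair i j)) t) \<and>
        (\<exists>u\<in>V. pair i u \<in> elts t \<and> pair j u \<in> elts t)) \<or>
     ((\<exists>\<zeta>\<in>V. \<gamma> = tag 1 \<zeta>) \<or> (\<exists>l\<in>V. \<exists>t\<in>V. \<gamma> = tag 0 (pair (tag 2 l) t))) \<and>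
        (\<forall>z\<in>V. is_child \<gamma> z \<longrightarrow> pair (pair z M) (vnat 0) \<in> elts T) \<or>
     (\<exists>\<Gamma>\<in>V. \<gamma> = tag 2 \<Gamma>) \<and> (\<exists>z\<in>V. is_child \<gamma> z \<and> pair (pair z M) (vnat 1) \<in> elts T) \<or>
     ((\<exists>\<Gamma>\<in>V. \<gamma> = tag 3 \<Gamma>) \<or> (\<exists>\<Phi>\<in>V. \<exists>t\<in>V. \<gamma> = tag 0 (pair (tag 5 \<Phi>) t))) \<and>
        (\<forall>z\<in>V. is_child \<gamma> z \<longrightarrow> pair (pair z M) (vnat 1) \<in> elts T)"

text \<open>A value at every child is demanded because a missing one could make \<open>truth\<close>
  fail and wrongly suggest the value 0.\<close>

definition truth_St :: "'u \<Rightarrow> 'u \<Rightarrow> 'u \<Rightarrow> bool" where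
  "truth_St x y T \<longleftrightarrow> (\<exists>\<gamma>\<in>V. \<exists>M\<in>V. x = pair \<gamma> M \<and>
     (\<forall>z\<in>V. is_child \<gamma> z \<longrightarrow> (\<exists>c\<in>V. pair (pair z M) c \<in> elts T)) \<and>
     (y = vnat 1 \<and> truth \<gamma> M T \<or> y = vnat 0 \<and> \<not> truth \<gamma> M T))"

lemma definable_truth_St: "definable (\<lambda>e. truth_St (e i) (e j) (e k))"
  unfolding truth_St_def truth_def by (intro definable_intros definable_is_child definable_iscomp vnat_in)

definition children :: "'u \<Rightarrow> 'u set" where
  "children \<gamma> = {z\<in>V. is_child \<gamma> z}"

lemma children_simps:
  "\<zeta> \<in> V \<Longrightarrow> children (cNeg \<zeta>) = {\<zeta>}"
  "\<Gamma> \<in> V \<Longrightarrow> children (cOr \<Gamma>) = elts \<Gamma>"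
  "\<Gamma> \<in> V \<Longrightarrow> children (cAnd \<Gamma>) = elts \<Gamma>"
  "\<Phi> \<in> V \<Longrightarrow> set as \<subseteq> V \<Longrightarrow> children (cBasic (fConj \<Phi>) as) = (\<lambda>l. cBasic l as) ` elts \<Phi>"
  "l \<in> V \<Longrightarrow> set as \<subseteq> V \<Longrightarrow> children (cBasic (fNeg l) as) = {cBasic l as}"
  "children (cBasic (fRel R vs) as) = {}"
  "children (cBasic (fEq i j) as) = {}"
  using transV by (auto simp: children_def is_child_def code_defs formula_defs)

text \<open>The recursion computing the truth value of a code in a structure also has to descend through the
  literals inside basic codes, which are therefore treated as codes themselves.\<close>

definition codes' :: "'u set" where
  "codes' = codes \<union> basic_literals"

lemma codes'_in: "\<gamma> \<in> codes' \<Longrightarrow> \<gamma> \<in> V"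
  unfolding codes'_def using codes_in basic_literals_in by blast

lemma codes'_cases [consumes 1, case_names Rel Eq NegLit ConjLit Neg Or And]:
  assumes "\<gamma> \<in> codes'"
  obtains R vs as where "\<gamma> = cBasic (fRel R vs) as" "R \<in> V" "set as \<subseteq> elts X" "set vs \<subseteq> {..<length as}"
  | i j as where "\<gamma> = cBasic (fEq i j) as" "set as \<subseteq> elts X" "i < length as" "j < length as"
  | l as where "\<gamma> = cBasic (fNeg l) as" "l \<in> V" "set as \<subseteq> elts X" "cBasic l as \<in> codes'"
  | \<Phi> as where "\<gamma> = cBasic (fConj \<Phi>) as" "\<Phi> \<in> V" "set as \<subseteq> elts X"
      "\<forall>l\<in>elts \<Phi>. cBasic l as \<in> codes'" "finite (elts \<Phi>)"
  | \<zeta> where "\<gamma> = cNeg \<zeta>" "\<zeta> \<in> codes'"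
  | \<Gamma> where "\<gamma> = cOr \<Gamma>" "\<Gamma> \<in> V" "elts \<Gamma> \<subseteq> codes'"
  | \<Gamma> where "\<gamma> = cAnd \<Gamma>" "\<Gamma> \<in> V" "elts \<Gamma> \<subseteq> codes'"
proof (cases "\<gamma> \<in> codes")
  case True
  then show thesis
  proof cases
    case (1 \<Phi> as)
    have "cBasic l as \<in> codes'" if "l \<in> elts \<Phi>" for l
    proof -
      have "l \<in> literals L" "free_vars l \<subseteq> {..<length as}"
        using 1(4,6) that by (auto simp: free_vars_simps)
      then show ?thesis using 1(5) unfolding codes'_def basic_literals_def by blast
    qed
    then show thesis using 1 that(4) by blast
  next
    case (2 \<zeta>)
    then show thesis using that(5) unfolding codes'_def by blast
  next
    case (3 \<Gamma>)
    then show thesis using that(6)[of \<Gamma>] unfolding codes'_def indexed_family_def by blast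
  next
    case (4 \<Gamma>)
    then show thesis using that(7)[of \<Gamma>] unfolding codes'_def indexed_family_def by blast
  qed
next
  case False
  then obtain \<phi> as where \<gamma>: "\<gamma> = cBasic \<phi> as" "\<phi> \<in> literals L" "set as \<subseteq> elts X"
    "free_vars \<phi> \<subseteq> {..<length as}"
    using assms unfolding codes'_def basic_literals_def by blast
  from \<gamma>(2) show thesis
  proof cases
    case 1
    then show thesis
    proof cases
      case (1 R vs)
      then show thesis using that(1)[of R vs as] \<gamma> symbol_in[OF 1(2)] by (simp add: free_vars_simps)
    next
      case (2 i j)
      then show thesis using that(2)[of i j as] \<gamma> by (simp add: free_vars_simps)
    qed
  next
    case (2 l)
    have "cBasic l as \<in> codes'"
      using \<gamma> 2 unfolding codes'_def basic_literals_def by (auto simp: free_vars_simps)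
    then show thesis using that(3)[of l as] \<gamma> 2 literals_in by blast
  qed
qed

text \<open>The child \<open>cBasic l as\<close> of \<open>cBasic (fConj \<Phi>) as\<close> need not
  lie below it in the membership order, since both are pairs with the same tuple. Comparing the
  formulas alone restores descent.\<close>

definition code_height :: "'u \<Rightarrow> 'u" where
  "code_height \<gamma> = (if \<exists>\<phi> as. \<gamma> = cBasic \<phi> as then THE \<phi>. \<exists>as. \<gamma> = cBasic \<phi> as else \<gamma>)"

lemma code_height_basic: "code_height (cBasic \<phi> as) = \<phi>"
  unfolding code_height_def by (auto simp: cBasic_def)

text \<open>The height of a basic code lies below that code, so passing from a compound code to a
  basic one still descends.\<close>

lemma code_height_below:
  assumes "(\<gamma>, tag k \<Gamma>) \<in> below"
  shows "(code_height \<gamma>, tag k \<Gamma>) \<in> below"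
proof (cases "\<exists>\<phi> as. \<gamma> = cBasic \<phi> as")
  case True
  then obtain \<phi> as where \<gamma>: "\<gamma> = cBasic \<phi> as" by blast
  have "(\<phi>, \<gamma>) \<in> below" unfolding \<gamma> cBasic_def tag_def by (meson below_pair below_trans)
  then show ?thesis
    using assms below_trans unfolding \<gamma> code_height_basic by blast
next
  case False
  then have "code_height \<gamma> = \<gamma>" unfolding code_height_def by simp
  then show ?thesis using assms by simp
qed

lemma children:
  assumes "\<gamma> \<in> codes'"
  shows "is_set (children \<gamma>)" and "z \<in> children \<gamma> \<Longrightarrow> z \<in> codes' \<and> (code_height z, code_height \<gamma>) \<in> below"
proof -
  have "is_set (children \<gamma>) \<and> (\<forall>z\<in>children \<gamma>. z \<in> codes' \<and> (code_height z, code_height \<gamma>) \<in> below)"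
    using assms
  proof (cases rule: codes'_cases)
    case (Rel R vs as)
    then show ?thesis by (simp add: children_simps is_set_empty)
  next
    case (Eq i j as)
    then show ?thesis by (simp add: children_simps is_set_empty)
  next
    case (NegLit l as)
    have as: "set as \<subseteq> V" using NegLit(3) X_sub by blast
    have "is_set {cBasic l as}" using codes'_in[OF NegLit(4)] by (intro is_set_finite) simp_all
    then show ?thesis
      unfolding NegLit(1) children_simps(5)[OF NegLit(2) as] code_height_basic
      using NegLit(4) by (simp add: code_height_basic fNeg_def below_tag)
  next
    case (ConjLit \<Phi> as)
    have as: "set as \<subseteq> V" using ConjLit(3) X_sub by blast
    have "is_set ((\<lambda>l. cBasic l as) ` elts \<Phi>)"
      using ConjLit(4,5) codes'_in by (intro is_set_finite) auto
    then show ?thesis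
      unfolding ConjLit(1) children_simps(4)[OF ConjLit(2) as] code_height_basic
      using ConjLit(4) by (simp add: code_height_basic fConj_def below_tag_elts)
  next
    case (Neg \<zeta>)
    have h: "code_height (cNeg \<zeta>) = cNeg \<zeta>" by (auto simp: code_height_def code_defs)
    have "is_set {\<zeta>}" using codes'_in[OF Neg(2)] by (intro is_set_finite) simp_all
    then show ?thesis
      unfolding Neg(1) children_simps(1)[OF codes'_in[OF Neg(2)]] h
      using Neg(2) by (simp add: cNeg_def code_height_below below_tag)
  next
    case (Or \<Gamma>)
    have h: "code_height (cOr \<Gamma>) = cOr \<Gamma>" by (auto simp: code_height_def code_defs)
    show ?thesis
      unfolding Or(1) children_simps(2)[OF Or(2)] h
      using Or is_set_elts[OF Or(2)] by (auto simp: cOr_def intro: code_height_below below_tag_elts)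
  next
    case (And \<Gamma>)
    have h: "code_height (cAnd \<Gamma>) = cAnd \<Gamma>" by (auto simp: code_height_def code_defs)
    show ?thesis
      unfolding And(1) children_simps(3)[OF And(2)] h
      using And is_set_elts[OF And(2)] by (auto simp: cAnd_def intro: code_height_below below_tag_elts)
  qed
  then show "is_set (children \<gamma>)" "z \<in> children \<gamma> \<Longrightarrow> z \<in> codes' \<and> (code_height z, code_height \<gamma>) \<in> below"
    by blast+
qed

abbreviation "intp \<gamma> \<equiv> interp X Strs \<gamma>"

definition truth_value :: "bool \<Rightarrow> 'u" where
  "truth_value b = vnat (if b then 1 else 0)"

lemma truth_iff:
  assumes \<gamma>: "\<gamma> \<in> codes'" and M: "M \<in> Strs"
    and T: "\<And>z k. z \<in> children \<gamma> \<Longrightarrow> pair (pair z M) (vnat k) \<in> elts T \<longleftrightarrow> vnat k = truth_value (M \<in> intp z)"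
  shows "truth \<gamma> M T \<longleftrightarrow> M \<in> intp \<gamma>"
proof -
  have T0: "pair (pair z M) (vnat 0) \<in> elts T \<longleftrightarrow> M \<notin> intp z" if "z \<in> children \<gamma>" for z
    using T[OF that, of 0] by (simp add: truth_value_def del: vnat.simps)
  have T1: "pair (pair z M) (vnat 1) \<in> elts T \<longleftrightarrow> M \<in> intp z" if "z \<in> children \<gamma>" for z
    using T[OF that, of 1] by (simp add: truth_value_def del: vnat.simps)
  have all0: "(\<forall>z\<in>V. is_child \<gamma> z \<longrightarrow> pair (pair z M) (vnat 0) \<in> elts T) \<longleftrightarrow> (\<forall>z\<in>children \<gamma>. M \<notin> intp z)"
    using T0 unfolding children_def by auto
  have all1: "(\<forall>z\<in>V. is_child \<gamma> z \<longrightarrow> pair (pair z M) (vnat 1) \<in> elts T) \<longleftrightarrow> (\<forall>z\<in>children \<gamma>. M \<in> intp z)"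
    using T1 unfolding children_def by auto
  have ex1: "(\<exists>z\<in>V. is_child \<gamma> z \<and> pair (pair z M) (vnat 1) \<in> elts T) \<longleftrightarrow> (\<exists>z\<in>children \<gamma>. M \<in> intp z)"
    using T1 unfolding children_def by auto
  note truth = truth_def[of \<gamma> M T, unfolded all0 all1 ex1]
  from \<gamma> show ?thesis
  proof (cases rule: codes'_cases)
    case (Rel R vs as)
    have asV: "as ! i \<in> V" if "i < length as" for i
      using that Rel(3) X_sub nth_mem by blast
    have V: "R \<in> V" "tuple (map vnat vs) \<in> V" "tuple as \<in> V" "tuple (map (\<lambda>i. as ! i) vs) \<in> V"
      using Rel X_sub asV by (auto simp: image_subset_iff)
    have comp: "iscomp (tuple (map vnat vs)) (tuple as) w \<longleftrightarrow> w = tuple (map (\<lambda>i. as ! i) vs)"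
      if "w \<in> V" for w
      using that Rel(4) asV by (intro iscomp_iff) (auto simp: pair_in_tuple)
    have "truth \<gamma> M T \<longleftrightarrow> (\<exists>w\<in>V. iscomp (tuple (map vnat vs)) (tuple as) w \<and> pair R w \<in> elts M)"
      unfolding truth unfolding Rel(1) cBasic_def fRel_def using V by auto
    also have "\<dots> \<longleftrightarrow> pair R (tuple (map (\<lambda>i. as ! i) vs)) \<in> elts M"
      using comp V(4) by auto
    finally show ?thesis unfolding Rel(1) interp_simps fsat_simps using M by simp
  next
    case (Eq i j as)
    have asV: "set as \<subseteq> V" using Eq(2) X_sub by blast
    have "truth \<gamma> M T \<longleftrightarrow> (\<exists>u\<in>V. pair (vnat i) u \<in> elts (tuple as) \<and> pair (vnat j) u \<in> elts (tuple as))"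
      unfolding truth unfolding Eq(1) cBasic_def fEq_def using asV by auto
    also have "\<dots> \<longleftrightarrow> as ! i = as ! j"
      unfolding pair_in_tuple using Eq(3,4) asV nth_mem by auto
    finally show ?thesis unfolding Eq(1) interp_simps fsat_simps using M by simp
  next
    case (NegLit l as)
    have as: "set as \<subseteq> V" using NegLit(3) X_sub by blast
    have k: "children \<gamma> = {cBasic l as}" unfolding NegLit(1) by (rule children_simps(5)[OF NegLit(2) as])
    have "truth \<gamma> M T \<longleftrightarrow> (\<forall>z\<in>children \<gamma>. M \<notin> intp z)"
      unfolding truth unfolding NegLit(1) cBasic_def fNeg_def using NegLit(2) as by auto
    then show ?thesis unfolding k unfolding NegLit(1) interp_simps fsat_simps using M by (simp add: interp_simps)
  next
    case (ConjLit \<Phi> as)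
    have as: "set as \<subseteq> V" using ConjLit(3) X_sub by blast
    have k: "children \<gamma> = (\<lambda>l. cBasic l as) ` elts \<Phi>" unfolding ConjLit(1) by (rule children_simps(4)[OF ConjLit(2) as])
    have "truth \<gamma> M T \<longleftrightarrow> (\<forall>z\<in>children \<gamma>. M \<in> intp z)"
      unfolding truth unfolding ConjLit(1) cBasic_def fConj_def using ConjLit(2) as by auto
    then show ?thesis unfolding k unfolding ConjLit(1) interp_simps fsat_simps using M by (simp add: interp_simps)
  next
    case (Neg \<zeta>)
    have k: "children \<gamma> = {\<zeta>}" unfolding Neg(1) by (rule children_simps(1)[OF codes'_in[OF Neg(2)]])
    have "truth \<gamma> M T \<longleftrightarrow> (\<forall>z\<in>children \<gamma>. M \<notin> intp z)"
      unfolding truth unfolding Neg(1) cNeg_def using codes'_in[OF Neg(2)] by auto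
    then show ?thesis unfolding k unfolding Neg(1) interp_simps using M by simp
  next
    case (Or \<Gamma>)
    have k: "children \<gamma> = elts \<Gamma>" unfolding Or(1) by (rule children_simps(2)[OF Or(2)])
    have "truth \<gamma> M T \<longleftrightarrow> (\<exists>z\<in>children \<gamma>. M \<in> intp z)"
      unfolding truth unfolding Or(1) cOr_def using Or(2) by auto
    then show ?thesis unfolding k unfolding Or(1) interp_simps by simp
  next
    case (And \<Gamma>)
    have k: "children \<gamma> = elts \<Gamma>" unfolding And(1) by (rule children_simps(3)[OF And(2)])
    have "truth \<gamma> M T \<longleftrightarrow> (\<forall>z\<in>children \<gamma>. M \<in> intp z)"
      unfolding truth unfolding And(1) cAnd_def using And(2) by auto
    then show ?thesis unfolding k unfolding And(1) interp_simps using M by simp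
  qed
qed

end

text \<open>Double induction along membership: for incomparable \<open>x\<close> and
  \<open>y\<close>, comparability one step below each forces them to have the same elements.\<close>

lemma ordinal_trichotomy:
  fixes a :: "'u::set_universe"
  assumes a: "is_ordinal a" and "x \<in> elts a" "y \<in> elts a"
  shows "x \<in> elts y \<or> x = y \<or> y \<in> elts x"
proof -
  have wf: "wf {(x :: 'u, y). mem x y}" using wfp_mem unfolding wfp_def .
  have tr: "z \<in> elts a" if "x \<in> elts a" "z \<in> elts x" for x z
    using a that unfolding is_ordinal_def by blast
  have tr2: "z \<in> elts x" if "x \<in> elts a" "y \<in> elts x" "z \<in> elts y" for x y z
    using a that unfolding is_ordinal_def by blast
  have "\<forall>y\<in>elts a. x \<in> elts y \<or> x = y \<or> y \<in> elts x" if "x \<in> elts a" for x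
    using that
  proof (induction x rule: wf_induct_rule[OF wf])
    case (1 x)
    have "x \<in> elts y \<or> x = y \<or> y \<in> elts x" if "y \<in> elts a" for y
      using that
    proof (induction y rule: wf_induct_rule[OF wf])
      case (1 y)
      note IHx = \<open>\<And>z. (z, x) \<in> {(x, y). mem x y} \<Longrightarrow> z \<in> elts a \<Longrightarrow> \<forall>y\<in>elts a. z \<in> elts y \<or> z = y \<or> y \<in> elts z\<close>
      note IHy = 1(1)
      have x: "x \<in> elts a" and y: "y \<in> elts a" by fact+
      show ?case
      proof (rule ccontr)
        assume n: "\<not> (x \<in> elts y \<or> x = y \<or> y \<in> elts x)"
        have "elts x = elts y"
        proof (intro set_eqI iffI)
          fix z assume z: "z \<in> elts x"
          then have "z \<in> elts y \<or> z = y \<or> y \<in> elts z"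
            using IHx[of z] tr[OF x z] y by (simp add: elts_def)
          then show "z \<in> elts y" using n z tr2[OF x z] by blast
        next
          fix z assume z: "z \<in> elts y"
          then have "x \<in> elts z \<or> x = z \<or> z \<in> elts x"
            using IHy[of z] tr[OF y z] by (simp add: elts_def)
          then show "z \<in> elts x" using n z tr2[OF y z] by blast
        qed
        then show False using n elts_inject[of x y] by blast
      qed
    qed
    then show ?case by blast
  qed
  then show ?thesis using assms(2,3) by blast
qed

text \<open>If \<open>s\<close> were smaller than \<open>r\<close>, a rational in between would lie
  in one cut and not in the other; it is positive because \<open>s\<close> is nonnegative, hence a
  quotient of naturals.\<close>

lemma real_code_le:
  assumes "real_code r x" "real_code s x"
  shows "r \<le> s"
proof (rule ccontr)
  assume "\<not> r \<le> s"
  then obtain t where t: "t \<in> \<rat>" "s < t" "t < r" using Rats_dense_in_real[of s r] by auto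
  have "0 \<le> s" using assms(2) unfolding real_code_def by simp
  then have "0 < t" using t by simp
  obtain p q :: nat where q: "q \<noteq> 0" "\<bar>t\<bar> = real p / real q"
    by (rule Rats_abs_nat_div_natE[OF t(1)])
  then have pq: "t = real p / real q" using \<open>0 < t\<close> by simp
  have "pair (vnat p) (vnat q) \<in> elts x"
    using assms(1) t(3) q(1) unfolding real_code_def pq by auto
  then have "real p / real q < s"
    using assms(2) unfolding real_code_def by auto
  then show False using t pq by simp
qed

lemma real_code_unique: "real_code r x \<Longrightarrow> real_code s x \<Longrightarrow> r = s"
  using real_code_le by (metis order_antisym)

context transitive_model begin

text \<open>Each value is sent to its least index. The choice of \<open>j\<close> is made outside
  \<open>V\<close>, but trichotomy makes the least index unique, so \<open>j\<close> is definable
  and belongs to \<open>V\<close>.\<close>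

lemma card_le_image:
  assumes \<kappa>: "\<kappa> \<in> V" "is_ordinal \<kappa>" and k: "fun_in V \<kappa> k" and F: "F \<in> V" "elts F = k ` elts \<kappa>"
  shows "card_le V F \<kappa>"
proof -
  obtain g where g: "g \<in> V" "elts g = (\<lambda>i. pair i (k i)) ` elts \<kappa>"
    using k unfolding fun_in_def by blast
  have pg: "pair i A \<in> elts g \<longleftrightarrow> i \<in> elts \<kappa> \<and> A = k i" for i A
    unfolding g(2) by auto
  have "\<exists>i. i \<in> elts \<kappa> \<and> k i = A \<and> (\<forall>i'\<in>elts i. pair i' A \<notin> elts g)" if A: "A \<in> elts F" for A
  proof -
    obtain i0 where i0: "i0 \<in> {i\<in>elts \<kappa>. k i = A}" using A unfolding F(2) by blast
    show ?thesis
    proof (rule wfE_min[OF wfp_mem[unfolded wfp_def] i0])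
      fix i assume i: "i \<in> {i\<in>elts \<kappa>. k i = A}"
        and min: "\<And>i'. (i', i) \<in> {(x, y). mem x y} \<Longrightarrow> i' \<notin> {i\<in>elts \<kappa>. k i = A}"
      have "pair i' A \<notin> elts g" if "i' \<in> elts i" for i'
        using min[of i'] that by (auto simp: pg elts_def[of i])
      then show ?thesis using i by blast
    qed
  qed
  then have "\<exists>j. \<forall>A\<in>elts F. j A \<in> elts \<kappa> \<and> k (j A) = A \<and> (\<forall>i'\<in>elts (j A). pair i' A \<notin> elts g)"
    using bchoice[of "elts F" "\<lambda>A i. i \<in> elts \<kappa> \<and> k i = A \<and> (\<forall>i'\<in>elts i. pair i' A \<notin> elts g)"] by simp
  then obtain j where "\<forall>A\<in>elts F. j A \<in> elts \<kappa> \<and> k (j A) = A \<and> (\<forall>i'\<in>elts (j A). pair i' A \<notin> elts g)"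
    by blast
  then have j: "A \<in> elts F \<Longrightarrow> j A \<in> elts \<kappa>" "A \<in> elts F \<Longrightarrow> k (j A) = A"
    "A \<in> elts F \<Longrightarrow> i \<in> elts (j A) \<Longrightarrow> pair i A \<notin> elts g" for A i
    by blast+
  have "fun_in V F j"
  proof (rule fun_inI[OF F(1), where P = "\<lambda>A i. i \<in> elts \<kappa> \<and> pair i A \<in> elts g \<and> (\<forall>i'\<in>elts i. pair i' A \<notin> elts g)"])
    show "definable (\<lambda>e. e 1 \<in> elts \<kappa> \<and> pair (e 1) (e 0) \<in> elts g \<and> (\<forall>i'\<in>elts (e 1). pair i' (e 0) \<notin> elts g))"
      by (intro definable_intros \<kappa> g)
    fix A assume A: "A \<in> elts F"
    show "j A \<in> V" by (rule transV[OF \<kappa>(1) j(1)[OF A]])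
    show "i \<in> elts \<kappa> \<and> pair i A \<in> elts g \<and> (\<forall>i'\<in>elts i. pair i' A \<notin> elts g) \<longleftrightarrow> i = j A" for i
    proof
      assume i: "i \<in> elts \<kappa> \<and> pair i A \<in> elts g \<and> (\<forall>i'\<in>elts i. pair i' A \<notin> elts g)"
      have "pair (j A) A \<in> elts g" using j(1,2)[OF A] by (simp add: pg)
      then have "j A \<notin> elts i" using i by blast
      moreover have "i \<notin> elts (j A)" using i j(3)[OF A] by blast
      ultimately show "i = j A" using ordinal_trichotomy[OF \<kappa>(2), of i "j A"] i j(1)[OF A] by blast
    next
      assume "i = j A"
      then show "i \<in> elts \<kappa> \<and> pair i A \<in> elts g \<and> (\<forall>i'\<in>elts i. pair i' A \<notin> elts g)"
        using j(1,2)[OF A] j(3)[OF A] by (simp add: pg)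
    qed
  qed
  moreover have "inj_on j (elts F)" by (rule inj_onI) (metis j(2))
  ultimately show ?thesis unfolding card_le_def using j(1) by blast
qed

end

section \<open>The truth table of codes and the sets it defines\<close>

context random_setting begin

text \<open>The recursion is on pairs of a code and a structure: truth values belong to \<open>V\<close> from the outset,
  whereas this is only a consequence of the recursion for the interpretation of a code.\<close>

definition truth_dom :: "'u set" where
  "truth_dom = {pair \<gamma> M |\<gamma> M. \<gamma> \<in> codes' \<and> M \<in> Strs}"

definition truth_sub :: "'u \<Rightarrow> 'u set" where
  "truth_sub x = {y. \<exists>\<gamma> M z. x = pair \<gamma> M \<and> z \<in> children \<gamma> \<and> y = pair z M}"

definition truth_fun :: "'u \<Rightarrow> 'u" where
  "truth_fun x = truth_value (\<exists>\<gamma> M. x = pair \<gamma> M \<and> M \<in> intp \<gamma>)"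

lemma truth_sub_pair: "truth_sub (pair \<gamma> M) = (\<lambda>z. pair z M) ` children \<gamma>"
  unfolding truth_sub_def by auto

lemma truth_fun_pair: "truth_fun (pair \<gamma> M) = truth_value (M \<in> intp \<gamma>)"
  unfolding truth_fun_def by simp

lemma truth_value_eq_iff: "y = truth_value b \<longleftrightarrow> y = vnat 1 \<and> b \<or> y = vnat 0 \<and> \<not> b"
  by (simp add: truth_value_def del: vnat.simps)

lemma vnat_1_eq_truth_value: "vnat 1 = truth_value b \<longleftrightarrow> b"
  by (simp add: truth_value_def del: vnat.simps)

lemma truth_value_in: "truth_value b \<in> V"
  unfolding truth_value_def by (rule vnat_in)

text \<open>The counterpart of \<open>code_St_char\<close>: the source of \<open>step\<close> and
  \<open>uniq\<close> for the recursion on truth values.\<close>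

lemma truth_St_iff:
  assumes \<gamma>: "\<gamma> \<in> codes'" and M: "M \<in> Strs" and T: "T \<in> V"
    and part: "\<And>z c. z \<in> children \<gamma> \<Longrightarrow> pair (pair z M) c \<in> elts T \<Longrightarrow> c = truth_value (M \<in> intp z)"
  shows "truth_St (pair \<gamma> M) y T \<longleftrightarrow>
    (\<forall>z\<in>children \<gamma>. pair (pair z M) (truth_value (M \<in> intp z)) \<in> elts T) \<and> y = truth_value (M \<in> intp \<gamma>)"
    (is "_ \<longleftrightarrow> ?tot \<and> _")
proof -
  have "(\<forall>z\<in>V. is_child \<gamma> z \<longrightarrow> (\<exists>c\<in>V. pair (pair z M) c \<in> elts T)) \<longleftrightarrow>
      (\<forall>z\<in>children \<gamma>. \<exists>c\<in>V. pair (pair z M) c \<in> elts T)"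
    unfolding children_def by auto
  also have "\<dots> \<longleftrightarrow> ?tot"
  proof (intro ball_cong refl iffI)
    fix z assume z: "z \<in> children \<gamma>" and "\<exists>c\<in>V. pair (pair z M) c \<in> elts T"
    then obtain c where c: "pair (pair z M) c \<in> elts T" by blast
    then show "pair (pair z M) (truth_value (M \<in> intp z)) \<in> elts T" using part[OF z c] by simp
  next
    fix z assume "pair (pair z M) (truth_value (M \<in> intp z)) \<in> elts T"
    then show "\<exists>c\<in>V. pair (pair z M) c \<in> elts T" using truth_value_in by blast
  qed
  finally have tot: "(\<forall>z\<in>V. is_child \<gamma> z \<longrightarrow> (\<exists>c\<in>V. pair (pair z M) c \<in> elts T)) \<longleftrightarrow> ?tot" .
  have truth: "truth \<gamma> M T \<longleftrightarrow> M \<in> intp \<gamma>" if t: ?tot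
  proof (rule truth_iff[OF \<gamma> M])
    fix z k assume z: "z \<in> children \<gamma>"
    then have "pair (pair z M) (truth_value (M \<in> intp z)) \<in> elts T" using t by blast
    then show "pair (pair z M) (vnat k) \<in> elts T \<longleftrightarrow> vnat k = truth_value (M \<in> intp z)"
      using part[OF z] by metis
  qed
  have "truth_St (pair \<gamma> M) y T \<longleftrightarrow> ?tot \<and>
     (y = vnat 1 \<and> truth \<gamma> M T \<or> y = vnat 0 \<and> \<not> truth \<gamma> M T)"
    unfolding tot[symmetric] truth_St_def using codes'_in[OF \<gamma>] Strs_in[OF M] by auto
  also have "\<dots> \<longleftrightarrow> ?tot \<and> y = truth_value (M \<in> intp \<gamma>)"
    unfolding truth_value_eq_iff using truth by blast
  finally show ?thesis .
qed

lemma fun_in_truth: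
  assumes "A \<in> V" "elts A \<subseteq> truth_dom"
  shows "fun_in V A truth_fun"
proof (rule fun_in_recursion[where D = truth_dom and sub = truth_sub and St = truth_St
      and r = "inv_image below (\<lambda>x. code_height (THE \<gamma>. \<exists>M. x = pair \<gamma> M))"])
  show "truth_dom \<subseteq> V" unfolding truth_dom_def using codes'_in Strs_in by auto
  show "wf (inv_image below (\<lambda>x. code_height (THE \<gamma>. \<exists>M. x = pair \<gamma> M)))"
    by (intro wf_inv_image wf_below)
  show "definable (\<lambda>e. truth_St (e i) (e j) (e k))" for i j k by (rule definable_truth_St)
  show "A \<in> V" "elts A \<subseteq> truth_dom" by (rule assms)+
  show "z \<in> truth_dom \<and> (z, x) \<in> inv_image below (\<lambda>x. code_height (THE \<gamma>. \<exists>M. x = pair \<gamma> M))"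
    if xD: "x \<in> truth_dom" and zs: "z \<in> truth_sub x" for x z
  proof -
    obtain \<gamma> M where x: "x = pair \<gamma> M" "\<gamma> \<in> codes'" "M \<in> Strs" using xD unfolding truth_dom_def by blast
    obtain y where y: "y \<in> children \<gamma>" "z = pair y M" using zs unfolding x(1) truth_sub_pair by blast
    show ?thesis using children(2)[OF x(2) y(1)] x y(2) unfolding truth_dom_def by auto
  qed
  show "is_set (truth_sub x)" if xD: "x \<in> truth_dom" for x
  proof -
    obtain \<gamma> M where x: "x = pair \<gamma> M" "\<gamma> \<in> codes'" "M \<in> Strs" using xD unfolding truth_dom_def by blast
    note k = is_set_vset[OF children(1)[OF x(2)]]
    have "is_set ((\<lambda>z. pair z M) ` elts (vset (children \<gamma>)))"
      by (intro fun_in_image fun_in_connective_keys k Strs_in x)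
    then show ?thesis unfolding x(1) truth_sub_pair k(2) .
  qed
next
  fix x T
  assume xD: "x \<in> truth_dom" and T: "T \<in> V"
    and tot: "\<And>z w. z \<in> truth_sub x \<Longrightarrow> pair z w \<in> elts T \<longleftrightarrow> w = truth_fun z"
  obtain \<gamma> M where x: "x = pair \<gamma> M" "\<gamma> \<in> codes'" "M \<in> Strs" using xD unfolding truth_dom_def by blast
  have *: "pair (pair z M) c \<in> elts T \<longleftrightarrow> c = truth_value (M \<in> intp z)" if "z \<in> children \<gamma>" for z c
    using tot[of "pair z M" c] that unfolding x(1) truth_sub_pair truth_fun_pair by simp
  have "truth_St x (truth_fun x) T"
    unfolding x(1) truth_fun_pair
    by (rule iffD2[OF truth_St_iff[OF x(2,3) T]]) (simp_all add: *)
  moreover have "truth_fun x \<in> V" unfolding truth_fun_def by (rule truth_value_in)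
  ultimately show "truth_fun x \<in> V \<and> truth_St x (truth_fun x) T" by blast
next
  fix x y T
  assume xD: "x \<in> truth_dom" and T: "T \<in> V" and y: "y \<in> V" "truth_St x y T"
    and part: "\<And>z w. z \<in> truth_sub x \<Longrightarrow> pair z w \<in> elts T \<Longrightarrow> w = truth_fun z"
  obtain \<gamma> M where x: "x = pair \<gamma> M" "\<gamma> \<in> codes'" "M \<in> Strs" using xD unfolding truth_dom_def by blast
  have *: "c = truth_value (M \<in> intp z)" if "z \<in> children \<gamma>" "pair (pair z M) c \<in> elts T" for z c
    using part[of "pair z M" c] that unfolding x(1) truth_sub_pair truth_fun_pair by simp
  show "y = truth_fun x \<and> (\<forall>z\<in>truth_sub x. pair z (truth_fun z) \<in> elts T)"
  proof -
    have "truth_St (pair \<gamma> M) y T" using y(2) unfolding x(1) .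
    then have "(\<forall>z\<in>children \<gamma>. pair (pair z M) (truth_value (M \<in> intp z)) \<in> elts T) \<and> y = truth_value (M \<in> intp \<gamma>)"
      by (rule iffD1[OF truth_St_iff[OF x(2,3) T], rotated]) (rule *)
    then show ?thesis unfolding x(1) truth_sub_pair by (simp add: truth_fun_pair)
  qed
qed

text \<open>A single truth table \<open>g\<close> for all codes in \<open>A\<close> and all
  structures is computed in \<open>V\<close>; with \<open>g\<close> as a parameter, both each
  interpretation and the map taking codes to interpretations become definable.\<close>

lemma fun_in_intp:
  assumes "A \<in> V" "elts A \<subseteq> codes'"
  shows "fun_in V A (\<lambda>\<gamma>. vset (intp \<gamma>))" and "\<gamma> \<in> elts A \<Longrightarrow> is_set (intp \<gamma>)"
proof -
  define B where "B = {pair \<gamma> M |\<gamma> M. \<gamma> \<in> elts A \<and> M \<in> Strs}"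
  have B: "is_set B" unfolding B_def by (intro is_set_prod is_set_elts is_set_Str assms)
  have "elts (vset B) \<subseteq> truth_dom"
    unfolding is_set_vset(2)[OF B] using assms(2) unfolding B_def truth_dom_def by blast
  from fun_in_truth[OF is_set_vset(1)[OF B] this]
  obtain g where g: "g \<in> V" "elts g = (\<lambda>x. pair x (truth_fun x)) ` B"
    unfolding fun_in_def is_set_vset(2)[OF B] by blast
  have pg: "M \<in> Strs \<and> pair (pair \<gamma> M) (vnat 1) \<in> elts g \<longleftrightarrow> M \<in> intp \<gamma>" if "\<gamma> \<in> elts A" for \<gamma> M
  proof -
    have "pair (pair \<gamma> M) c \<in> elts g \<longleftrightarrow> c = truth_value (M \<in> intp \<gamma>)" if "M \<in> Strs" for c
    proof -
      have "pair \<gamma> M \<in> B" using \<open>\<gamma> \<in> elts A\<close> that unfolding B_def by blast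
      then show ?thesis unfolding g(2) by (auto simp: truth_fun_pair intro: rev_image_eqI)
    qed
    from this[of "vnat 1"]
    have "M \<in> Strs \<and> pair (pair \<gamma> M) (vnat 1) \<in> elts g \<longleftrightarrow> M \<in> Strs \<and> M \<in> intp \<gamma>"
      unfolding vnat_1_eq_truth_value by blast
    then show ?thesis using interp_subset by blast
  qed
  note S = is_set_vset[OF is_set_Str]
  show int: "is_set (intp \<gamma>)" if "\<gamma> \<in> elts A" for \<gamma>
  proof -
    have "is_set {M\<in>Strs. pair (pair \<gamma> M) (vnat 1) \<in> elts g}"
      by (intro separation is_set_Str definable_intros g vnat_in transV[OF assms(1) that])
    also have "{M\<in>Strs. pair (pair \<gamma> M) (vnat 1) \<in> elts g} = intp \<gamma>" using pg[OF that] by blast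
    finally show ?thesis .
  qed
  show "fun_in V A (\<lambda>\<gamma>. vset (intp \<gamma>))"
  proof (rule fun_inI[OF assms(1), where P = "\<lambda>\<gamma> Y. \<forall>M\<in>V. M \<in> elts Y \<longleftrightarrow>
      M \<in> elts (vset Strs) \<and> pair (pair \<gamma> M) (vnat 1) \<in> elts g"])
    show "definable (\<lambda>e. \<forall>M\<in>V. M \<in> elts (e 1) \<longleftrightarrow>
      M \<in> elts (vset Strs) \<and> pair (pair (e 0) M) (vnat 1) \<in> elts g)"
      by (intro definable_intros S g vnat_in)
    fix \<gamma> assume \<gamma>: "\<gamma> \<in> elts A"
    note i = is_set_vset[OF int[OF \<gamma>]]
    show "vset (intp \<gamma>) \<in> V" by (rule i)
    fix Y assume Y: "Y \<in> V"
    have "(\<forall>M\<in>V. M \<in> elts Y \<longleftrightarrow> M \<in> elts (vset Strs) \<and> pair (pair \<gamma> M) (vnat 1) \<in> elts g) \<longleftrightarrow>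
        (\<forall>M\<in>V. M \<in> elts Y \<longleftrightarrow> M \<in> intp \<gamma>)"
      unfolding S(2) pg[OF \<gamma>] ..
    also have "\<dots> \<longleftrightarrow> elts Y = intp \<gamma>" by (rule elts_eq_iff[OF Y is_set_subset[OF int[OF \<gamma>]]])
    also have "\<dots> \<longleftrightarrow> Y = vset (intp \<gamma>)" using i(2) by (metis vset_elts)
    finally show "(\<forall>M\<in>V. M \<in> elts Y \<longleftrightarrow> M \<in> elts (vset Strs) \<and> pair (pair \<gamma> M) (vnat 1) \<in> elts g) \<longleftrightarrow>
        Y = vset (intp \<gamma>)" .
  qed
qed

lemma is_set_intp: "\<gamma> \<in> codes' \<Longrightarrow> is_set (intp \<gamma>)"
  using fun_in_intp(2)[of "vset {\<gamma>}" \<gamma>] codes'_in by (simp add: vset_finite_in)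

end

context random_setting begin

lemma codes_codes': "\<gamma> \<in> codes \<Longrightarrow> \<gamma> \<in> codes'"
  unfolding codes'_def by blast

section \<open>Measurability and null sets\<close>

lemmas intp_set = is_set_vset[OF is_set_intp]

text \<open>A closed family is required to contain unions and complements, so \<open>cAnd\<close> is
  treated by De Morgan's law. This needs the negated codes to be an indexed family again.\<close>

lemma indexed_family_cNeg:
  assumes "indexed_family V \<kappa> \<Gamma>"
  shows "indexed_family V \<kappa> (vset (cNeg ` elts \<Gamma>))" and "is_set (cNeg ` elts \<Gamma>)"
proof -
  obtain h where \<Gamma>: "\<Gamma> \<in> V" and h: "fun_in V \<kappa> h" "elts \<Gamma> = h ` elts \<kappa>"
    using assms unfolding indexed_family_def by blast
  have neg: "fun_in V \<Gamma> cNeg"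
  proof (rule fun_inI[OF \<Gamma>, where P = "\<lambda>x y. y = tag 1 x"])
    show "definable (\<lambda>e. e 1 = tag 1 (e 0))" by (intro definable_intros)
  qed (use transV[OF \<Gamma>] in \<open>simp_all add: cNeg_def\<close>)
  show set: "is_set (cNeg ` elts \<Gamma>)" by (rule fun_in_image[OF \<Gamma> neg])
  have "fun_in V \<kappa> (\<lambda>i. cNeg (h i))"
    by (rule fun_in_comp[OF \<kappa>_in \<Gamma> h(1) neg]) (simp add: h(2))
  moreover have "cNeg ` elts \<Gamma> = (\<lambda>i. cNeg (h i)) ` elts \<kappa>" unfolding h(2) image_image ..
  ultimately show "indexed_family V \<kappa> (vset (cNeg ` elts \<Gamma>))"
    unfolding indexed_family_def using is_set_vset[OF set] by auto
qed

text \<open>Induction on codes. The generators of a closed family are given by single literals,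
  while a basic code is a conjunction of them, so already the base case uses complements and a
  finite union.\<close>

lemma closed_family_code:
  assumes S: "closed_family V \<kappa> L X S" and "\<gamma> \<in> codes"
  shows "vset (intp \<gamma>) \<in> elts S"
proof -
  note cf = S[unfolded closed_family_def, THEN conjunct2, THEN conjunct2]
  note S_lit = cf[THEN conjunct1] and S_compl = cf[THEN conjunct2, THEN conjunct1]
    and S_union = cf[THEN conjunct2, THEN conjunct2]
  have compl: "B \<in> elts S" if "A \<in> elts S" "B \<in> V" "elts B = Strs - elts A" for A B
    using S_compl that by blast
  have union: "B \<in> elts S"
    if "F \<in> V" "elts F \<subseteq> elts S" "card_le V F \<kappa>" "B \<in> V" "elts B = (\<Union>A\<in>elts F. elts A)" for F B
    by (rule S_union[rule_format, OF that(1) conjI[OF that(2,3)] that(4,5)])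
  have lit: "vset (intp (cBasic l as)) \<in> elts S"
    if "l \<in> literals L" "set as \<subseteq> elts X" "free_vars l \<subseteq> {..<length as}" for l as
  proof -
    have "cBasic l as \<in> codes'" unfolding codes'_def basic_literals_def using that by blast
    note i = intp_set[OF this]
    have "elts (vset (intp (cBasic l as))) = {M\<in>Strs. fsat X M (\<lambda>i. as ! i) l}"
      unfolding i(2) unfolding interp_simps ..
    then show ?thesis using S_lit[rule_format, OF that(1) conjI[OF that(2,3)] i(1)] by blast
  qed
  have neg: "vset (intp (cNeg \<zeta>)) \<in> elts S" if "vset (intp \<zeta>) \<in> elts S" "\<zeta> \<in> codes'" "cNeg \<zeta> \<in> codes'" for \<zeta>
    by (rule compl[OF that(1) intp_set(1)[OF that(3)]])
      (unfold intp_set(2)[OF that(2)] intp_set(2)[OF that(3)], unfold interp_simps, rule refl)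
  have or: "vset (intp (cOr \<Gamma>)) \<in> elts S"
    if fam: "indexed_family V \<kappa> \<Gamma>" and \<Gamma>: "\<And>\<gamma>. \<gamma> \<in> elts \<Gamma> \<Longrightarrow> \<gamma> \<in> codes"
      and mem: "\<And>\<gamma>. \<gamma> \<in> elts \<Gamma> \<Longrightarrow> vset (intp \<gamma>) \<in> elts S" for \<Gamma>
  proof -
    obtain h where \<Gamma>V: "\<Gamma> \<in> V" and h: "fun_in V \<kappa> h" "elts \<Gamma> = h ` elts \<kappa>"
      using fam unfolding indexed_family_def by blast
    have sub: "elts \<Gamma> \<subseteq> codes'" using \<Gamma> codes_codes' by blast
    note f = fun_in_intp(1)[OF \<Gamma>V sub]
    note F = is_set_vset[OF fun_in_image[OF \<Gamma>V f]]
    have "fun_in V \<kappa> (\<lambda>i. vset (intp (h i)))"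
      by (rule fun_in_comp[OF \<kappa>_in \<Gamma>V h(1) f]) (simp add: h(2))
    \<comment> \<open>The family of interpretations comes as an image of \<kappa>, but closure is
      stated for families that inject into \<kappa>; this is where \<kappa> being an ordinal
      enters.\<close>
    then have card: "card_le V (vset ((\<lambda>\<gamma>. vset (intp \<gamma>)) ` elts \<Gamma>)) \<kappa>"
      by (rule card_le_image[OF \<kappa>_in ordinal _ F(1)]) (unfold F(2), simp add: h(2) image_image)
    have "cOr \<Gamma> \<in> codes'" by (intro codes_codes' borel_codes.intros fam \<Gamma>)
    note i = intp_set[OF this]
    show ?thesis
    proof (rule union[OF F(1) _ card i(1)])
      show "elts (vset ((\<lambda>\<gamma>. vset (intp \<gamma>)) ` elts \<Gamma>)) \<subseteq> elts S"
        unfolding F(2) using mem by blast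
      have "elts (vset (intp \<gamma>)) = intp \<gamma>" if "\<gamma> \<in> elts \<Gamma>" for \<gamma>
        using intp_set(2)[of \<gamma>] sub that by blast
      then show "elts (vset (intp (cOr \<Gamma>))) =
          (\<Union>A\<in>elts (vset ((\<lambda>\<gamma>. vset (intp \<gamma>)) ` elts \<Gamma>)). elts A)"
        unfolding i(2) F(2) unfolding interp_simps by simp
    qed
  qed
  show ?thesis using assms(2)
  proof induction
    case (1 \<Phi> as)
    have c: "cBasic (fConj \<Phi>) as \<in> codes'"
      by (intro codes_codes' borel_codes.intros 1)
    note i = intp_set[OF this]
    have fv: "free_vars l \<subseteq> {..<length as}" if "l \<in> elts \<Phi>" for l
      using 1(5) that by (auto simp: free_vars_simps)
    have l': "cBasic l as \<in> codes'" if "l \<in> elts \<Phi>" for l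
      using 1(3,4) fv[OF that] that unfolding codes'_def basic_literals_def by blast
    have n: "is_set (Strs - intp (cBasic l as))" if "l \<in> elts \<Phi>" for l
    proof -
      have "is_set {M\<in>Strs. M \<notin> elts (vset (intp (cBasic l as)))}"
        by (intro separation is_set_Str definable_intros intp_set l' that)
      also have "{M\<in>Strs. M \<notin> elts (vset (intp (cBasic l as)))} = Strs - intp (cBasic l as)"
        unfolding intp_set(2)[OF l'[OF that]] by blast
      finally show ?thesis .
    qed
    have nS: "vset (Strs - intp (cBasic l as)) \<in> elts S" if "l \<in> elts \<Phi>" for l
    proof (rule compl[OF lit is_set_vset(1)[OF n[OF that]]])
      show "elts (vset (Strs - intp (cBasic l as))) = Strs - elts (vset (intp (cBasic l as)))"
        unfolding is_set_vset(2)[OF n[OF that]] intp_set(2)[OF l'[OF that]] ..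
    qed (use 1(3,4) fv[OF that] that in auto)
    \<comment> \<open>The complements of the literals; the basic code is the complement of their
      union, the whole collection \<open>Strs\<close> when there are no literals.\<close>
    define F where "F = (\<lambda>l. vset (Strs - intp (cBasic l as))) ` elts \<Phi>"
    have "finite F" unfolding F_def using 1(2) by simp
    have FV: "F \<subseteq> V" unfolding F_def using is_set_vset(1)[OF n] by blast
    note F = is_set_vset[OF is_set_finite[OF \<open>finite F\<close> FV]]
    define U where "U = (\<Union>A\<in>F. elts A)"
    have U: "is_set U" unfolding U_def by (intro is_set_Union is_set_finite \<open>finite F\<close> FV)
    have "vset U \<in> elts S"
    proof (rule union[OF F(1) _ _ is_set_vset(1)[OF U]])
      show "elts (vset F) \<subseteq> elts S" unfolding F(2) unfolding F_def using nS by blast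
      show "card_le V (vset F) \<kappa>"
        using \<open>finite F\<close> by (intro card_le_finite F \<kappa>_in \<kappa>_infinite) simp
      show "elts (vset U) = (\<Union>A\<in>elts (vset F). elts A)"
        unfolding F(2) is_set_vset(2)[OF U] unfolding U_def ..
    qed
    then show ?case
    proof (rule compl[OF _ i(1)])
      have "U = (\<Union>l\<in>elts \<Phi>. Strs - intp (cBasic l as))"
        unfolding U_def F_def using is_set_vset(2)[OF n] by simp
      then show "elts (vset (intp (cBasic (fConj \<Phi>) as))) = Strs - elts (vset U)"
        unfolding i(2) is_set_vset(2)[OF U] by (auto simp: interp_simps fsat_simps)
    qed
  next
    case (2 \<zeta>)
    then show ?case by (intro neg codes_codes' borel_codes.intros)
  next
    case (3 \<Gamma>)
    then show ?case by (intro or)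
  next
    case (4 \<Gamma>)
    note N = indexed_family_cNeg[OF 4(1)]
    define N where "N = vset (cNeg ` elts \<Gamma>)"
    have eN: "elts N = cNeg ` elts \<Gamma>" unfolding N_def by (rule is_set_vset(2)[OF N(2)])
    have fam: "indexed_family V \<kappa> N" unfolding N_def by (rule N(1))
    have codes: "\<gamma> \<in> codes" if "\<gamma> \<in> elts N" for \<gamma>
      using that 4(2) unfolding eN by (auto intro: borel_codes.intros)
    have mem: "vset (intp \<gamma>) \<in> elts S" if \<gamma>: "\<gamma> \<in> elts N" for \<gamma>
    proof -
      obtain \<zeta> where \<zeta>: "\<zeta> \<in> elts \<Gamma>" "\<gamma> = cNeg \<zeta>" using \<gamma> unfolding eN by blast
      show ?thesis unfolding \<zeta>(2)
        by (intro neg codes_codes' borel_codes.intros 4(2)[OF \<zeta>(1)] 4(3)[OF \<zeta>(1)])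
    qed
    have orN: "cOr N \<in> codes'" by (intro codes_codes' borel_codes.intros fam codes)
    have andG: "cAnd \<Gamma> \<in> codes'" by (intro codes_codes' borel_codes.intros 4)
    show ?case
    proof (rule compl[OF or[OF fam codes mem] intp_set(1)[OF andG]])
      show "elts (vset (intp (cAnd \<Gamma>))) = Strs - elts (vset (intp (cOr N)))"
        unfolding intp_set(2)[OF andG] intp_set(2)[OF orN] by (auto simp: interp_simps eN)
    qed
  qed
qed

lemma measurable_code: "\<gamma> \<in> codes \<Longrightarrow> vset (intp \<gamma>) \<in> measurable_sets V \<kappa> L X"
  unfolding measurable_sets_def by (simp add: intp_set(1) codes_codes' closed_family_code)

lemma pair_code:
  assumes "\<gamma> \<in> codes" "\<zeta> \<in> codes"
  shows "cAnd (vset {\<gamma>, \<zeta>}) \<in> codes"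
proof -
  have V: "vset {\<gamma>, \<zeta>} \<in> V" using assms codes_in by (simp add: vset_finite_in)
  have "fun_in V (vset {\<gamma>, \<zeta>}) (\<lambda>x. x)"
    using V transV[OF V] by (intro fun_in_finite) auto
  moreover have "card_le V (vset {\<gamma>, \<zeta>}) \<kappa>"
    by (intro card_le_finite V \<kappa>_in \<kappa>_infinite) simp
  \<comment> \<open>Repeating one of the two codes on the remaining indices makes the doubleton a
    \<kappa>-indexed family; as it is nonempty, \<open>pad\<close> adds nothing.\<close>
  ultimately have "indexed_family V \<kappa> (vset (pad \<gamma> ((\<lambda>x. x) ` elts (vset {\<gamma>, \<zeta>}))))"
    by (intro indexed_family_pad V codes_in assms \<kappa>_in \<kappa>_nonempty)
  then have "indexed_family V \<kappa> (vset {\<gamma>, \<zeta>})" by (simp add: pad_def)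
  then show ?thesis
    by (rule borel_codes.intros) (use assms in auto)
qed

section \<open>Null sets outside a set of full measure\<close>

lemma mval_nonneg:
  assumes "probability_kappa_measure V \<kappa> L X \<mu>" "A \<in> measurable_sets V \<kappa> L X"
  shows "0 \<le> mval \<mu> A"
proof -
  obtain h where h: "elts \<mu> = (\<lambda>A. pair A (h A)) ` measurable_sets V \<kappa> L X"
    "\<forall>A\<in>measurable_sets V \<kappa> L X. \<exists>r. real_code r (h A)"
    using assms(1) unfolding probability_kappa_measure_def by blast
  obtain r where r: "real_code r (h A)" using h(2) assms(2) by blast
  have "mval \<mu> A = r"
    unfolding mval_def
  proof (rule the_equality)
    show "\<exists>x. real_code r x \<and> pair A x \<in> elts \<mu>" using r h(1) assms(2) by blast
    fix r' assume "\<exists>x. real_code r' x \<and> pair A x \<in> elts \<mu>"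
    then have "real_code r' (h A)" unfolding h(1) by auto
    then show "r' = r" using r by (rule real_code_unique)
  qed
  then show ?thesis using r unfolding real_code_def by simp
qed

text \<open>Finite additivity is extracted from additivity over the numerals: the structures split
  into \<open>\<zeta>\<close>, the part of \<open>\<gamma>\<close> outside \<open>\<zeta>\<close>,
  the rest, and empty sets. As \<open>\<zeta>\<close> carries the total mass 1, nothing is left for
  the second piece.\<close>

lemma null_outside_conull:
  assumes \<mu>: "probability_kappa_measure V \<kappa> L X \<mu>"
    and \<gamma>: "\<gamma> \<in> codes" and \<zeta>: "\<zeta> \<in> codes" and one: "mval \<mu> (vset (intp \<zeta>)) = 1"
  shows "mval \<mu> (vset (intp (cAnd (vset {\<gamma>, cNeg \<zeta>})))) = 0"
proof -
  define A where "A = cAnd (vset {\<gamma>, cNeg \<zeta>})"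
  define C where "C = cAnd (vset {cNeg \<gamma>, cNeg \<zeta>})"
  \<comment> \<open>Numerals 0, 1, 2 index the three pieces, and all others the empty set; being
    given by a case distinction on parameters, the sequence is definable.\<close>
  define c where "c n = (if n = vnat 0 then \<zeta> else if n = vnat 1 then A else if n = vnat 2 then C else cFalse)"
    for n :: 'u
  have codes: "A \<in> codes" "C \<in> codes" "\<zeta> \<in> codes" "cFalse \<in> codes"
    unfolding A_def C_def by (intro pair_code borel_codes.intros \<gamma> \<zeta> cFalse_code)+
  then have c: "c n \<in> codes" for n by (simp add: c_def)
  note i = intp_set[OF codes_codes'[OF c]]
  have AC: "intp A = intp \<gamma> - intp \<zeta>" "intp C = Strs - intp \<gamma> - intp \<zeta>"
    using interp_subset[of X Strs \<gamma>] by (auto simp: A_def C_def interp_simps)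
  note om = is_set_vset[OF is_set_omega]
  have fin: "fun_in V (vset (range vnat)) (\<lambda>n. vset (intp (c n)))"
  proof (rule fun_inI[OF om(1), where P = "\<lambda>n y. n = vnat 0 \<and> y = vset (intp \<zeta>) \<or>
      n = vnat 1 \<and> y = vset (intp A) \<or> n = vnat 2 \<and> y = vset (intp C) \<or>
      n \<noteq> vnat 0 \<and> n \<noteq> vnat 1 \<and> n \<noteq> vnat 2 \<and> y = vset (intp cFalse)"])
    show "definable (\<lambda>e. e 0 = vnat 0 \<and> e 1 = vset (intp \<zeta>) \<or>
      e 0 = vnat 1 \<and> e 1 = vset (intp A) \<or> e 0 = vnat 2 \<and> e 1 = vset (intp C) \<or>
      e 0 \<noteq> vnat 0 \<and> e 0 \<noteq> vnat 1 \<and> e 0 \<noteq> vnat 2 \<and> e 1 = vset (intp cFalse))"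
      by (intro definable_intros intp_set(1) codes_codes' codes vnat_in)
    show "vset (intp (c n)) \<in> V" for n by (rule i)
    have "(vnat 0 :: 'u) \<noteq> vnat 1" "(vnat 0 :: 'u) \<noteq> vnat 2" "(vnat 1 :: 'u) \<noteq> vnat 2"
      unfolding vnat_inject by simp_all
    then show "n = vnat 0 \<and> y = vset (intp \<zeta>) \<or>
      n = vnat 1 \<and> y = vset (intp A) \<or> n = vnat 2 \<and> y = vset (intp C) \<or>
      n \<noteq> vnat 0 \<and> n \<noteq> vnat 1 \<and> n \<noteq> vnat 2 \<and> y = vset (intp cFalse) \<longleftrightarrow> y = vset (intp (c n))" for n y
      unfolding c_def by (auto simp del: vnat.simps)
  qed
  have disj: "intp (c m) \<inter> intp (c n) = {}" if "m \<noteq> n" for m n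
    using that unfolding c_def by (auto simp: AC interp_cFalse simp del: vnat.simps)
  have "Strs \<subseteq> (\<Union>n\<in>range vnat. intp (c n))"
  proof
    fix M assume M: "M \<in> Strs"
    have c': "c (vnat 0) = \<zeta>" "c (vnat 1) = A" "c (vnat 2) = C"
      unfolding c_def vnat_inject by simp_all
    have "M \<in> intp (c (vnat 0)) \<or> M \<in> intp (c (vnat 1)) \<or> M \<in> intp (c (vnat 2))"
      unfolding c' AC using M by blast
    then show "M \<in> (\<Union>n\<in>range vnat. intp (c n))" by blast
  qed
  moreover have "(\<Union>n\<in>range vnat. intp (c n)) \<subseteq> Strs"
    by (intro UN_least interp_subset)
  ultimately have un: "Strs = (\<Union>n\<in>range vnat. intp (c n))" by (rule subset_antisym)
  have add: "additive_over V \<kappa> L X \<mu> (vset (range vnat))" and total: "mval \<mu> (vset Strs) = 1"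
    using \<mu> unfolding probability_kappa_measure_def by blast+
  have "((\<lambda>n. mval \<mu> (vset (intp (c n)))) has_sum mval \<mu> (vset Strs)) (elts (vset (range vnat)))"
  proof (rule add[unfolded additive_over_def, rule_format], intro conjI ballI impI)
    show "fun_in V (vset (range vnat)) (\<lambda>n. vset (intp (c n)))" by (rule fin)
    show "vset (intp (c n)) \<in> measurable_sets V \<kappa> L X" for n by (rule measurable_code[OF c])
    show "elts (vset (intp (c m))) \<inter> elts (vset (intp (c n))) = {}" if "m \<noteq> n" for m n
      unfolding i(2) by (rule disj[OF that])
    show "vset Strs \<in> V" by (rule is_set_vset(1)[OF is_set_Str])
    show "elts (vset Strs) = (\<Union>n\<in>elts (vset (range vnat)). elts (vset (intp (c n))))"
      unfolding i(2) om(2) is_set_vset(2)[OF is_set_Str] by (rule un)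
  qed
  then have sum: "((\<lambda>n. mval \<mu> (vset (intp (c n)))) has_sum 1) (range vnat)"
    unfolding total om(2) .
  have pos: "0 \<le> mval \<mu> (vset (intp (c n)))" for n
    by (rule mval_nonneg[OF \<mu> measurable_code[OF c]])
  \<comment> \<open>All terms are nonnegative, so the first two, which are 1 and the measure of
    \<open>A\<close>, sum to at most 1.\<close>
  have "(\<Sum>n\<in>{vnat 0, vnat 1}. mval \<mu> (vset (intp (c n)))) \<le> 1"
  proof (rule finite_sum_le_has_sum[OF sum])
    show "{vnat 0, vnat 1} \<subseteq> (range vnat :: 'u set)" by blast
  qed (simp_all add: pos)
  moreover have "(\<Sum>n\<in>{vnat 0, vnat 1}. mval \<mu> (vset (intp (c n)))) =
      mval \<mu> (vset (intp (c (vnat 0)))) + mval \<mu> (vset (intp (c (vnat 1))))"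
    by (subst sum.insert) (simp_all del: vnat.simps)
  moreover have "c (vnat 0) = \<zeta>" "c (vnat 1) = A"
    unfolding c_def vnat_inject by simp_all
  ultimately have "mval \<mu> (vset (intp A)) \<le> 0" using one by simp
  moreover have "0 \<le> mval \<mu> (vset (intp A))" by (rule mval_nonneg[OF \<mu> measurable_code[OF codes(1)]])
  ultimately show ?thesis unfolding A_def by simp
qed

end

theorem proposition6p4:
  fixes V :: "'u::set_universe set" and \<kappa> X L \<mu> G M\<^sub>G :: 'u
  assumes "model_of_set_theory V"
    and "\<kappa> \<in> V" and "is_ordinal \<kappa>" and "infinite (elts \<kappa>)"
    and "X \<in> V" and "infinite (elts X)"
    and "L \<in> V" and "relational_language L"
    and "card_le V X \<kappa>"
    and "probability_kappa_measure V \<kappa> L X \<mu>"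
    and "random_generic_filter V \<kappa> L X \<mu> G"
    and "random_generic_structure V \<kappa> L X \<mu> G M\<^sub>G"
  shows "\<forall>\<phi>\<in>almost_sure_theory V \<kappa> L X \<mu>. models X M\<^sub>G \<phi>"
proof
  fix \<phi> assume "\<phi> \<in> almost_sure_theory V \<kappa> L X \<mu>"
  then have \<phi>: "\<phi> \<in> infinitary_formulas V \<kappa> L" and fv: "free_vars \<phi> = {}"
    and one: "mval \<mu> (vset {M \<in> Str V L X. models X M \<phi>}) = 1"
    unfolding almost_sure_theory_def sentences_def by simp_all
  interpret random_setting V \<kappa> X L
    by unfold_locales (fact assms)+
  obtain x where x: "x \<in> elts X" using X_nonempty by blast
  \<comment> \<open>The translation starts from an assignment whose graph is in \<open>V\<close>.
    For a sentence any assignment will do, and a constant one is at hand.\<close>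
  obtain a where a: "asg (\<lambda>_. x) a" using ex_asg[OF x] by blast
  have indep: "fsat X M s \<phi> \<longleftrightarrow> fsat X M t \<phi>" for M s t
    by (rule fsat_cong[OF \<phi>]) (simp add: fv)
  have models: "models X M \<phi> \<longleftrightarrow> fsat X M (\<lambda>_. x) \<phi>" for M
  proof
    assume "models X M \<phi>"
    then show "fsat X M (\<lambda>_. x) \<phi>" unfolding models_def using x by auto
  next
    assume "fsat X M (\<lambda>_. x) \<phi>"
    then show "models X M \<phi>" unfolding models_def using indep by blast
  qed
  define \<zeta> where "\<zeta> = code_of X (\<lambda>_. x) \<phi>"
  \<comment> \<open>The equation is used at two values of \<open>S\<close>: the structures of
    \<open>V\<close>, where the measure is taken, and those of the generic extension, where
    \<open>M\<^sub>G\<close> lives.\<close>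
  have \<zeta>: "\<zeta> \<in> codes" and int: "interp X S \<zeta> = {M\<in>S. models X M \<phi>}" for S
    using code_of_correct[OF \<phi> a] unfolding \<zeta>_def models by blast+
  have one': "mval \<mu> (vset (intp \<zeta>)) = 1" unfolding int by (rule one)
  have "generic_filter V (positive_codes V \<kappa> L X \<mu>) (code_le V L X \<mu>) G"
    using assms(11) unfolding random_generic_filter_def .
  then obtain p where p: "p \<in> elts G" "p \<in> positive_codes V \<kappa> L X \<mu>"
    and up: "\<And>q. q \<in> positive_codes V \<kappa> L X \<mu> \<Longrightarrow> code_le V L X \<mu> p q \<Longrightarrow> q \<in> elts G"
    unfolding generic_filter_def by blast
  have "\<zeta> \<in> elts G"
  proof (rule up)
    show "\<zeta> \<in> positive_codes V \<kappa> L X \<mu>"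
      unfolding positive_codes_def code_measure_def using \<zeta> one' by simp
    have "p \<in> codes" using p(2) unfolding positive_codes_def by simp
    then show "code_le V L X \<mu> p \<zeta>"
      unfolding code_le_def code_measure_def by (rule null_outside_conull[OF assms(10) _ \<zeta> one'])
  qed
  then have "M\<^sub>G \<in> interp X (Str (generic_extension V (positive_codes V \<kappa> L X \<mu>) G) L X) \<zeta>"
    using assms(12) unfolding random_generic_structure_def by blast
  then show "models X M\<^sub>G \<phi>" unfolding int by simp
qed

end
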